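(* Let $X$ be an $F$-finite scheme, and suppose that $M$ and $N$ are coherent Cartier modules on $X$ with $C(M)=M$ and $N_{\mathrm{nil}}=0$. Then $\mathrm{Hom}_{\mathrm{Cart}}(M,N)$, the set of morphisms of Cartier modules from $M$ to $N$, is finite dimensional over $\mathbb{F}_q$, hence a finite set.
   Context: Let $p$ be a prime, $q$ a power of $p$; schemes are locally Noetherian and separated over $\mathbb{F}_q$. $F: X\to X$ is the $q$-th power Frobenius; $X$ is $F$-finite if $F$ is a finite morphism. A Cartier module on $X$ is a quasi-coherent $\mathcal{O}_X$-module $M$ together with an $\mathcal{O}_X$-linear map $C=C_M: F_*M\to M$ (equivalently an additive map $C:M\to M$ with $C(r^qm)=rC(m)$); morphisms are $\mathcal{O}_X$-linear maps commuting with the structural maps. It is coherent if $M$ is a coherent $\mathcal{O}_X$-module, and nilpotent if $C^e(M)=0$ for some $e\ge 0$. For a coherent Cartier module $N$, $N_{\mathrm{nil}}$ denotes its largest nilpotent Cartier submodule; so $N_{\mathrm{nil}}=0$ means that $N$ has no non-zero nilpotent Cartier submodule.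
   Formalization: X is also assumed quasi-compact (so Noetherian, not only locally Noetherian); without this the claim fails, e.g. for X an infinite disjoint union of copies of Spec F_q, M = N = O_X, C = id, where Hom_Cart(M,N) is an infinite product of copies of F_q. *)

theory Defs
  imports
    "HOL-Analysis.Abstract_Topology"
    "HOL-Algebra.Ring_Divisibility"
    "HOL-Algebra.Module"
    "HOL-Computational_Algebra.Primes"
begin

hide_const (open) Divisibility.prime

section \<open>Algebra\<close>

definition finitely_generated :: "('r, 'x) ring_scheme \<Rightarrow> ('r, 'm, 'y) module_scheme \<Rightarrow> bool"
  where "finitely_generated R M \<longleftrightarrow>
    (\<exists>B \<subseteq> carrier M. finite B \<and>
      (\<forall>m \<in> carrier M. \<exists>c \<in> B \<rightarrow> carrier R. m = (\<Oplus>\<^bsub>M\<^esub>b\<in>B. c b \<odot>\<^bsub>M\<^esub> b)))"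

definition linearly_independent ::
    "('r, 'x) ring_scheme \<Rightarrow> ('r, 'm, 'y) module_scheme \<Rightarrow> 'm set \<Rightarrow> bool"
  where "linearly_independent R M S \<longleftrightarrow> S \<subseteq> carrier M \<and>
    (\<forall>B c. finite B \<and> B \<subseteq> S \<and> c \<in> B \<rightarrow> carrier R \<and> (\<Oplus>\<^bsub>M\<^esub>b\<in>B. c b \<odot>\<^bsub>M\<^esub> b) = \<zero>\<^bsub>M\<^esub>
      \<longrightarrow> (\<forall>b \<in> B. c b = \<zero>\<^bsub>R\<^esub>))"

text \<open>The ring \<open>B\<close> as a module over the source of the ring homomorphism \<open>h\<close> into \<open>B\<close>.\<close>
definition module_along :: "('r \<Rightarrow> 'b) \<Rightarrow> 'b ring \<Rightarrow> ('r, 'b) module"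
  where "module_along h B =
    \<lparr>carrier = carrier B, mult = mult B, one = one B, zero = zero B, add = add B,
     smult = (\<lambda>r b. h r \<otimes>\<^bsub>B\<^esub> b)\<rparr>"

text \<open>\<open>\<rho> : A \<rightarrow> B\<close> induces an isomorphism of \<open>A\<^sub>f\<close> with \<open>B\<close>.\<close>
definition is_localization :: "'b ring \<Rightarrow> 'b \<Rightarrow> 'b ring \<Rightarrow> ('b \<Rightarrow> 'b) \<Rightarrow> bool"
  where "is_localization A f B \<rho> \<longleftrightarrow>
    \<rho> \<in> ring_hom A B \<and> \<rho> f \<in> Units B \<and>
    (\<forall>b \<in> carrier B. \<exists>n::nat. \<exists>a \<in> carrier A. \<rho> a = \<rho> f [^]\<^bsub>B\<^esub> n \<otimes>\<^bsub>B\<^esub> b) \<and>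
    (\<forall>a \<in> carrier A. \<rho> a = \<zero>\<^bsub>B\<^esub> \<longrightarrow> (\<exists>n::nat. f [^]\<^bsub>A\<^esub> n \<otimes>\<^bsub>A\<^esub> a = \<zero>\<^bsub>A\<^esub>))"

text \<open>For algebras \<open>A\<close>, \<open>B\<close>, \<open>T\<close> over a field \<open>K\<close> (with structural maps \<open>i\<close>, \<open>j\<close>), and \<open>K\<close>-algebra maps
  \<open>\<alpha> : A \<rightarrow> T\<close>, \<open>\<beta> : B \<rightarrow> T\<close>: the map from the tensor product of \<open>A\<close> and \<open>B\<close> over \<open>K\<close> to \<open>T\<close> is
  surjective and injective. As \<open>K\<close> is a field, every element of the tensor product is a sum of
  \<open>a \<otimes> b\<^sub>a\<close> over a finite linearly independent set of \<open>a\<close>'s, and it vanishes iff all \<open>b\<^sub>a\<close> do.\<close>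
definition is_tensor_product ::
    "'k ring \<Rightarrow> 'a ring \<Rightarrow> ('k \<Rightarrow> 'a) \<Rightarrow> 'b ring \<Rightarrow> 't ring \<Rightarrow> ('a \<Rightarrow> 't) \<Rightarrow> ('b \<Rightarrow> 't) \<Rightarrow> bool"
  where "is_tensor_product K A i B T \<alpha> \<beta> \<longleftrightarrow>
    (\<forall>t \<in> carrier T. \<exists>(n::nat) a b. a \<in> {..<n} \<rightarrow> carrier A \<and> b \<in> {..<n} \<rightarrow> carrier B \<and>
        t = (\<Oplus>\<^bsub>T\<^esub>l\<in>{..<n}. \<alpha> (a l) \<otimes>\<^bsub>T\<^esub> \<beta> (b l))) \<and>
    (\<forall>S b. finite S \<and> linearly_independent K (module_along i A) S \<and> b \<in> S \<rightarrow> carrier B \<and>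
        (\<Oplus>\<^bsub>T\<^esub>a\<in>S. \<alpha> a \<otimes>\<^bsub>T\<^esub> \<beta> (b a)) = \<zero>\<^bsub>T\<^esub> \<longrightarrow> (\<forall>a \<in> S. b a = \<zero>\<^bsub>B\<^esub>))"


section \<open>Sheaves and ringed spaces\<close>

text \<open>\<open>S U\<close> is the set of sections over \<open>U\<close>, and \<open>r U V\<close> is the restriction from \<open>U\<close> to \<open>V\<close>.
  Only the values on open sets matter.\<close>
definition sheaf_on :: "'a topology \<Rightarrow> ('a set \<Rightarrow> 's set) \<Rightarrow> ('a set \<Rightarrow> 'a set \<Rightarrow> 's \<Rightarrow> 's) \<Rightarrow> bool"
  where "sheaf_on T S r \<longleftrightarrow>
    (\<forall>U V. openin T U \<and> openin T V \<and> V \<subseteq> U \<longrightarrow> r U V \<in> S U \<rightarrow> S V) \<and>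
    (\<forall>U. openin T U \<longrightarrow> (\<forall>s \<in> S U. r U U s = s)) \<and>
    (\<forall>U V W. openin T U \<and> openin T V \<and> openin T W \<and> W \<subseteq> V \<and> V \<subseteq> U \<longrightarrow>
      (\<forall>s \<in> S U. r V W (r U V s) = r U W s)) \<and>
    (\<forall>\<U>. (\<forall>U \<in> \<U>. openin T U) \<longrightarrow>
      (\<forall>s \<in> S (\<Union>\<U>). \<forall>t \<in> S (\<Union>\<U>). (\<forall>U \<in> \<U>. r (\<Union>\<U>) U s = r (\<Union>\<U>) U t) \<longrightarrow> s = t)) \<and>
    (\<forall>\<U> s. (\<forall>U \<in> \<U>. openin T U \<and> s U \<in> S U) \<and>
        (\<forall>U \<in> \<U>. \<forall>V \<in> \<U>. r U (U \<inter> V) (s U) = r V (U \<inter> V) (s V)) \<longrightarrow>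
      (\<exists>t \<in> S (\<Union>\<U>). \<forall>U \<in> \<U>. r (\<Union>\<U>) U t = s U))"

record ('a, 'b) ringed_space =
  topo :: "'a topology"
  sec :: "'a set \<Rightarrow> 'b ring"
  res :: "'a set \<Rightarrow> 'a set \<Rightarrow> 'b \<Rightarrow> 'b"

definition ringed_space :: "('a, 'b) ringed_space \<Rightarrow> bool"
  where "ringed_space X \<longleftrightarrow>
    sheaf_on (topo X) (\<lambda>U. carrier (sec X U)) (res X) \<and>
    (\<forall>U. openin (topo X) U \<longrightarrow> cring (sec X U)) \<and>
    (\<forall>U V. openin (topo X) U \<and> openin (topo X) V \<and> V \<subseteq> U \<longrightarrow>
      res X U V \<in> ring_hom (sec X U) (sec X V))"

text \<open>The germ at \<open>x\<close> of the section \<open>s\<close> over \<open>U\<close> is a unit of the stalk.\<close>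
definition invertible_at :: "('a, 'b) ringed_space \<Rightarrow> 'a set \<Rightarrow> 'b \<Rightarrow> 'a \<Rightarrow> bool"
  where "invertible_at X U s x \<longleftrightarrow>
    (\<exists>V. openin (topo X) V \<and> x \<in> V \<and> V \<subseteq> U \<and> res X U V s \<in> Units (sec X V))"

definition basic_open :: "('a, 'b) ringed_space \<Rightarrow> 'a set \<Rightarrow> 'b \<Rightarrow> 'a set"
  where "basic_open X U f = {x \<in> U. invertible_at X U f x}"


section \<open>Schemes\<close>

definition prime_spectrum :: "'b ring \<Rightarrow> 'b set topology"
  where "prime_spectrum R =
    topology_generated_by ((\<lambda>f. {P. primeideal P R \<and> f \<notin> P}) ` carrier R)"

text \<open>The structure sheaf of \<open>Spec A\<close> is the sheaf with sections \<open>A\<^sub>f\<close> over \<open>D(f)\<close>, and with the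
  canonical maps of \<open>A\<close>-algebras as restrictions between these. So an isomorphism \<open>\<pi>\<close> of
  \<open>(U, \<O>|U)\<close> with \<open>Spec A\<close>, where necessarily \<open>A\<close> is \<open>\<O>(U)\<close>, is a homeomorphism such that
  \<open>A\<^sub>f\<close> is \<open>\<O>(\<pi>\<inverse>(D(f)))\<close> for every \<open>f\<close>.\<close>
definition affine_open :: "('a, 'b) ringed_space \<Rightarrow> 'a set \<Rightarrow> bool"
  where "affine_open X U \<longleftrightarrow> openin (topo X) U \<and>
    (\<exists>\<pi>. homeomorphic_map (subtopology (topo X) U) (prime_spectrum (sec X U)) \<pi> \<and>
      (\<forall>f \<in> carrier (sec X U).
        is_localization (sec X U) f (sec X {x \<in> U. f \<notin> \<pi> x}) (res X U {x \<in> U. f \<notin> \<pi> x})))"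

definition scheme :: "('a, 'b) ringed_space \<Rightarrow> bool"
  where "scheme X \<longleftrightarrow> ringed_space X \<and> (\<forall>x \<in> topspace (topo X). \<exists>U. x \<in> U \<and> affine_open X U)"

definition locally_noetherian :: "('a, 'b) ringed_space \<Rightarrow> bool"
  where "locally_noetherian X \<longleftrightarrow>
    (\<forall>x \<in> topspace (topo X). \<exists>U. x \<in> U \<and> affine_open X U \<and> noetherian_ring (sec X U))"

text \<open>Together with the previous condition: \<open>X\<close> is Noetherian. Finiteness of sets of morphisms fails
  without this, for instance for infinite disjoint unions of points.\<close>
definition quasi_compact :: "('a, 'b) ringed_space \<Rightarrow> bool"
  where "quasi_compact X \<longleftrightarrow> compact_space (topo X)"

text \<open>A scheme over (the spectrum of) a ring \<open>K\<close>; the morphism to \<open>Spec K\<close> is given by the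
  homomorphism \<open>\<iota>\<close> from \<open>K\<close> to the ring of global sections.\<close>
definition scheme_over :: "'k ring \<Rightarrow> ('a, 'b) ringed_space \<Rightarrow> ('k \<Rightarrow> 'b) \<Rightarrow> bool"
  where "scheme_over K X \<iota> \<longleftrightarrow> scheme X \<and> \<iota> \<in> ring_hom K (sec X (topspace (topo X)))"

definition structure_map :: "('a, 'b) ringed_space \<Rightarrow> ('k \<Rightarrow> 'b) \<Rightarrow> 'a set \<Rightarrow> 'k \<Rightarrow> 'b"
  where "structure_map X \<iota> U a = res X (topspace (topo X)) U (\<iota> a)"


section \<open>Morphisms of schemes\<close>

text \<open>For a morphism from \<open>X\<close> to \<open>Y\<close>, \<open>sharp f V\<close> maps the sections of \<open>Y\<close> over \<open>V\<close>
  to the sections of \<open>X\<close> over the preimage of \<open>V\<close>.\<close>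
record ('a, 'b, 'c, 'd) morphism =
  base :: "'a \<Rightarrow> 'c"
  sharp :: "'c set \<Rightarrow> 'd \<Rightarrow> 'b"

definition preimage :: "('a, 'b) ringed_space \<Rightarrow> ('a, 'b, 'c, 'd) morphism \<Rightarrow> 'c set \<Rightarrow> 'a set"
  where "preimage X f V = {x \<in> topspace (topo X). base f x \<in> V}"

text \<open>The last condition says that the maps induced on the stalks are local.\<close>
definition scheme_morphism ::
    "('a, 'b) ringed_space \<Rightarrow> ('c, 'd) ringed_space \<Rightarrow> ('a, 'b, 'c, 'd) morphism \<Rightarrow> bool"
  where "scheme_morphism X Y f \<longleftrightarrow>
    continuous_map (topo X) (topo Y) (base f) \<and>
    (\<forall>V. openin (topo Y) V \<longrightarrow> sharp f V \<in> ring_hom (sec Y V) (sec X (preimage X f V))) \<and>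
    (\<forall>V W. openin (topo Y) V \<and> openin (topo Y) W \<and> W \<subseteq> V \<longrightarrow>
      (\<forall>s \<in> carrier (sec Y V).
        sharp f W (res Y V W s) = res X (preimage X f V) (preimage X f W) (sharp f V s))) \<and>
    (\<forall>V. openin (topo Y) V \<longrightarrow> (\<forall>s \<in> carrier (sec Y V). \<forall>x \<in> preimage X f V.
      invertible_at X (preimage X f V) (sharp f V s) x \<longrightarrow> invertible_at Y V s (base f x)))"

definition morphism_over ::
    "('a, 'b) ringed_space \<Rightarrow> ('k \<Rightarrow> 'b) \<Rightarrow> ('c, 'd) ringed_space \<Rightarrow> ('k \<Rightarrow> 'd) \<Rightarrow>
     'k ring \<Rightarrow> ('a, 'b, 'c, 'd) morphism \<Rightarrow> bool"
  where "morphism_over X \<iota> Y \<kappa> K f \<longleftrightarrow> scheme_morphism X Y f \<and>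
    (\<forall>a \<in> carrier K. sharp f (topspace (topo Y)) (\<kappa> a) = \<iota> a)"

definition finite_morphism ::
    "('a, 'b) ringed_space \<Rightarrow> ('c, 'd) ringed_space \<Rightarrow> ('a, 'b, 'c, 'd) morphism \<Rightarrow> bool"
  where "finite_morphism X Y f \<longleftrightarrow> scheme_morphism X Y f \<and>
    (\<forall>V. affine_open Y V \<longrightarrow> affine_open X (preimage X f V) \<and>
      finitely_generated (sec Y V) (module_along (sharp f V) (sec X (preimage X f V))))"

definition closed_immersion ::
    "('a, 'b) ringed_space \<Rightarrow> ('c, 'd) ringed_space \<Rightarrow> ('a, 'b, 'c, 'd) morphism \<Rightarrow> bool"
  where "closed_immersion X Y f \<longleftrightarrow> scheme_morphism X Y f \<and>
    embedding_map (topo X) (topo Y) (base f) \<and>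
    closedin (topo Y) (base f ` topspace (topo X)) \<and>
    (\<forall>V. openin (topo Y) V \<longrightarrow> (\<forall>s \<in> carrier (sec X (preimage X f V)). \<forall>y \<in> V.
      \<exists>W. openin (topo Y) W \<and> y \<in> W \<and> W \<subseteq> V \<and>
        (\<exists>t \<in> carrier (sec Y W).
          sharp f W t = res X (preimage X f V) (preimage X f W) s)))"

text \<open>\<open>P\<close> is the product of \<open>X\<close> with itself over the field \<open>K\<close>, with projections \<open>p1\<close>, \<open>p2\<close>:
  it is glued from the spectra of the tensor products of \<open>\<O>(U)\<close> and \<open>\<O>(V)\<close>, for affine open
  \<open>U\<close>, \<open>V\<close>.\<close>
definition is_self_product ::
    "'k ring \<Rightarrow> ('a, 'b) ringed_space \<Rightarrow> ('k \<Rightarrow> 'b) \<Rightarrow> ('c, 'd) ringed_space \<Rightarrow> ('k \<Rightarrow> 'd) \<Rightarrow>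
     ('c, 'd, 'a, 'b) morphism \<Rightarrow> ('c, 'd, 'a, 'b) morphism \<Rightarrow> bool"
  where "is_self_product K X \<iota> P \<kappa> p1 p2 \<longleftrightarrow>
    scheme_over K P \<kappa> \<and> morphism_over P \<kappa> X \<iota> K p1 \<and> morphism_over P \<kappa> X \<iota> K p2 \<and>
    (\<forall>U V. affine_open X U \<and> affine_open X V \<longrightarrow>
      affine_open P (preimage P p1 U \<inter> preimage P p2 V) \<and>
      is_tensor_product K (sec X U) (structure_map X \<iota> U) (sec X V)
        (sec P (preimage P p1 U \<inter> preimage P p2 V))
        (\<lambda>s. res P (preimage P p1 U) (preimage P p1 U \<inter> preimage P p2 V) (sharp p1 U s))
        (\<lambda>s. res P (preimage P p2 V) (preimage P p1 U \<inter> preimage P p2 V) (sharp p2 V s)))"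

text \<open>\<open>d\<close> is a section of \<open>p\<close>, as morphisms of schemes.\<close>
definition section_of ::
    "('a, 'b) ringed_space \<Rightarrow> ('a, 'b, 'c, 'd) morphism \<Rightarrow> ('c, 'd) ringed_space \<Rightarrow>
     ('c, 'd, 'a, 'b) morphism \<Rightarrow> bool"
  where "section_of X d P p \<longleftrightarrow>
    (\<forall>x \<in> topspace (topo X). base p (base d x) = x) \<and>
    (\<forall>U. openin (topo X) U \<longrightarrow>
      (\<forall>s \<in> carrier (sec X U). sharp d (preimage P p U) (sharp p U s) = s))"

text \<open>The diagonal is a closed immersion into the product of \<open>X\<close> with itself over \<open>K\<close>. The product
  always exists, but perhaps not with points and sections in the types of \<open>X\<close>. So the types \<open>'c\<close>
  and \<open>'d\<close> of its points and sections are a parameter; in a theorem that has this condition as a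
  hypothesis for type variables \<open>'c\<close>, \<open>'d\<close> that do not occur elsewhere, they are arbitrary and impose
  no restriction.\<close>
definition separated_over ::
    "'c itself \<Rightarrow> 'd itself \<Rightarrow> 'k ring \<Rightarrow> ('a, 'b) ringed_space \<Rightarrow> ('k \<Rightarrow> 'b) \<Rightarrow> bool"
  where "separated_over (_ :: 'c itself) (_ :: 'd itself) K X \<iota> \<longleftrightarrow>
    (\<exists>(P :: ('c, 'd) ringed_space) \<kappa> p1 p2 d.
      is_self_product K X \<iota> P \<kappa> p1 p2 \<and> morphism_over X \<iota> P \<kappa> K d \<and>
      section_of X d P p1 \<and> section_of X d P p2 \<and> closed_immersion X P d)"

definition frobenius :: "nat \<Rightarrow> ('a, 'b) ringed_space \<Rightarrow> ('a, 'b, 'a, 'b) morphism"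
  where "frobenius q X = \<lparr>base = (\<lambda>x. x), sharp = (\<lambda>U s. s [^]\<^bsub>sec X U\<^esub> q)\<rparr>"

definition F_finite :: "nat \<Rightarrow> ('a, 'b) ringed_space \<Rightarrow> bool"
  where "F_finite q X \<longleftrightarrow> finite_morphism X X (frobenius q X)"


section \<open>Sheaves of modules\<close>

record ('a, 'b, 'm) sheaf_of_modules =
  msec :: "'a set \<Rightarrow> ('b, 'm) module"
  mres :: "'a set \<Rightarrow> 'a set \<Rightarrow> 'm \<Rightarrow> 'm"

definition O_module :: "('a, 'b) ringed_space \<Rightarrow> ('a, 'b, 'm, 'z) sheaf_of_modules_scheme \<Rightarrow> bool"
  where "O_module X M \<longleftrightarrow>
    sheaf_on (topo X) (\<lambda>U. carrier (msec M U)) (mres M) \<and>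
    (\<forall>U. openin (topo X) U \<longrightarrow> module (sec X U) (msec M U)) \<and>
    (\<forall>U V. openin (topo X) U \<and> openin (topo X) V \<and> V \<subseteq> U \<longrightarrow>
      (\<forall>m \<in> carrier (msec M U). \<forall>n \<in> carrier (msec M U).
        mres M U V (m \<oplus>\<^bsub>msec M U\<^esub> n) = mres M U V m \<oplus>\<^bsub>msec M V\<^esub> mres M U V n) \<and>
      (\<forall>r \<in> carrier (sec X U). \<forall>m \<in> carrier (msec M U).
        mres M U V (r \<odot>\<^bsub>msec M U\<^esub> m) = res X U V r \<odot>\<^bsub>msec M V\<^esub> mres M U V m))"

text \<open>For every affine open \<open>U\<close> and every \<open>f\<close> in \<open>\<O>(U)\<close>, the canonical map from \<open>M(U)\<^sub>f\<close>
  to \<open>M(D(f))\<close> is surjective and injective; that is, \<open>M|U\<close> is the sheaf associated with the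
  module \<open>M(U)\<close>.\<close>
definition quasi_coherent ::
    "('a, 'b) ringed_space \<Rightarrow> ('a, 'b, 'm, 'z) sheaf_of_modules_scheme \<Rightarrow> bool"
  where "quasi_coherent X M \<longleftrightarrow> O_module X M \<and>
    (\<forall>U f. affine_open X U \<and> f \<in> carrier (sec X U) \<longrightarrow>
      (\<forall>m \<in> carrier (msec M (basic_open X U f)). \<exists>k::nat. \<exists>n \<in> carrier (msec M U).
        mres M U (basic_open X U f) n =
          res X U (basic_open X U f) (f [^]\<^bsub>sec X U\<^esub> k) \<odot>\<^bsub>msec M (basic_open X U f)\<^esub> m) \<and>
      (\<forall>n \<in> carrier (msec M U).
        mres M U (basic_open X U f) n = \<zero>\<^bsub>msec M (basic_open X U f)\<^esub> \<longrightarrow>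
        (\<exists>k::nat. f [^]\<^bsub>sec X U\<^esub> k \<odot>\<^bsub>msec M U\<^esub> n = \<zero>\<^bsub>msec M U\<^esub>)))"

text \<open>Meant for locally Noetherian \<open>X\<close>, where relations between finitely many sections over an
  affine open set are automatically finitely generated.\<close>
definition coherent ::
    "('a, 'b) ringed_space \<Rightarrow> ('a, 'b, 'm, 'z) sheaf_of_modules_scheme \<Rightarrow> bool"
  where "coherent X M \<longleftrightarrow> quasi_coherent X M \<and>
    (\<forall>U. affine_open X U \<longrightarrow> finitely_generated (sec X U) (msec M U))"


section \<open>Cartier modules\<close>

record ('a, 'b, 'm) cartier = "('a, 'b, 'm) sheaf_of_modules" +
  cmap :: "'a set \<Rightarrow> 'm \<Rightarrow> 'm"

text \<open>As the Frobenius is the identity on points, the direct image of \<open>M\<close> has the sections \<open>M(U)\<close>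
  over \<open>U\<close>, on which \<open>r\<close> acts as \<open>r\<^sup>q\<close>.\<close>
definition cartier_module :: "nat \<Rightarrow> ('a, 'b) ringed_space \<Rightarrow> ('a, 'b, 'm) cartier \<Rightarrow> bool"
  where "cartier_module q X M \<longleftrightarrow> quasi_coherent X M \<and>
    (\<forall>U. openin (topo X) U \<longrightarrow>
      cmap M U \<in> carrier (msec M U) \<rightarrow> carrier (msec M U) \<and>
      (\<forall>m \<in> carrier (msec M U). \<forall>n \<in> carrier (msec M U).
        cmap M U (m \<oplus>\<^bsub>msec M U\<^esub> n) = cmap M U m \<oplus>\<^bsub>msec M U\<^esub> cmap M U n) \<and>
      (\<forall>r \<in> carrier (sec X U). \<forall>m \<in> carrier (msec M U).
        cmap M U (r [^]\<^bsub>sec X U\<^esub> q \<odot>\<^bsub>msec M U\<^esub> m) = r \<odot>\<^bsub>msec M U\<^esub> cmap M U m)) \<and>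
    (\<forall>U V. openin (topo X) U \<and> openin (topo X) V \<and> V \<subseteq> U \<longrightarrow>
      (\<forall>m \<in> carrier (msec M U). mres M U V (cmap M U m) = cmap M V (mres M U V m)))"

definition coherent_cartier_module :: "nat \<Rightarrow> ('a, 'b) ringed_space \<Rightarrow> ('a, 'b, 'm) cartier \<Rightarrow> bool"
  where "coherent_cartier_module q X M \<longleftrightarrow> cartier_module q X M \<and> coherent X M"

text \<open>\<open>C(M) = M\<close>: the image of the map of sheaves \<open>C\<close> is \<open>M\<close>, so every section is locally in the
  image.\<close>
definition structural_map_surjective :: "('a, 'b) ringed_space \<Rightarrow> ('a, 'b, 'm) cartier \<Rightarrow> bool"
  where "structural_map_surjective X M \<longleftrightarrow>
    (\<forall>U. openin (topo X) U \<longrightarrow> (\<forall>m \<in> carrier (msec M U). \<forall>x \<in> U.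
      \<exists>V. openin (topo X) V \<and> x \<in> V \<and> V \<subseteq> U \<and>
        (\<exists>n \<in> carrier (msec M V). cmap M V n = mres M U V m)))"

definition nilpotent_cartier :: "('a, 'b) ringed_space \<Rightarrow> ('a, 'b, 'm) cartier \<Rightarrow> bool"
  where "nilpotent_cartier X M \<longleftrightarrow>
    (\<exists>e::nat. \<forall>U. openin (topo X) U \<longrightarrow>
      (\<forall>m \<in> carrier (msec M U). (cmap M U ^^ e) m = \<zero>\<^bsub>msec M U\<^esub>))"

definition restrict_carriers :: "('a, 'b, 'm) cartier \<Rightarrow> ('a set \<Rightarrow> 'm set) \<Rightarrow> ('a, 'b, 'm) cartier"
  where "restrict_carriers N L = N\<lparr>msec := \<lambda>U. (msec N U)\<lparr>carrier := L U\<rparr>\<rparr>"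

definition nilpotent_cartier_submodule ::
    "nat \<Rightarrow> ('a, 'b) ringed_space \<Rightarrow> ('a, 'b, 'm) cartier \<Rightarrow> ('a set \<Rightarrow> 'm set) \<Rightarrow> bool"
  where "nilpotent_cartier_submodule q X N L \<longleftrightarrow>
    (\<forall>U. openin (topo X) U \<longrightarrow> L U \<subseteq> carrier (msec N U)) \<and>
    cartier_module q X (restrict_carriers N L) \<and>
    nilpotent_cartier X (restrict_carriers N L)"

definition largest_nilpotent_submodule ::
    "nat \<Rightarrow> ('a, 'b) ringed_space \<Rightarrow> ('a, 'b, 'm) cartier \<Rightarrow> ('a set \<Rightarrow> 'm set) \<Rightarrow> bool"
  where "largest_nilpotent_submodule q X N L \<longleftrightarrow> nilpotent_cartier_submodule q X N L \<and>
    (\<forall>L'. nilpotent_cartier_submodule q X N L' \<longrightarrow> (\<forall>U. openin (topo X) U \<longrightarrow> L' U \<subseteq> L U))"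

text \<open>A morphism is a family of maps \<open>\<phi> U : M(U) \<rightarrow> N(U)\<close> for open \<open>U\<close>; outside of its domain it is
  \<open>undefined\<close>, so that different elements of this set are different morphisms.\<close>
definition cartier_hom ::
    "('a, 'b) ringed_space \<Rightarrow> ('a, 'b, 'm) cartier \<Rightarrow> ('a, 'b, 'n) cartier \<Rightarrow>
     ('a set \<Rightarrow> 'm \<Rightarrow> 'n) set"
  where "cartier_hom X M N = {\<phi>. \<phi> \<in> extensional {U. openin (topo X) U} \<and>
    (\<forall>U. openin (topo X) U \<longrightarrow>
      \<phi> U \<in> carrier (msec M U) \<rightarrow>\<^sub>E carrier (msec N U) \<and>
      (\<forall>m \<in> carrier (msec M U). \<forall>m' \<in> carrier (msec M U).
        \<phi> U (m \<oplus>\<^bsub>msec M U\<^esub> m') = \<phi> U m \<oplus>\<^bsub>msec N U\<^esub> \<phi> U m') \<and>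
      (\<forall>r \<in> carrier (sec X U). \<forall>m \<in> carrier (msec M U).
        \<phi> U (r \<odot>\<^bsub>msec M U\<^esub> m) = r \<odot>\<^bsub>msec N U\<^esub> \<phi> U m) \<and>
      (\<forall>m \<in> carrier (msec M U). \<phi> U (cmap M U m) = cmap N U (\<phi> U m))) \<and>
    (\<forall>U V. openin (topo X) U \<and> openin (topo X) V \<and> V \<subseteq> U \<longrightarrow>
      (\<forall>m \<in> carrier (msec M U). mres N U V (\<phi> U m) = \<phi> V (mres M U V m)))}"

text \<open>The vector space of morphisms over \<open>K\<close> with its pointwise operations. The fields \<open>mult\<close> and
  \<open>one\<close> of the record are irrelevant for modules.\<close>
definition Hom_Cart ::
    "('a, 'b) ringed_space \<Rightarrow> ('k \<Rightarrow> 'b) \<Rightarrow> ('a, 'b, 'm) cartier \<Rightarrow> ('a, 'b, 'n) cartier \<Rightarrow>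
     ('k, 'a set \<Rightarrow> 'm \<Rightarrow> 'n) module"
  where "Hom_Cart X \<iota> M N =
    \<lparr>carrier = cartier_hom X M N, mult = undefined, one = undefined,
     zero = (\<lambda>U \<in> {U. openin (topo X) U}. \<lambda>m \<in> carrier (msec M U). \<zero>\<^bsub>msec N U\<^esub>),
     add = (\<lambda>\<phi> \<psi>. \<lambda>U \<in> {U. openin (topo X) U}. \<lambda>m \<in> carrier (msec M U).
       \<phi> U m \<oplus>\<^bsub>msec N U\<^esub> \<psi> U m),
     smult = (\<lambda>a \<phi>. \<lambda>U \<in> {U. openin (topo X) U}. \<lambda>m \<in> carrier (msec M U).
       structure_map X \<iota> U a \<odot>\<^bsub>msec N U\<^esub> \<phi> U m)\<rparr>"

end

theory Submission
  imports Defs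
begin

text \<open>
  Morphisms of Cartier modules are fixed points of a Frobenius-linear operator on a Noetherian
  module, and such an operator has only finitely many fixed points.

  \<^bold>\<open>The operator.\<close> Let \<open>R\<close> be the ring of an affine open set \<open>U\<close>, and write \<open>M\<close>, \<open>N\<close> for the modules of
  sections over \<open>U\<close> and \<open>H\<close> for the module of \<open>R\<close>-linear maps from \<open>M\<close> to \<open>N\<close>. Say that \<open>f\<close> in \<open>H\<close> is
  related to \<open>g\<close> in \<open>H\<close> if \<open>f C = C g\<close>. This relation is additive, and if it relates \<open>f\<close> to \<open>g\<close>, then it
  relates \<open>r f\<close> to \<open>r\<^sup>q g\<close>. Two choices of \<open>g\<close> for the same \<open>f\<close> differ by a map whose image is a
  submodule of \<open>N\<close> that \<open>C\<close> kills, hence by zero, as \<open>N\<close> has no nilpotent submodule. So on the module \<open>V\<close> of all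
  \<open>f\<close> that start an infinite chain of related maps, sending \<open>f\<close> to \<open>g\<close> is a \<open>q\<close>-linear endomorphism \<open>F\<close>,
  and the maps that commute with \<open>C\<close> are the fixed points of \<open>F\<close> (\<open>finite_cartier_linear_maps\<close>).
  As \<open>M\<close> and \<open>N\<close> are finitely generated and \<open>R\<close> is Noetherian, \<open>H\<close> and \<open>V\<close> are Noetherian.

  \<^bold>\<open>The fixed points.\<close> By Noetherian induction, it is shown for every \<open>F\<close>-stable submodule \<open>W\<close> that the
  fixed points of \<open>F\<close> fall into finitely many classes modulo \<open>W\<close> (\<open>finite_fixed\<close> is the case \<open>W = 0\<close>).
  Let \<open>a\<close> be in \<open>R\<close>. The elements of \<open>V/W\<close> that a power of \<open>a\<close> kills and the multiples of \<open>a\<close> in \<open>V/W\<close>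
  correspond to two stable submodules. A fixed point \<open>x\<close> in both is zero modulo \<open>W\<close>: from \<open>x = a v + w\<close>
  one gets \<open>x = a\<^sup>q F v + F w\<close> and so on, so that \<open>x\<close> is divisible by every power of \<open>a\<close> modulo \<open>W\<close>, but
  one power of \<open>a\<close> kills all the \<open>a\<close>-power torsion. So if both submodules are larger than \<open>W\<close>, the
  claim for them implies it for \<open>W\<close>. Otherwise every element of \<open>R\<close> acts on \<open>V/W\<close> either injectively
  or as zero; that is, \<open>V/W\<close> is torsion-free over a domain. In this situation, fixed points that are
  linearly independent over \<open>K\<close> are linearly independent over the domain: applying \<open>F\<close> to a relation
  raises its coefficients to their \<open>q\<close>-th powers, and elimination gives a shorter relation
  unless the ratios of the coefficients solve \<open>x\<^sup>q = x\<close> and hence are in \<open>K\<close>. The formal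
  version of this argument is \<open>reach_adjoin\<close>. Since \<open>V\<close> is Noetherian and \<open>K\<close> is finite, finiteness follows.

  \<^bold>\<open>Globalization.\<close> Morphisms are determined by their components on a finite cover of \<open>X\<close> by
  affine open sets with Noetherian rings (\<open>cartier_hom_eqI_affine_cover\<close>). It remains to see on an affine open
  set \<open>U\<close> that a section of \<open>N\<close> vanishes if \<open>C\<close> kills all its multiples. The sections with this
  property form a subsheaf, which is quasi-coherent as \<open>F\<close>-finiteness reduces the condition on all
  multiples to a condition on finitely many (\<open>null_extend\<close>). So it is a nilpotent Cartier submodule of \<open>N\<close>, and it is zero.
\<close>


section \<open>Roots of the Frobenius equation in a domain\<close>

text \<open>For counting roots only the values of a polynomial matter. So a monic polynomial of degree \<open>n\<close> is
  represented by its function, built up by Horner's scheme; values outside of the ring are arbitrary.\<close>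
inductive monic_polynomial_function :: "('a, 'b) ring_scheme \<Rightarrow> nat \<Rightarrow> ('a \<Rightarrow> 'a) \<Rightarrow> bool"
  for R (structure)
  where
    const: "(\<And>x. x \<in> carrier R \<Longrightarrow> f x = \<one>) \<Longrightarrow> monic_polynomial_function R 0 f"
  | step: "monic_polynomial_function R n f \<Longrightarrow> c \<in> carrier R \<Longrightarrow>
      (\<And>x. x \<in> carrier R \<Longrightarrow> g x = x \<otimes> f x \<oplus> c) \<Longrightarrow> monic_polynomial_function R (Suc n) g"

lemma (in cring) monic_polynomial_function_closed:
  "monic_polynomial_function R n f \<Longrightarrow> x \<in> carrier R \<Longrightarrow> f x \<in> carrier R"
  by (induction rule: monic_polynomial_function.induct) auto

text \<open>Synthetic division: if \<open>k\<close> is the quotient of \<open>h\<close> by \<open>x - b\<close>, then \<open>x k + h(b)\<close> is the quotient of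
  \<open>x h + c\<close>.\<close>
lemma (in cring) monic_polynomial_function_division:
  assumes "monic_polynomial_function R (Suc n) f" and b: "b \<in> carrier R"
  shows "\<exists>g. monic_polynomial_function R n g \<and> (\<forall>x \<in> carrier R. f x = (x \<ominus> b) \<otimes> g x \<oplus> f b)"
  using assms(1)
proof (induction n arbitrary: f)
  case 0
  then obtain h c where h: "monic_polynomial_function R 0 h" "c \<in> carrier R"
      and f: "\<And>x. x \<in> carrier R \<Longrightarrow> f x = x \<otimes> h x \<oplus> c"
    by (auto elim: monic_polynomial_function.cases)
  have h1: "h x = \<one>" if "x \<in> carrier R" for x
    using h(1) that by (auto elim: monic_polynomial_function.cases)
  have "f x = (x \<ominus> b) \<otimes> h x \<oplus> f b" if x: "x \<in> carrier R" for x
    using x b h(2) by (simp add: f h1) algebra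
  then show ?case
    using h(1) by blast
next
  case (Suc n)
  from Suc.prems obtain h c where h: "monic_polynomial_function R (Suc n) h" "c \<in> carrier R"
      and f: "\<And>x. x \<in> carrier R \<Longrightarrow> f x = x \<otimes> h x \<oplus> c"
    by (auto elim: monic_polynomial_function.cases)
  obtain k where k: "monic_polynomial_function R n k"
      and hk: "\<And>x. x \<in> carrier R \<Longrightarrow> h x = (x \<ominus> b) \<otimes> k x \<oplus> h b"
    using Suc.IH[OF h(1)] by blast
  have hb: "h b \<in> carrier R"
    using monic_polynomial_function_closed[OF h(1) b] .
  have "f x = (x \<ominus> b) \<otimes> (x \<otimes> k x \<oplus> h b) \<oplus> f b" if x: "x \<in> carrier R" for x
  proof -
    have "k x \<in> carrier R"
      using monic_polynomial_function_closed[OF k x] .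
    then show ?thesis
      unfolding f[OF x] f[OF b] hk[OF x] using x b hb h(2) by algebra
  qed
  moreover have "monic_polynomial_function R (Suc n) (\<lambda>x. x \<otimes> k x \<oplus> h b)"
    using k hb by (rule monic_polynomial_function.step) simp
  ultimately show ?case
    by blast
qed

lemma (in domain) monic_polynomial_function_roots:
  assumes "monic_polynomial_function R n f"
  shows "finite {x \<in> carrier R. f x = \<zero>} \<and> card {x \<in> carrier R. f x = \<zero>} \<le> n"
  using assms
proof (induction n arbitrary: f)
  case 0
  then have "{x \<in> carrier R. f x = \<zero>} = {}"
    by (auto elim: monic_polynomial_function.cases)
  then show ?case
    by (simp only: finite.emptyI card.empty simp_thms order_refl)
next
  case (Suc n)
  show ?case
  proof (cases "{x \<in> carrier R. f x = \<zero>} = {}")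
    case True
    then show ?thesis
      by (simp only: finite.emptyI card.empty simp_thms le0)
  next
    case False
    then obtain b where b: "b \<in> carrier R" "f b = \<zero>"
      by auto
    obtain g where g: "monic_polynomial_function R n g"
        and fg: "\<And>x. x \<in> carrier R \<Longrightarrow> f x = (x \<ominus> b) \<otimes> g x \<oplus> f b"
      using monic_polynomial_function_division[OF Suc.prems b(1)] by blast
    have "{x \<in> carrier R. f x = \<zero>} \<subseteq> insert b {x \<in> carrier R. g x = \<zero>}"
    proof
      fix x assume "x \<in> {x \<in> carrier R. f x = \<zero>}"
      then have x: "x \<in> carrier R" "f x = \<zero>"
        by auto
      have gx: "g x \<in> carrier R"
        using monic_polynomial_function_closed[OF g x(1)] .
      have "(x \<ominus> b) \<otimes> g x = \<zero>"
        using fg[OF x(1)] x b gx by simp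
      then have "x \<ominus> b = \<zero> \<or> g x = \<zero>"
        using integral_iff[of "x \<ominus> b" "g x"] x b gx by auto
      then show "x \<in> insert b {x \<in> carrier R. g x = \<zero>}"
        using x b by auto
    qed
    moreover have "finite {x \<in> carrier R. g x = \<zero>}" "card {x \<in> carrier R. g x = \<zero>} \<le> n"
      using Suc.IH[OF g] by auto
    ultimately show ?thesis
      using card_mono[of "insert b {x \<in> carrier R. g x = \<zero>}" "{x \<in> carrier R. f x = \<zero>}"]
        card_insert_le_m1[of "Suc n" "{x \<in> carrier R. g x = \<zero>}" b] finite_subset
      by (metis (no_types, lifting) diff_Suc_1 finite.insertI le_trans zero_less_Suc)
  qed
qed

lemma (in field) order_ge_two:
  assumes "finite (carrier R)"
  shows "2 \<le> order R"
  using card_mono[OF assms, of "{\<zero>, \<one>}"] by (simp add: order_def)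

lemma (in field) power_order_eq_self:
  assumes "finite (carrier R)" and "a \<in> carrier R"
  shows "a [^] order R = a"
proof (cases "a = \<zero>")
  case True
  moreover have "order R \<noteq> 0"
    using assms by (auto simp: order_def)
  ultimately show ?thesis
    by (simp add: nat_pow_zero)
next
  case False
  have "card (Units R) = order R - 1"
    using assms(1) by (simp add: field_Units order_def)
  moreover have "a [^] card (Units R) = \<one>"
    using False assms by (intro units_power_order_eq_one) (auto simp: field_Units)
  moreover have "order R = Suc (order R - 1)"
    using order_ge_two[OF assms(1)] by simp
  ultimately show ?thesis
    using assms(2) by (metis l_one nat_pow_Suc)
qed

text \<open>The monic polynomial \<open>x\<^sup>q - d\<^sup>q\<^sup>-\<^sup>1 x\<close> has the \<open>q\<close> distinct roots \<open>j(a) d\<close>, hence no others. This is the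
  homogeneous form of the fact that the solutions of \<open>x\<^sup>q = x\<close> in a field that contains \<open>K\<close> are the
  elements of \<open>K\<close>; it deals with a fraction \<open>c/d\<close> without a field of fractions.\<close>
lemma (in domain) homogeneous_Frobenius_roots:
  assumes "field K" and "finite (carrier K)" and "order K = q" and "j \<in> ring_hom K R"
    and c: "c \<in> carrier R" and d: "d \<in> carrier R" "d \<noteq> \<zero>"
    and eq: "c [^] q = c \<otimes> d [^] (q - 1)"
  shows "\<exists>a \<in> carrier K. c = j a \<otimes> d"
proof -
  interpret K: field K by fact
  interpret j: ring_hom_cring K R j
    using assms(4) by unfold_locales auto
  have q: "2 \<le> q"
    using K.order_ge_two assms(2,3) by simp
  let ?f = "\<lambda>x. x [^] q \<oplus> \<ominus> (d [^] (q - 1)) \<otimes> x"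
  have power: "monic_polynomial_function R k (\<lambda>x. x [^] k)" for k
  proof (induction k)
    case 0
    show ?case
      by (rule monic_polynomial_function.const) simp
  next
    case (Suc k)
    then show ?case
      by (rule monic_polynomial_function.step[of _ _ _ \<zero>]) (auto simp: m_comm)
  qed
  have power_q: "x [^] q = x \<otimes> (x \<otimes> x [^] (q - 2))" if "x \<in> carrier R" for x
  proof -
    have "q = Suc (Suc (q - 2))"
      using q by simp
    then have "x [^] q = x [^] Suc (Suc (q - 2))"
      by simp
    then show ?thesis
      using that by (simp add: m_ac)
  qed
  have "monic_polynomial_function R (Suc (q - 2)) (\<lambda>x. x \<otimes> x [^] (q - 2) \<oplus> \<ominus> (d [^] (q - 1)))"
    using power by (rule monic_polynomial_function.step) (use d in auto)
  then have "monic_polynomial_function R (Suc (Suc (q - 2))) ?f"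
    by (rule monic_polynomial_function.step[of _ _ _ \<zero>]) (use d in \<open>auto simp: power_q r_distr m_comm\<close>)
  moreover have "Suc (Suc (q - 2)) = q"
    using q by simp
  ultimately have roots: "finite {x \<in> carrier R. ?f x = \<zero>}" "card {x \<in> carrier R. ?f x = \<zero>} \<le> q"
    using monic_polynomial_function_roots[of q ?f] by simp_all
  have root: "?f x = \<zero>" if "x \<in> carrier R" "x [^] q = x \<otimes> d [^] (q - 1)" for x
    using that d by (simp add: l_minus r_minus m_comm[of _ x] r_neg)
  let ?A = "(\<lambda>a. j a \<otimes> d) ` carrier K"
  have "\<one> \<in> j ` carrier K"
    by (metis K.one_closed imageI j.hom_one)
  then have inj: "inj_on j (carrier K)"
    using one_not_zero by (intro j.ring.non_trivial_field_hom_imp_inj assms(1)) (metis singletonD)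
  have "inj_on (\<lambda>a. j a \<otimes> d) (carrier K)"
  proof (rule inj_onI)
    fix a b assume ab: "a \<in> carrier K" "b \<in> carrier K" "j a \<otimes> d = j b \<otimes> d"
    then have "j a = j b"
      using d m_rcancel by auto
    then show "a = b"
      using ab inj by (auto dest: inj_onD)
  qed
  then have "card ?A = q"
    using assms(3) by (simp add: card_image order_def)
  moreover have "?A \<subseteq> {x \<in> carrier R. ?f x = \<zero>}"
  proof clarify
    fix a assume a: "a \<in> carrier K"
    have "(j a \<otimes> d) [^] q = j (a [^]\<^bsub>K\<^esub> q) \<otimes> d [^] q"
      using a d by (simp add: nat_pow_distrib j.ring.hom_nat_pow)
    also have "\<dots> = j a \<otimes> (d [^] (q - 1) \<otimes> d)"
      using a K.power_order_eq_self assms(2,3) q d nat_pow_Suc[of d "q - 1"] by auto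
    finally show "j a \<otimes> d \<in> carrier R \<and> ?f (j a \<otimes> d) = \<zero>"
      using a d by (intro conjI root) (auto simp: m_ac)
  qed
  ultimately have "?A = {x \<in> carrier R. ?f x = \<zero>}"
    using roots by (intro card_seteq) auto
  then show ?thesis
    using root[OF c eq] c by blast
qed

lemma (in primeideal) homogeneous_Frobenius_roots_mod:
  assumes K: "field K" "finite (carrier K)" "order K = q" and j: "j \<in> ring_hom K R"
    and c: "c \<in> carrier R" and d: "d \<in> carrier R" "d \<notin> I"
    and eq: "d [^] (q - 1) \<otimes> c \<ominus> c [^] q \<in> I"
  shows "\<exists>a \<in> carrier K. j a \<otimes> d \<ominus> c \<in> I"
proof -
  interpret D: domain "R Quot I"
    by (rule quotient_is_domain)
  interpret h: ring_hom_cring R "R Quot I" "(+>) I"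
    by (rule rcos_ring_hom_cring)
  have jc: "j a \<in> carrier R" if "a \<in> carrier K" for a
    using that j by (rule ring_hom_closed[rotated])
  have eqI: "I +> x = I +> y \<longleftrightarrow> x \<ominus> y \<in> I" if "x \<in> carrier R" "y \<in> carrier R" for x y
    using quotient_eq_iff_same_a_r_cos[OF is_ideal that] by simp
  have zI: "I +> x = \<zero>\<^bsub>R Quot I\<^esub> \<longleftrightarrow> x \<in> I" if "x \<in> carrier R" for x
    using eqI[OF that zero_closed] that by (simp add: minus_eq)
  have "\<exists>a \<in> carrier K. I +> c = ((+>) I \<circ> j) a \<otimes>\<^bsub>R Quot I\<^esub> (I +> d)"
  proof (rule D.homogeneous_Frobenius_roots[OF K])
    show "(+>) I \<circ> j \<in> ring_hom K (R Quot I)"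
      using ring_hom_trans[OF j h.homh] by simp
    have "I +> (d [^] (q - 1) \<otimes> c) = I +> c [^] q"
      using eqI[of "d [^] (q - 1) \<otimes> c" "c [^] q"] c d eq by simp
    then show "(I +> c) [^]\<^bsub>R Quot I\<^esub> q = (I +> c) \<otimes>\<^bsub>R Quot I\<^esub> (I +> d) [^]\<^bsub>R Quot I\<^esub> (q - 1)"
      using c d by (simp add: D.m_comm h.ring.hom_nat_pow)
    show "I +> c \<in> carrier (R Quot I)" "I +> d \<in> carrier (R Quot I)" "I +> d \<noteq> \<zero>\<^bsub>R Quot I\<^esub>"
      using c d zI by auto
  qed
  then obtain a where "a \<in> carrier K" "I +> c = (I +> j a) \<otimes>\<^bsub>R Quot I\<^esub> (I +> d)"
    by auto
  then have "a \<in> carrier K" "I +> (j a \<otimes> d) = I +> c"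
    using d jc by auto
  then show ?thesis
    using eqI[of "j a \<otimes> d" c] c d jc by auto
qed

section \<open>Noetherian modules\<close>

text \<open>The ascending chain condition for the submodules inside \<open>V\<close>, as well-foundedness of reverse
  inclusion: this gives Noetherian induction and maximal elements at once.\<close>
definition noetherian_on :: "('r, 'x) ring_scheme \<Rightarrow> ('r, 'm, 'y) module_scheme \<Rightarrow> 'm set \<Rightarrow> bool"
  where "noetherian_on R M V \<longleftrightarrow>
    wf {(W', W). submodule W R M \<and> submodule W' R M \<and> W' \<subseteq> V \<and> W \<subset> W'}"

text \<open>For the ascending chain condition of an extension: \<open>g\<close> and \<open>h\<close> are the traces of a submodule on
  the two parts of the extension, and a strict inclusion is strict on one of them.\<close>
lemma wf_two_steps:
  assumes "wf r1" and "wf r2"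
    and "\<And>x y. (x, y) \<in> r \<Longrightarrow> (g x, g y) \<in> r1 \<or> g x = g y \<and> (h x, h y) \<in> r2"
  shows "wf r"
proof (rule wf_subset)
  show "wf (inv_image (r1 <*lex*> r2) (\<lambda>x. (g x, h x)))"
    using assms(1,2) by (intro wf_inv_image wf_lex_prod)
  show "r \<subseteq> inv_image (r1 <*lex*> r2) (\<lambda>x. (g x, h x))"
    using assms(3) by (auto simp: inv_image_def)
qed

lemma (in noetherian_ring) wf_ideals: "wf {(J, I). ideal I R \<and> ideal J R \<and> I \<subset> J}"
proof (rule ccontr)
  assume "\<not> ?thesis"
  then obtain f where f: "\<And>i. ideal (f i) R \<and> f i \<subset> f (Suc i)"
    unfolding wf_iff_no_infinite_down_chain mem_Collect_eq case_prod_conv by blast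
  then have "mono f"
    by (intro mono_iff_le_Suc[THEN iffD2]) auto
  then have "f i \<subseteq> f k \<or> f k \<subseteq> f i" for i k
    by (meson linear monoD)
  then have "subset.chain {I. ideal I R} (range f)"
    using f by (auto simp: pred_on.chain_def)
  then have "\<Union>(range f) \<in> range f"
    by (intro ideal_chain_is_trivial) auto
  then obtain k where "\<Union>(range f) = f k"
    by auto
  then show False
    using f[of k] by blast
qed

context module
begin

lemma submodule_carrier: "submodule W R M \<Longrightarrow> x \<in> W \<Longrightarrow> x \<in> carrier M"
  using submoduleE(1) by blast

lemma submodule_zero: "submodule W R M \<Longrightarrow> \<zero>\<^bsub>M\<^esub> \<in> W"
  using submodule.axioms(1) subgroup.one_closed by fastforce

lemma submodule_minus: "submodule W R M \<Longrightarrow> x \<in> W \<Longrightarrow> y \<in> W \<Longrightarrow> x \<ominus>\<^bsub>M\<^esub> y \<in> W"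
  by (simp add: M.minus_eq submoduleE)

lemma submodule_Int: "submodule W R M \<Longrightarrow> submodule W' R M \<Longrightarrow> submodule (W \<inter> W') R M"
  by (intro submoduleI) (auto simp: submoduleE submodule_zero dest: submodule_carrier)

text \<open>As \<open>\<ominus> x = (\<ominus> \<one>) x\<close>, closure under negation comes for free.\<close>
lemma submoduleI':
  assumes "W \<subseteq> carrier M" and "\<zero>\<^bsub>M\<^esub> \<in> W"
    and "\<And>x y. x \<in> W \<Longrightarrow> y \<in> W \<Longrightarrow> x \<oplus>\<^bsub>M\<^esub> y \<in> W"
    and smult: "\<And>a x. a \<in> carrier R \<Longrightarrow> x \<in> W \<Longrightarrow> a \<odot>\<^bsub>M\<^esub> x \<in> W"
  shows "submodule W R M"
proof (rule submoduleI)
  fix x assume x: "x \<in> W"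
  then have "\<ominus>\<^bsub>M\<^esub> x = (\<ominus> \<one>) \<odot>\<^bsub>M\<^esub> x"
    using assms(1) by (subst smult_l_minus) auto
  then show "\<ominus>\<^bsub>M\<^esub> x \<in> W"
    using smult[OF _ x, of "\<ominus> \<one>"] by simp
qed (use assms in auto)

lemma smult_minus_distr:
  "a \<in> carrier R \<Longrightarrow> x \<in> carrier M \<Longrightarrow> y \<in> carrier M \<Longrightarrow>
    a \<odot>\<^bsub>M\<^esub> (x \<ominus>\<^bsub>M\<^esub> y) = a \<odot>\<^bsub>M\<^esub> x \<ominus>\<^bsub>M\<^esub> a \<odot>\<^bsub>M\<^esub> y"
  by (simp add: M.minus_eq smult_r_distr smult_r_minus)

lemma smult_minus_ldistr:
  "a \<in> carrier R \<Longrightarrow> b \<in> carrier R \<Longrightarrow> x \<in> carrier M \<Longrightarrow>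
    (a \<ominus> b) \<odot>\<^bsub>M\<^esub> x = a \<odot>\<^bsub>M\<^esub> x \<ominus>\<^bsub>M\<^esub> b \<odot>\<^bsub>M\<^esub> x"
  by (simp add: M.minus_eq R.minus_eq smult_l_distr smult_l_minus)

lemma combination_in_submodule:
  assumes "submodule W R M" and "finite B" and "B \<subseteq> W" and "c \<in> B \<rightarrow> carrier R"
  shows "(\<Oplus>\<^bsub>M\<^esub>b\<in>B. c b \<odot>\<^bsub>M\<^esub> b) \<in> W"
  using assms(2,3,4)
proof (induction B rule: finite_induct)
  case empty
  then show ?case
    using submodule_zero[OF assms(1)] by simp
next
  case (insert b B)
  then have "(\<lambda>b. c b \<odot>\<^bsub>M\<^esub> b) \<in> B \<rightarrow> carrier M" "c b \<odot>\<^bsub>M\<^esub> b \<in> carrier M"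
    using submodule_carrier[OF assms(1)] by (auto simp: Pi_def)
  then have "(\<Oplus>\<^bsub>M\<^esub>b\<in>insert b B. c b \<odot>\<^bsub>M\<^esub> b) = c b \<odot>\<^bsub>M\<^esub> b \<oplus>\<^bsub>M\<^esub> (\<Oplus>\<^bsub>M\<^esub>b\<in>B. c b \<odot>\<^bsub>M\<^esub> b)"
    using insert.hyps by (intro M.finsum_insert) auto
  then show ?case
    using insert by (auto intro!: submoduleE[OF assms(1)])
qed

definition sum_with_multiples where "sum_with_multiples W x = {w \<oplus>\<^bsub>M\<^esub> r \<odot>\<^bsub>M\<^esub> x | w r. w \<in> W \<and> r \<in> carrier R}"

lemma sum_with_multiples_submodule:
  assumes W: "submodule W R M" and x: "x \<in> carrier M"
  shows "submodule (sum_with_multiples W x) R M"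
proof (rule submoduleI')
  note Wc = submodule_carrier[OF W]
  show "sum_with_multiples W x \<subseteq> carrier M"
    using x Wc by (auto simp: sum_with_multiples_def)
  show "\<zero>\<^bsub>M\<^esub> \<in> sum_with_multiples W x"
    unfolding sum_with_multiples_def mem_Collect_eq
    by (intro exI[of _ "\<zero>\<^bsub>M\<^esub>"] exI[of _ \<zero>]) (use x W submodule_zero in auto)
next
  fix u v assume "u \<in> sum_with_multiples W x" "v \<in> sum_with_multiples W x"
  then obtain w r w' r' where *: "u = w \<oplus>\<^bsub>M\<^esub> r \<odot>\<^bsub>M\<^esub> x" "w \<in> W" "r \<in> carrier R"
      "v = w' \<oplus>\<^bsub>M\<^esub> r' \<odot>\<^bsub>M\<^esub> x" "w' \<in> W" "r' \<in> carrier R"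
    by (auto simp: sum_with_multiples_def)
  then have "u \<oplus>\<^bsub>M\<^esub> v = (w \<oplus>\<^bsub>M\<^esub> w') \<oplus>\<^bsub>M\<^esub> (r \<oplus> r') \<odot>\<^bsub>M\<^esub> x"
    using x submodule_carrier[OF W] by (simp add: smult_l_distr M.a_ac)
  then show "u \<oplus>\<^bsub>M\<^esub> v \<in> sum_with_multiples W x"
    using * submoduleE(5)[OF W] unfolding sum_with_multiples_def by blast
next
  fix a u assume a: "a \<in> carrier R" and "u \<in> sum_with_multiples W x"
  then obtain w r where *: "u = w \<oplus>\<^bsub>M\<^esub> r \<odot>\<^bsub>M\<^esub> x" "w \<in> W" "r \<in> carrier R"
    by (auto simp: sum_with_multiples_def)
  then have "a \<odot>\<^bsub>M\<^esub> u = a \<odot>\<^bsub>M\<^esub> w \<oplus>\<^bsub>M\<^esub> (a \<otimes> r) \<odot>\<^bsub>M\<^esub> x"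
    using a x submodule_carrier[OF W] by (simp add: smult_r_distr smult_assoc1)
  then show "a \<odot>\<^bsub>M\<^esub> u \<in> sum_with_multiples W x"
    using * a submoduleE(4)[OF W] unfolding sum_with_multiples_def by blast
qed

lemma subset_sum_with_multiples:
  assumes W: "submodule W R M" and x: "x \<in> carrier M"
  shows "W \<subseteq> sum_with_multiples W x" and "x \<in> sum_with_multiples W x"
proof -
  have "w = w \<oplus>\<^bsub>M\<^esub> \<zero> \<odot>\<^bsub>M\<^esub> x" if "w \<in> W" for w
    using that x submodule_carrier[OF W] by simp
  then show "W \<subseteq> sum_with_multiples W x"
    unfolding sum_with_multiples_def by blast
  have "x = \<zero>\<^bsub>M\<^esub> \<oplus>\<^bsub>M\<^esub> \<one> \<odot>\<^bsub>M\<^esub> x"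
    using x by simp
  then show "x \<in> sum_with_multiples W x"
    using submodule_zero[OF W] unfolding sum_with_multiples_def by blast
qed

text \<open>Of two nested submodules of \<open>A + R x\<close>, the smaller one is the larger one if both meet \<open>A\<close> in the same
  submodule and give the same ideal of all \<open>r\<close> with \<open>r x\<close> in \<open>A\<close> plus the submodule.\<close>
lemma noetherian_on_adjoin:
  assumes "noetherian_ring R" and A: "submodule A R M" and x: "x \<in> carrier M"
    and noeth: "noetherian_on R M A"
  shows "noetherian_on R M (sum_with_multiples A x)"
  unfolding noetherian_on_def
proof (rule wf_two_steps)
  let ?I = "\<lambda>W. {r \<in> carrier R. \<exists>a\<in>A. r \<odot>\<^bsub>M\<^esub> x \<oplus>\<^bsub>M\<^esub> a \<in> W}"
  show "wf {(W', W). submodule W R M \<and> submodule W' R M \<and> W' \<subseteq> A \<and> W \<subset> W'}"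
    using noeth by (simp add: noetherian_on_def)
  show "wf {(J, I). ideal I R \<and> ideal J R \<and> I \<subset> J}"
    by (rule noetherian_ring.wf_ideals) fact
  fix W' W
  assume "(W', W) \<in> {(W', W). submodule W R M \<and> submodule W' R M \<and> W' \<subseteq> sum_with_multiples A x \<and> W \<subset> W'}"
  then have W: "submodule W R M" and W': "submodule W' R M" and sub: "W' \<subseteq> sum_with_multiples A x"
      and less: "W \<subset> W'"
    by auto
  have I: "ideal (?I U) R" if U: "submodule U R M" for U
  proof (rule idealI[OF R.ring_axioms])
    show "subgroup (?I U) (add_monoid R)"
    proof (rule R.add.subgroupI)
      have "\<zero> \<odot>\<^bsub>M\<^esub> x \<oplus>\<^bsub>M\<^esub> \<zero>\<^bsub>M\<^esub> \<in> U"
        using submodule_zero[OF U] x by simp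
      then show "?I U \<noteq> {}"
        using submodule_zero[OF A] by blast
    next
      fix r assume "r \<in> ?I U"
      then obtain a where a: "r \<in> carrier R" "a \<in> A" "r \<odot>\<^bsub>M\<^esub> x \<oplus>\<^bsub>M\<^esub> a \<in> U"
        by auto
      then have "(\<ominus> r) \<odot>\<^bsub>M\<^esub> x \<oplus>\<^bsub>M\<^esub> \<ominus>\<^bsub>M\<^esub> a = \<ominus>\<^bsub>M\<^esub> (r \<odot>\<^bsub>M\<^esub> x \<oplus>\<^bsub>M\<^esub> a)"
        using x submodule_carrier[OF A] by (simp add: smult_l_minus M.minus_add)
      then show "\<ominus> r \<in> ?I U"
        using a submoduleE(3)[OF U] submoduleE(3)[OF A]
        by (auto intro!: bexI[of _ "\<ominus>\<^bsub>M\<^esub> a"])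
    next
      fix r s assume "r \<in> ?I U" "s \<in> ?I U"
      then obtain a b where a: "r \<in> carrier R" "a \<in> A" "r \<odot>\<^bsub>M\<^esub> x \<oplus>\<^bsub>M\<^esub> a \<in> U"
          and b: "s \<in> carrier R" "b \<in> A" "s \<odot>\<^bsub>M\<^esub> x \<oplus>\<^bsub>M\<^esub> b \<in> U"
        by auto
      then have "(r \<oplus> s) \<odot>\<^bsub>M\<^esub> x \<oplus>\<^bsub>M\<^esub> (a \<oplus>\<^bsub>M\<^esub> b) = (r \<odot>\<^bsub>M\<^esub> x \<oplus>\<^bsub>M\<^esub> a) \<oplus>\<^bsub>M\<^esub> (s \<odot>\<^bsub>M\<^esub> x \<oplus>\<^bsub>M\<^esub> b)"
        using x submodule_carrier[OF A] by (simp add: smult_l_distr M.a_ac)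
      then show "r \<oplus> s \<in> ?I U"
        using a b submoduleE(5)[OF U] submoduleE(5)[OF A]
        by (auto intro!: bexI[of _ "a \<oplus>\<^bsub>M\<^esub> b"])
    qed auto
  next
    fix r s assume "r \<in> ?I U" and s: "s \<in> carrier R"
    then obtain a where a: "r \<in> carrier R" "a \<in> A" "r \<odot>\<^bsub>M\<^esub> x \<oplus>\<^bsub>M\<^esub> a \<in> U"
      by auto
    then have "(s \<otimes> r) \<odot>\<^bsub>M\<^esub> x \<oplus>\<^bsub>M\<^esub> s \<odot>\<^bsub>M\<^esub> a = s \<odot>\<^bsub>M\<^esub> (r \<odot>\<^bsub>M\<^esub> x \<oplus>\<^bsub>M\<^esub> a)"
      using x s submodule_carrier[OF A] by (simp add: smult_r_distr smult_assoc1)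
    then show "s \<otimes> r \<in> ?I U"
      using a s submoduleE(4)[OF U] submoduleE(4)[OF A]
      by (auto intro!: bexI[of _ "s \<odot>\<^bsub>M\<^esub> a"])
    then show "r \<otimes> s \<in> ?I U"
      using a s by (simp add: m_comm)
  qed
  have "W' \<subseteq> W" if eqA: "W' \<inter> A = W \<inter> A" and eqI: "?I W' = ?I W"
  proof
    fix u assume u: "u \<in> W'"
    then obtain a r where a: "a \<in> A" "r \<in> carrier R" "u = a \<oplus>\<^bsub>M\<^esub> r \<odot>\<^bsub>M\<^esub> x"
      using sub by (auto simp: sum_with_multiples_def)
    then have "r \<in> ?I W'"
      using u x submodule_carrier[OF A] by (auto simp: M.a_comm)
    then obtain b where b: "b \<in> A" "r \<odot>\<^bsub>M\<^esub> x \<oplus>\<^bsub>M\<^esub> b \<in> W"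
      unfolding eqI by auto
    let ?w = "r \<odot>\<^bsub>M\<^esub> x \<oplus>\<^bsub>M\<^esub> b"
    have carr: "a \<in> carrier M" "b \<in> carrier M" "r \<odot>\<^bsub>M\<^esub> x \<in> carrier M"
      using a b x submodule_carrier[OF A] by auto
    have "u \<ominus>\<^bsub>M\<^esub> ?w = a \<ominus>\<^bsub>M\<^esub> b"
      unfolding a(3) using carr by (simp add: M.minus_eq M.minus_add M.a_ac M.r_neg1 M.r_neg2 M.r_neg)
    then have "u \<ominus>\<^bsub>M\<^esub> ?w \<in> W' \<inter> A"
      using submodule_minus[OF A a(1) b(1)] submodule_minus[OF W' u, of ?w] b(2) less by auto
    then have "u \<ominus>\<^bsub>M\<^esub> ?w \<in> W"
      unfolding eqA by simp
    moreover have "u = (u \<ominus>\<^bsub>M\<^esub> ?w) \<oplus>\<^bsub>M\<^esub> ?w"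
      unfolding a(3) using carr by (simp add: M.minus_eq M.a_assoc M.l_neg)
    ultimately show "u \<in> W"
      using submoduleE(5)[OF W _ b(2)] by metis
  qed
  moreover have "W \<inter> A \<subseteq> W' \<inter> A" "?I W \<subseteq> ?I W'"
    using less by auto
  ultimately show "(W' \<inter> A, W \<inter> A) \<in> {(W', W). submodule W R M \<and> submodule W' R M \<and> W' \<subseteq> A \<and> W \<subset> W'} \<or>
      W' \<inter> A = W \<inter> A \<and> (?I W', ?I W) \<in> {(J, I). ideal I R \<and> ideal J R \<and> I \<subset> J}"
    using less I[OF W] I[OF W'] submodule_Int[OF W A] submodule_Int[OF W' A] by blast
qed

lemma noetherian_on_subset:
  "noetherian_on R M A \<Longrightarrow> B \<subseteq> A \<Longrightarrow> noetherian_on R M B"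
  unfolding noetherian_on_def by (erule wf_subset) auto

lemma noetherian_on_zero: "noetherian_on R M {\<zero>\<^bsub>M\<^esub>}"
proof -
  have "{(W', W). submodule W R M \<and> submodule W' R M \<and> W' \<subseteq> {\<zero>\<^bsub>M\<^esub>} \<and> W \<subset> W'} = {}"
    using submodule_zero by blast
  then show ?thesis
    unfolding noetherian_on_def by (simp only: wf_on_bot)
qed

lemma zero_submodule: "submodule {\<zero>\<^bsub>M\<^esub>} R M"
  by (rule submoduleI') auto

theorem finitely_generated_imp_noetherian:
  assumes "noetherian_ring R" and "finitely_generated R M"
  shows "noetherian_on R M (carrier M)"
proof -
  obtain B where B: "B \<subseteq> carrier M" "finite B"
      and gen: "\<And>m. m \<in> carrier M \<Longrightarrow> \<exists>c \<in> B \<rightarrow> carrier R. m = (\<Oplus>\<^bsub>M\<^esub>b\<in>B. c b \<odot>\<^bsub>M\<^esub> b)"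
    using assms(2) unfolding finitely_generated_def by blast
  have "\<exists>V. B' \<subseteq> V \<and> submodule V R M \<and> noetherian_on R M V" if "finite B'" "B' \<subseteq> carrier M" for B'
    using that
  proof (induction B' rule: finite_induct)
    case empty
    then show ?case
      using noetherian_on_zero zero_submodule by blast
  next
    case (insert b B')
    then obtain V where V: "B' \<subseteq> V" "submodule V R M" "noetherian_on R M V"
      by auto
    then show ?case
      using insert.prems noetherian_on_adjoin[OF assms(1) V(2) _ V(3), of b]
        sum_with_multiples_submodule[OF V(2), of b] subset_sum_with_multiples[OF V(2), of b]
      by (intro exI[of _ "sum_with_multiples V b"]) auto
  qed
  then obtain V where V: "B \<subseteq> V" "submodule V R M" "noetherian_on R M V"
    using B by blast
  have "carrier M \<subseteq> V"
    using gen combination_in_submodule[OF V(2) B(2) V(1)] by fastforce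
  then show ?thesis
    using V(3) noetherian_on_subset by blast
qed

text \<open>Of two nested submodules, the smaller one is the larger one if both have the same image under \<open>f\<close>
  and the same intersection with its kernel.\<close>
lemma noetherian_on_extension:
  assumes N: "module R N" and V: "submodule V R M"
    and f: "f \<in> carrier M \<rightarrow> carrier N"
      "\<And>x y. x \<in> carrier M \<Longrightarrow> y \<in> carrier M \<Longrightarrow> f (x \<oplus>\<^bsub>M\<^esub> y) = f x \<oplus>\<^bsub>N\<^esub> f y"
      "\<And>r x. r \<in> carrier R \<Longrightarrow> x \<in> carrier M \<Longrightarrow> f (r \<odot>\<^bsub>M\<^esub> x) = r \<odot>\<^bsub>N\<^esub> f x"
    and noeth: "noetherian_on R N (carrier N)" "noetherian_on R M {x \<in> V. f x = \<zero>\<^bsub>N\<^esub>}"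
  shows "noetherian_on R M V"
  unfolding noetherian_on_def
proof (rule wf_two_steps)
  interpret N: module R N by fact
  let ?K = "{x \<in> V. f x = \<zero>\<^bsub>N\<^esub>}"
  show "wf {(W', W). submodule W R N \<and> submodule W' R N \<and> W' \<subseteq> carrier N \<and> W \<subset> W'}"
      "wf {(W', W). submodule W R M \<and> submodule W' R M \<and> W' \<subseteq> ?K \<and> W \<subset> W'}"
    using noeth by (auto simp: noetherian_on_def)
  have f0: "f \<zero>\<^bsub>M\<^esub> = \<zero>\<^bsub>N\<^esub>"
    using f(3)[of \<zero> "\<zero>\<^bsub>M\<^esub>"] f(1) by (auto simp: Pi_def)
  have im: "submodule (f ` W) R N" if W: "submodule W R M" for W
  proof (rule N.submoduleI')
    note Wc = submodule_carrier[OF W]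
    show "f ` W \<subseteq> carrier N"
      using f(1) Wc by auto
    show "\<zero>\<^bsub>N\<^esub> \<in> f ` W"
      using f0 submodule_zero[OF W] by force
    show "u \<oplus>\<^bsub>N\<^esub> v \<in> f ` W" if "u \<in> f ` W" "v \<in> f ` W" for u v
      using that f(2) Wc submoduleE(5)[OF W] by (auto simp: image_iff) metis
    show "a \<odot>\<^bsub>N\<^esub> v \<in> f ` W" if "a \<in> carrier R" "v \<in> f ` W" for a v
      using that f(3) Wc submoduleE(4)[OF W] by (auto simp: image_iff) metis
  qed
  have K: "submodule ?K R M"
    by (rule submoduleI')
      (use submodule_carrier[OF V] submodule_zero[OF V] f0 f(2,3) submoduleE(4,5)[OF V] in auto)
  fix W' W
  assume "(W', W) \<in> {(W', W). submodule W R M \<and> submodule W' R M \<and> W' \<subseteq> V \<and> W \<subset> W'}"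
  then have W: "submodule W R M" and W': "submodule W' R M" and sub: "W' \<subseteq> V" and less: "W \<subset> W'"
    by auto
  have "W' \<subseteq> W" if eqf: "f ` W' = f ` W" and eqK: "W' \<inter> ?K = W \<inter> ?K"
  proof
    fix u assume u: "u \<in> W'"
    then obtain w where w: "w \<in> W" "f u = f w"
      using eqf by (metis imageE imageI)
    have carr: "u \<in> carrier M" "w \<in> carrier M"
      using u w W W' submodule_carrier by auto
    have uw: "u = (u \<ominus>\<^bsub>M\<^esub> w) \<oplus>\<^bsub>M\<^esub> w"
      using carr by (simp add: M.minus_eq M.a_assoc M.l_neg)
    then have "f u = f (u \<ominus>\<^bsub>M\<^esub> w) \<oplus>\<^bsub>N\<^esub> f w"
      using f(2) carr by (metis M.minus_closed)
    then have "f (u \<ominus>\<^bsub>M\<^esub> w) = \<zero>\<^bsub>N\<^esub>"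
      using w(2) f(1) carr by (metis M.minus_closed N.add.r_cancel_one' PiE)
    moreover have d: "u \<ominus>\<^bsub>M\<^esub> w \<in> W'"
      using submodule_minus[OF W' u] w(1) less by auto
    ultimately have "u \<ominus>\<^bsub>M\<^esub> w \<in> W' \<inter> ?K"
      using sub by auto
    then have "u \<ominus>\<^bsub>M\<^esub> w \<in> W"
      unfolding eqK by simp
    then show "u \<in> W"
      using uw submoduleE(5)[OF W _ w(1)] by metis
  qed
  moreover have "W \<inter> ?K \<subseteq> W' \<inter> ?K" "f ` W \<subseteq> f ` W'" "f ` W' \<subseteq> carrier N"
    using less f(1) submodule_carrier[OF W'] by auto
  ultimately show "(f ` W', f ` W) \<in> {(W', W). submodule W R N \<and> submodule W' R N \<and> W' \<subseteq> carrier N \<and> W \<subset> W'} \<or>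
      f ` W' = f ` W \<and> (W' \<inter> ?K, W \<inter> ?K) \<in> {(W', W). submodule W R M \<and> submodule W' R M \<and> W' \<subseteq> ?K \<and> W \<subset> W'}"
    using less im[OF W] im[OF W'] submodule_Int[OF W K] submodule_Int[OF W' K] by blast
qed

end

section \<open>Fixed points of Frobenius-linear endomorphisms\<close>

lemma (in abelian_group) diff_add_cancel: "x \<in> carrier G \<Longrightarrow> y \<in> carrier G \<Longrightarrow> (x \<ominus> y) \<oplus> y = x"
  by (simp add: minus_eq a_assoc l_neg)

lemma (in abelian_group) add_diff_cancel: "x \<in> carrier G \<Longrightarrow> y \<in> carrier G \<Longrightarrow> (x \<oplus> y) \<ominus> y = x"
  by (simp add: minus_eq a_assoc r_neg)

lemma (in abelian_group) diff_diff_cancel: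
  "x \<in> carrier G \<Longrightarrow> y \<in> carrier G \<Longrightarrow> z \<in> carrier G \<Longrightarrow> (x \<ominus> z) \<ominus> (y \<ominus> z) = x \<ominus> y"
  using a_lcomm[of z "\<ominus> y" "\<ominus> z"] by (simp add: minus_eq minus_add a_ac r_neg1 r_neg2 r_neg)

lemma (in abelian_group) diff_add_diff:
  "x \<in> carrier G \<Longrightarrow> y \<in> carrier G \<Longrightarrow> z \<in> carrier G \<Longrightarrow> (x \<ominus> y) \<oplus> (y \<ominus> z) = x \<ominus> z"
  by (simp add: minus_eq minus_add a_ac r_neg1 r_neg2 r_neg)

lemma (in abelian_group) diff_diff_self:
  "x \<in> carrier G \<Longrightarrow> y \<in> carrier G \<Longrightarrow> x \<ominus> (x \<ominus> y) = y"
  using a_lcomm[of x y "\<ominus> x"] by (simp add: minus_eq minus_add a_ac r_neg1 r_neg2 r_neg)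

locale q_linear_module = module R M for R (structure) and M (structure) +
  fixes K and j and q :: nat and F
  assumes noeth: "noetherian_on R M (carrier M)"
    and F: "F \<in> carrier M \<rightarrow> carrier M"
    and F_add: "\<And>x y. x \<in> carrier M \<Longrightarrow> y \<in> carrier M \<Longrightarrow> F (x \<oplus>\<^bsub>M\<^esub> y) = F x \<oplus>\<^bsub>M\<^esub> F y"
    and F_smult: "\<And>r x. r \<in> carrier R \<Longrightarrow> x \<in> carrier M \<Longrightarrow> F (r \<odot>\<^bsub>M\<^esub> x) = r [^] q \<odot>\<^bsub>M\<^esub> F x"
    and K: "field K" "finite (carrier K)" "order K = q" and j: "j \<in> ring_hom K R"
begin

sublocale K: field K
  by (rule K(1))

sublocale j: ring_hom_cring K R j
  using j by unfold_locales

lemma q_ge_two: "2 \<le> q"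
  using K.order_ge_two K by simp

definition fixed where "fixed = {x \<in> carrier M. F x = x}"
text \<open>The class of \<open>s\<close> modulo \<open>W\<close>, cut down to the fixed points. Counting the sets \<open>fixed_class W s\<close> replaces
  counting the image of the fixed points in a quotient module.\<close>
definition fixed_class where "fixed_class W s = {x \<in> fixed. s \<ominus>\<^bsub>M\<^esub> x \<in> W}"
definition stable where "stable W \<longleftrightarrow> submodule W R M \<and> F ` W \<subseteq> W"
text \<open>The preimages in \<open>M\<close> of the \<open>a\<close>-power torsion of \<open>M/W\<close> and of \<open>a (M/W)\<close>, and the annihilator of \<open>M/W\<close>.\<close>
definition torsion where "torsion W a = {x \<in> carrier M. \<exists>k::nat. a [^] k \<odot>\<^bsub>M\<^esub> x \<in> W}"
definition multiples where "multiples W a = {a \<odot>\<^bsub>M\<^esub> v \<oplus>\<^bsub>M\<^esub> w | v w. v \<in> carrier M \<and> w \<in> W}"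
definition annihilator where "annihilator W = {a \<in> carrier R. \<forall>v \<in> carrier M. a \<odot>\<^bsub>M\<^esub> v \<in> W}"
text \<open>If \<open>R\<close> acts on \<open>M/W\<close> through a domain, these are the fixed points that are torsion over this domain
  modulo \<open>U\<close>.\<close>
definition reach where "reach W U = {s \<in> fixed. \<exists>c \<in> carrier R - annihilator W. c \<odot>\<^bsub>M\<^esub> s \<in> U}"

lemma F_zero: "F \<zero>\<^bsub>M\<^esub> = \<zero>\<^bsub>M\<^esub>"
  using F_add[of "\<zero>\<^bsub>M\<^esub>" "\<zero>\<^bsub>M\<^esub>"] F by (metis M.add.r_cancel_one' M.zero_closed M.l_zero PiE)

lemma F_minus:
  assumes "x \<in> carrier M" and "y \<in> carrier M"
  shows "F (x \<ominus>\<^bsub>M\<^esub> y) = F x \<ominus>\<^bsub>M\<^esub> F y"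
proof -
  have "F x = F (x \<ominus>\<^bsub>M\<^esub> y) \<oplus>\<^bsub>M\<^esub> F y"
    using F_add[of "x \<ominus>\<^bsub>M\<^esub> y" y] assms by (simp add: M.diff_add_cancel)
  moreover have "F (x \<ominus>\<^bsub>M\<^esub> y) \<in> carrier M" "F y \<in> carrier M"
    using F assms by auto
  ultimately show ?thesis
    by (simp add: M.add_diff_cancel)
qed

lemma fixed_carrier: "x \<in> fixed \<Longrightarrow> x \<in> carrier M"
  by (simp add: fixed_def)

lemma fixed_minus: "x \<in> fixed \<Longrightarrow> y \<in> fixed \<Longrightarrow> x \<ominus>\<^bsub>M\<^esub> y \<in> fixed"
  by (simp add: fixed_def F_minus)

lemma fixed_scale: "a \<in> carrier K \<Longrightarrow> x \<in> fixed \<Longrightarrow> j a \<odot>\<^bsub>M\<^esub> x \<in> fixed"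
  using F_smult[of "j a" x] K.power_order_eq_self[of a]
  by (simp add: fixed_def K flip: j.ring.hom_nat_pow)

lemma stable_torsion:
  assumes W: "stable W" and a: "a \<in> carrier R"
  shows "stable (torsion W a)" and "W \<subseteq> torsion W a"
proof -
  have Wm: "submodule W R M" and WF: "\<And>x. x \<in> W \<Longrightarrow> F x \<in> W"
    using W by (auto simp: stable_def)
  note Wc = submodule_carrier[OF Wm]
  have up: "a [^] (k + l) \<odot>\<^bsub>M\<^esub> x \<in> W" if "a [^] k \<odot>\<^bsub>M\<^esub> x \<in> W" "x \<in> carrier M" for k l :: nat and x
  proof -
    have "a [^] (k + l) \<odot>\<^bsub>M\<^esub> x = a [^] l \<odot>\<^bsub>M\<^esub> (a [^] k \<odot>\<^bsub>M\<^esub> x)"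
      using a that(2) by (simp add: smult_assoc1[symmetric] nat_pow_mult add.commute)
    then show ?thesis
      using that a submoduleE(4)[OF Wm] by simp
  qed
  have "submodule (torsion W a) R M"
  proof (rule submoduleI')
    show "\<zero>\<^bsub>M\<^esub> \<in> torsion W a"
      using a submodule_zero[OF Wm] by (auto simp: torsion_def)
  next
    fix x y assume "x \<in> torsion W a" "y \<in> torsion W a"
    then obtain k l :: nat where *: "a [^] k \<odot>\<^bsub>M\<^esub> x \<in> W" "x \<in> carrier M"
        "a [^] l \<odot>\<^bsub>M\<^esub> y \<in> W" "y \<in> carrier M"
      by (auto simp: torsion_def)
    then have "a [^] (k + l) \<odot>\<^bsub>M\<^esub> x \<oplus>\<^bsub>M\<^esub> a [^] (k + l) \<odot>\<^bsub>M\<^esub> y \<in> W"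
      using up[of k x l] up[of l y k] by (simp add: submoduleE(5)[OF Wm] add.commute)
    then show "x \<oplus>\<^bsub>M\<^esub> y \<in> torsion W a"
      using * a unfolding torsion_def by (auto simp flip: smult_r_distr)
  next
    fix r x assume r: "r \<in> carrier R" and "x \<in> torsion W a"
    then obtain k :: nat where *: "a [^] k \<odot>\<^bsub>M\<^esub> x \<in> W" "x \<in> carrier M"
      by (auto simp: torsion_def)
    then have "a [^] k \<odot>\<^bsub>M\<^esub> (r \<odot>\<^bsub>M\<^esub> x) = r \<odot>\<^bsub>M\<^esub> (a [^] k \<odot>\<^bsub>M\<^esub> x)"
      using a r by (simp add: smult_assoc1[symmetric] m_comm)
    then show "r \<odot>\<^bsub>M\<^esub> x \<in> torsion W a"
      using * r submoduleE(4)[OF Wm] by (simp add: torsion_def) metis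
  qed (auto simp: torsion_def)
  moreover have "F ` torsion W a \<subseteq> torsion W a"
  proof clarify
    fix x assume "x \<in> torsion W a"
    then obtain k :: nat where *: "a [^] k \<odot>\<^bsub>M\<^esub> x \<in> W" "x \<in> carrier M"
      by (auto simp: torsion_def)
    then have "F (a [^] k \<odot>\<^bsub>M\<^esub> x) = a [^] (k * q) \<odot>\<^bsub>M\<^esub> F x"
      using a by (simp add: F_smult nat_pow_pow)
    then show "F x \<in> torsion W a"
      using WF[OF *(1)] *(2) F unfolding torsion_def by auto
  qed
  ultimately show "stable (torsion W a)"
    by (simp add: stable_def)
  have "a [^] (0::nat) \<odot>\<^bsub>M\<^esub> x \<in> W" if "x \<in> W" for x
    using that Wc by simp
  then show "W \<subseteq> torsion W a"
    using Wc unfolding torsion_def by blast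
qed

lemma stable_multiples:
  assumes W: "stable W" and a: "a \<in> carrier R"
  shows "stable (multiples W a)" and "W \<subseteq> multiples W a"
proof -
  have Wm: "submodule W R M" and WF: "\<And>x. x \<in> W \<Longrightarrow> F x \<in> W"
    using W by (auto simp: stable_def)
  note Wc = submodule_carrier[OF Wm]
  note q = q_ge_two
  have "submodule (multiples W a) R M"
  proof (rule submoduleI')
    show "multiples W a \<subseteq> carrier M"
      using a Wc by (auto simp: multiples_def)
    show "\<zero>\<^bsub>M\<^esub> \<in> multiples W a"
      unfolding multiples_def mem_Collect_eq
      by (intro exI[of _ "\<zero>\<^bsub>M\<^esub>"]) (use a submodule_zero[OF Wm] in auto)
  next
    fix x y assume "x \<in> multiples W a" "y \<in> multiples W a"
    then obtain v w v' w' where *: "x = a \<odot>\<^bsub>M\<^esub> v \<oplus>\<^bsub>M\<^esub> w" "v \<in> carrier M" "w \<in> W"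
        "y = a \<odot>\<^bsub>M\<^esub> v' \<oplus>\<^bsub>M\<^esub> w'" "v' \<in> carrier M" "w' \<in> W"
      by (auto simp: multiples_def)
    then have "x \<oplus>\<^bsub>M\<^esub> y = a \<odot>\<^bsub>M\<^esub> (v \<oplus>\<^bsub>M\<^esub> v') \<oplus>\<^bsub>M\<^esub> (w \<oplus>\<^bsub>M\<^esub> w')"
      using a Wc by (simp add: smult_r_distr M.a_ac)
    then show "x \<oplus>\<^bsub>M\<^esub> y \<in> multiples W a"
      unfolding multiples_def using * submoduleE(5)[OF Wm] by blast
  next
    fix r x assume r: "r \<in> carrier R" and "x \<in> multiples W a"
    then obtain v w where *: "x = a \<odot>\<^bsub>M\<^esub> v \<oplus>\<^bsub>M\<^esub> w" "v \<in> carrier M" "w \<in> W"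
      by (auto simp: multiples_def)
    then have "r \<odot>\<^bsub>M\<^esub> x = a \<odot>\<^bsub>M\<^esub> (r \<odot>\<^bsub>M\<^esub> v) \<oplus>\<^bsub>M\<^esub> (r \<odot>\<^bsub>M\<^esub> w)"
      using a r Wc by (simp add: smult_r_distr smult_assoc1[symmetric] m_comm)
    then show "r \<odot>\<^bsub>M\<^esub> x \<in> multiples W a"
      unfolding multiples_def using * r submoduleE(4)[OF Wm] by blast
  qed
  moreover have "F ` multiples W a \<subseteq> multiples W a"
  proof clarify
    fix x assume "x \<in> multiples W a"
    then obtain v w where *: "x = a \<odot>\<^bsub>M\<^esub> v \<oplus>\<^bsub>M\<^esub> w" "v \<in> carrier M" "w \<in> W"
      by (auto simp: multiples_def)
    have "F x = a [^] q \<odot>\<^bsub>M\<^esub> F v \<oplus>\<^bsub>M\<^esub> F w"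
      using * a Wc by (simp add: F_add F_smult)
    also have "a [^] q = a \<otimes> a [^] (q - 1)"
      using a q nat_pow_mult[of a 1 "q - 1"] by simp
    also have "\<dots> \<odot>\<^bsub>M\<^esub> F v = a \<odot>\<^bsub>M\<^esub> (a [^] (q - 1) \<odot>\<^bsub>M\<^esub> F v)"
      using a * F by (simp add: smult_assoc1 Pi_iff)
    finally have Fx: "F x = a \<odot>\<^bsub>M\<^esub> (a [^] (q - 1) \<odot>\<^bsub>M\<^esub> F v) \<oplus>\<^bsub>M\<^esub> F w" .
    have "a [^] (q - 1) \<odot>\<^bsub>M\<^esub> F v \<in> carrier M"
      using a * F by auto
    then show "F x \<in> multiples W a"
      unfolding multiples_def using Fx WF *(3) by blast
  qed
  ultimately show "stable (multiples W a)"
    by (simp add: stable_def)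
  have "w = a \<odot>\<^bsub>M\<^esub> \<zero>\<^bsub>M\<^esub> \<oplus>\<^bsub>M\<^esub> w" if "w \<in> W" for w
    using that a Wc by simp
  then show "W \<subseteq> multiples W a"
    unfolding multiples_def by blast
qed

text \<open>Modulo \<open>W\<close>, a fixed multiple of \<open>a\<close> is divisible by every power of \<open>a\<close>, because applying the
  \<open>q\<close>-linear map \<open>F\<close> raises the exponent. But a single power of \<open>a\<close> kills the whole \<open>a\<close>-power torsion of
  \<open>M/W\<close>, as \<open>M\<close> is Noetherian.\<close>
lemma fixed_torsion_multiples:
  assumes W: "stable W" and a: "a \<in> carrier R"
  shows "fixed \<inter> torsion W a \<inter> multiples W a \<subseteq> W"
proof clarify
  have Wm: "submodule W R M" and WF: "\<And>x. x \<in> W \<Longrightarrow> F x \<in> W"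
    using W by (auto simp: stable_def)
  note Wc = submodule_carrier[OF Wm]
  note q = q_ge_two
  fix x assume x: "x \<in> fixed" "x \<in> torsion W a" "x \<in> multiples W a"
  obtain k :: nat where k: "a [^] k \<odot>\<^bsub>M\<^esub> x \<in> W"
    using x(2) by (auto simp: torsion_def)
  have xc: "x \<in> carrier M" "F x = x"
    using x(1) by (auto simp: fixed_def)
  \<comment> \<open>Each application of \<open>F\<close> replaces \<open>a\<^sup>l\<close> by \<open>a\<^sup>l\<^sup>q\<close>, and \<open>l q > l\<close>.\<close>
  have deep: "\<exists>v \<in> carrier M. \<exists>w \<in> W. \<exists>l > n. x = a [^] l \<odot>\<^bsub>M\<^esub> v \<oplus>\<^bsub>M\<^esub> w" for n :: nat
  proof (induction n)
    case 0
    from x(3) obtain v w where "x = a \<odot>\<^bsub>M\<^esub> v \<oplus>\<^bsub>M\<^esub> w" "v \<in> carrier M" "w \<in> W"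
      by (auto simp: multiples_def)
    then show ?case
      using a by (intro bexI[of _ v] bexI[of _ w] exI[of _ 1]) auto
  next
    case (Suc n)
    then obtain v w l where *: "x = a [^] l \<odot>\<^bsub>M\<^esub> v \<oplus>\<^bsub>M\<^esub> w" "v \<in> carrier M" "w \<in> W" "n < l"
      by blast
    then have "F x = a [^] (l * q) \<odot>\<^bsub>M\<^esub> F v \<oplus>\<^bsub>M\<^esub> F w"
      using a Wc by (simp add: F_add F_smult nat_pow_pow)
    moreover have "l + l \<le> l * q"
      using q by (metis mult_2_right mult_le_mono2)
    then have "Suc n < l * q"
      using *(4) by linarith
    ultimately show ?case
      using xc(2) F *(2) WF[OF *(3)] by (metis PiE)
  qed
  \<comment> \<open>The kernels of the powers of \<open>a\<close> on \<open>M/W\<close>, an ascending chain.\<close>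
  define U where "U i = {v \<in> carrier M. a [^] i \<odot>\<^bsub>M\<^esub> v \<in> W}" for i :: nat
  have U: "submodule (U i) R M" for i
  proof (rule submoduleI')
    show "\<zero>\<^bsub>M\<^esub> \<in> U i"
      using a submodule_zero[OF Wm] by (simp add: U_def)
    show "y \<oplus>\<^bsub>M\<^esub> z \<in> U i" if "y \<in> U i" "z \<in> U i" for y z
      using that a submoduleE(5)[OF Wm] by (simp add: U_def smult_r_distr)
    show "r \<odot>\<^bsub>M\<^esub> y \<in> U i" if "r \<in> carrier R" "y \<in> U i" for r y
    proof -
      have "a [^] i \<odot>\<^bsub>M\<^esub> (r \<odot>\<^bsub>M\<^esub> y) = r \<odot>\<^bsub>M\<^esub> (a [^] i \<odot>\<^bsub>M\<^esub> y)"
        using that a by (simp add: U_def smult_assoc1[symmetric] m_comm)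
      then show ?thesis
        using that submoduleE(4)[OF Wm] by (simp add: U_def)
    qed
  qed (auto simp: U_def)
  have U_mono: "U i \<subseteq> U (i + l)" for i l
  proof
    fix v assume v: "v \<in> U i"
    then have "a [^] (i + l) \<odot>\<^bsub>M\<^esub> v = a [^] l \<odot>\<^bsub>M\<^esub> (a [^] i \<odot>\<^bsub>M\<^esub> v)"
      using a by (simp add: U_def smult_assoc1[symmetric] nat_pow_mult add.commute)
    then show "v \<in> U (i + l)"
      using v a submoduleE(4)[OF Wm] by (simp add: U_def)
  qed
  obtain n where n: "\<And>i. \<not> U n \<subset> U i"
    using wfE_min[OF noeth[unfolded noetherian_on_def], of "U 0" "range U"] U submoduleE(1)
    by (auto simp: image_iff) metis
  obtain v w l where *: "x = a [^] l \<odot>\<^bsub>M\<^esub> v \<oplus>\<^bsub>M\<^esub> w" "v \<in> carrier M" "w \<in> W" "n < l"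
    using deep by blast
  have "a [^] (l + k) \<odot>\<^bsub>M\<^esub> v = a [^] k \<odot>\<^bsub>M\<^esub> (a [^] l \<odot>\<^bsub>M\<^esub> v)"
    using a *(2) by (simp add: smult_assoc1[symmetric] nat_pow_mult add.commute)
  also have "a [^] l \<odot>\<^bsub>M\<^esub> v = x \<ominus>\<^bsub>M\<^esub> w"
    using * a Wc by (simp add: M.minus_eq M.a_assoc M.r_neg)
  finally have "a [^] (l + k) \<odot>\<^bsub>M\<^esub> v = a [^] k \<odot>\<^bsub>M\<^esub> x \<ominus>\<^bsub>M\<^esub> a [^] k \<odot>\<^bsub>M\<^esub> w"
    using a xc Wc[OF *(3)] by (simp add: smult_minus_distr)
  then have "v \<in> U (l + k)"
    using * a k by (simp add: U_def submodule_minus[OF Wm] submoduleE(4)[OF Wm])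
  moreover have "U (l + k) = U n"
    using n[of "l + k"] U_mono[of n "l + k - n"] *(4) by auto
  moreover have "U n \<subseteq> U l"
    using U_mono[of n "l - n"] *(4) by simp
  ultimately have "a [^] l \<odot>\<^bsub>M\<^esub> v \<in> W"
    by (auto simp: U_def)
  then show "x \<in> W"
    using * submoduleE(5)[OF Wm] by simp
qed

lemma ideal_annihilator:
  assumes Wm: "submodule W R M"
  shows "ideal (annihilator W) R"
proof (rule idealI[OF R.ring_axioms])
  show "subgroup (annihilator W) (add_monoid R)"
    by (rule R.add.subgroupI)
      (auto simp: annihilator_def smult_l_distr smult_l_minus submoduleE[OF Wm] submodule_zero[OF Wm] intro: exI[of _ \<zero>])
  show "x \<otimes> a \<in> annihilator W" if "a \<in> annihilator W" "x \<in> carrier R" for a x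
    using that by (auto simp: annihilator_def smult_assoc1 submoduleE[OF Wm])
  then show "a \<otimes> x \<in> annihilator W" if "a \<in> annihilator W" "x \<in> carrier R" for a x
    using that by (auto simp: annihilator_def m_comm)
qed

lemma stable_adjoin:
  assumes U: "stable U" and t: "t \<in> fixed"
  shows "stable (sum_with_multiples U t)"
proof -
  have Um: "submodule U R M" and UF: "\<And>x. x \<in> U \<Longrightarrow> F x \<in> U"
    using U by (auto simp: stable_def)
  note Uc = submodule_carrier[OF Um] and tc = fixed_carrier[OF t]
  have "F ` sum_with_multiples U t \<subseteq> sum_with_multiples U t"
  proof clarify
    fix x assume "x \<in> sum_with_multiples U t"
    then obtain u r where *: "x = u \<oplus>\<^bsub>M\<^esub> r \<odot>\<^bsub>M\<^esub> t" "u \<in> U" "r \<in> carrier R"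
      by (auto simp: sum_with_multiples_def)
    then have "F x = F u \<oplus>\<^bsub>M\<^esub> r [^] q \<odot>\<^bsub>M\<^esub> t"
      using t Uc by (simp add: F_add F_smult fixed_def)
    then show "F x \<in> sum_with_multiples U t"
      using UF * unfolding sum_with_multiples_def by blast
  qed
  then show ?thesis
    using sum_with_multiples_submodule[OF Um tc] by (simp add: stable_def)
qed

text \<open>\<open>M/W\<close> is a nonzero torsion-free module over the domain \<open>R / annihilator W\<close>.\<close>
definition integral_quotient where
  "integral_quotient W \<longleftrightarrow> stable W \<and> \<not> carrier M \<subseteq> W \<and>
    (\<forall>a \<in> carrier R - annihilator W. \<forall>x \<in> carrier M. a \<odot>\<^bsub>M\<^esub> x \<in> W \<longrightarrow> x \<in> W)"

lemma primeideal_annihilator: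
  assumes W: "integral_quotient W"
  shows "primeideal (annihilator W) R"
proof -
  have Wm: "submodule W R M" and not_top: "\<not> carrier M \<subseteq> W"
      and regular: "\<And>a x. a \<in> carrier R - annihilator W \<Longrightarrow> x \<in> carrier M \<Longrightarrow> a \<odot>\<^bsub>M\<^esub> x \<in> W \<Longrightarrow> x \<in> W"
    using W by (auto simp: integral_quotient_def stable_def)
  show ?thesis
  proof (rule primeidealI[OF ideal_annihilator[OF Wm] R.is_cring])
    have "\<one> \<notin> annihilator W"
      using not_top by (auto simp: annihilator_def)
    then show "carrier R \<noteq> annihilator W"
      by auto
    show "a \<in> annihilator W \<or> b \<in> annihilator W" if ab: "a \<in> carrier R" "b \<in> carrier R" "a \<otimes> b \<in> annihilator W" for a b
    proof (rule ccontr)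
      assume neg: "\<not> (a \<in> annihilator W \<or> b \<in> annihilator W)"
      then have "b \<odot>\<^bsub>M\<^esub> v \<in> W" if "v \<in> carrier M" for v
        using regular[of a "b \<odot>\<^bsub>M\<^esub> v"] that ab by (auto simp: annihilator_def smult_assoc1)
      then show False
        using neg ab(2) by (auto simp: annihilator_def)
    qed
  qed
qed

text \<open>This step turns a relation over \<open>R\<close> between fixed points into one over \<open>K\<close>. Let \<open>c s = u + d t\<close> with \<open>u\<close>
  in \<open>U\<close>. Applying \<open>F\<close> gives \<open>c\<^sup>q s = F u + d\<^sup>q t\<close>, and elimination of \<open>t\<close> gives
  \<open>(d\<^sup>q\<^sup>-\<^sup>1 c - c\<^sup>q) s\<close> in \<open>U\<close>. If the coefficient vanishes on \<open>M/W\<close>, then \<open>c = j(a) d\<close> modulo the annihilator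
  for some \<open>a\<close> in \<open>K\<close>, and \<open>d (j(a) s - t)\<close> is in \<open>U\<close>.\<close>
lemma reach_adjoin:
  assumes W: "integral_quotient W" and U: "stable U" "W \<subseteq> U" and t: "t \<in> fixed"
  shows "reach W (sum_with_multiples U t) \<subseteq> reach W U \<union>
    (\<Union>a \<in> carrier K - {\<zero>\<^bsub>K\<^esub>}. {s \<in> fixed. j a \<odot>\<^bsub>M\<^esub> s \<ominus>\<^bsub>M\<^esub> t \<in> reach W U})"
    (is "_ \<subseteq> _ \<union> (\<Union>a \<in> _. ?G a)")
proof
  have Um: "submodule U R M" and UF: "\<And>x. x \<in> U \<Longrightarrow> F x \<in> U" and WU: "W \<subseteq> U"
    using U by (auto simp: stable_def)
  note Uc = submodule_carrier[OF Um] and tc = fixed_carrier[OF t]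
  fix s assume "s \<in> reach W (sum_with_multiples U t)"
  then obtain c where s: "s \<in> fixed" and c: "c \<in> carrier R" "c \<notin> annihilator W"
      and "c \<odot>\<^bsub>M\<^esub> s \<in> sum_with_multiples U t"
    by (auto simp: reach_def)
  then obtain u d where u: "u \<in> U" and d: "d \<in> carrier R" and eq: "c \<odot>\<^bsub>M\<^esub> s = u \<oplus>\<^bsub>M\<^esub> d \<odot>\<^bsub>M\<^esub> t"
    by (auto simp: sum_with_multiples_def)
  have sc: "s \<in> carrier M" and uc: "u \<in> carrier M"
    using fixed_carrier[OF s] Uc[OF u] by auto
  have u_eq: "u = c \<odot>\<^bsub>M\<^esub> s \<ominus>\<^bsub>M\<^esub> d \<odot>\<^bsub>M\<^esub> t"
    using uc d tc unfolding eq by (simp add: M.add_diff_cancel)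
  show "s \<in> reach W U \<union> (\<Union>a \<in> carrier K - {\<zero>\<^bsub>K\<^esub>}. ?G a)"
  proof (cases "d \<in> annihilator W")
    case True
    then have "d \<odot>\<^bsub>M\<^esub> t \<in> U"
      using tc WU unfolding annihilator_def by blast
    then have "c \<odot>\<^bsub>M\<^esub> s \<in> U"
      unfolding eq using u submoduleE(5)[OF Um] by simp
    then show ?thesis
      using s c by (auto simp: reach_def)
  next
    case dI: False
    have Fu: "F u = c [^] q \<odot>\<^bsub>M\<^esub> s \<ominus>\<^bsub>M\<^esub> d [^] q \<odot>\<^bsub>M\<^esub> t"
      unfolding u_eq using c d s t sc tc by (simp add: F_minus F_smult fixed_def)
    define e where "e = d [^] (q - 1) \<otimes> c \<ominus> c [^] q"
    have e: "e \<in> carrier R"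
      using c d by (simp add: e_def)
    have dq: "d [^] q = d [^] (q - 1) \<otimes> d"
      using d q_ge_two nat_pow_Suc[of d "q - 1"] by simp
    have "d [^] (q - 1) \<odot>\<^bsub>M\<^esub> u \<ominus>\<^bsub>M\<^esub> F u =
        ((d [^] (q - 1) \<otimes> c) \<odot>\<^bsub>M\<^esub> s \<ominus>\<^bsub>M\<^esub> d [^] q \<odot>\<^bsub>M\<^esub> t) \<ominus>\<^bsub>M\<^esub>
        (c [^] q \<odot>\<^bsub>M\<^esub> s \<ominus>\<^bsub>M\<^esub> d [^] q \<odot>\<^bsub>M\<^esub> t)"
      unfolding Fu unfolding u_eq dq using c d sc tc by (simp add: smult_minus_distr smult_assoc1)
    also have "\<dots> = e \<odot>\<^bsub>M\<^esub> s"
      unfolding e_def using c d sc tc by (simp add: smult_minus_ldistr M.diff_diff_cancel)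
    finally have "e \<odot>\<^bsub>M\<^esub> s \<in> U"
      using submodule_minus[OF Um submoduleE(4)[OF Um _ u] UF[OF u], of "d [^] (q - 1)"] d by simp
    show ?thesis
    proof (cases "e \<in> annihilator W")
      case False
      then show ?thesis
        using \<open>e \<odot>\<^bsub>M\<^esub> s \<in> U\<close> s e by (auto simp: reach_def)
    next
      case True
      interpret I: primeideal "annihilator W" R
        by (rule primeideal_annihilator[OF W])
      obtain a where a: "a \<in> carrier K" and diff: "j a \<otimes> d \<ominus> c \<in> annihilator W"
        using I.homogeneous_Frobenius_roots_mod[OF K j c(1) d dI] True by (auto simp: e_def)
      have "a \<noteq> \<zero>\<^bsub>K\<^esub>"
      proof
        assume "a = \<zero>\<^bsub>K\<^esub>"
        then have "\<ominus> c \<in> annihilator W"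
          using diff c d by (simp add: R.minus_eq)
        then show False
          using I.a_inv_closed[of "\<ominus> c"] c by simp
      qed
      have "(j a \<otimes> d \<ominus> c) \<odot>\<^bsub>M\<^esub> s \<oplus>\<^bsub>M\<^esub> u = (j a \<otimes> d) \<odot>\<^bsub>M\<^esub> s \<ominus>\<^bsub>M\<^esub> d \<odot>\<^bsub>M\<^esub> t"
        unfolding u_eq using a c d sc tc by (simp add: smult_minus_ldistr M.diff_add_diff)
      also have "\<dots> = d \<odot>\<^bsub>M\<^esub> (j a \<odot>\<^bsub>M\<^esub> s \<ominus>\<^bsub>M\<^esub> t)"
        using a d sc tc by (simp add: smult_minus_distr smult_assoc1[symmetric] R.m_comm)
      finally have "d \<odot>\<^bsub>M\<^esub> (j a \<odot>\<^bsub>M\<^esub> s \<ominus>\<^bsub>M\<^esub> t) = (j a \<otimes> d \<ominus> c) \<odot>\<^bsub>M\<^esub> s \<oplus>\<^bsub>M\<^esub> u" ..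
      moreover have "(j a \<otimes> d \<ominus> c) \<odot>\<^bsub>M\<^esub> s \<in> U"
        using diff sc WU unfolding annihilator_def by blast
      ultimately have "d \<odot>\<^bsub>M\<^esub> (j a \<odot>\<^bsub>M\<^esub> s \<ominus>\<^bsub>M\<^esub> t) \<in> U"
        using submoduleE(5)[OF Um _ u] by simp
      then have "s \<in> ?G a"
        using fixed_minus[OF fixed_scale[OF a s] t] s d dI by (auto simp: reach_def)
      then show ?thesis
        using a \<open>a \<noteq> \<zero>\<^bsub>K\<^esub>\<close> by blast
    qed
  qed
qed

text \<open>As \<open>a\<close> is invertible, the class of \<open>j(a) s - t\<close> determines the class of \<open>s\<close>.\<close>
lemma finite_fixed_classes_translate:
  assumes W: "submodule W R M" and t: "t \<in> fixed" and a: "a \<in> carrier K - {\<zero>\<^bsub>K\<^esub>}"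
    and finite: "finite (fixed_class W ` A)"
  shows "finite (fixed_class W ` {s \<in> fixed. j a \<odot>\<^bsub>M\<^esub> s \<ominus>\<^bsub>M\<^esub> t \<in> A})"
proof -
  note Wm = W and tc = fixed_carrier[OF t]
  have ac: "a \<in> carrier K"
    using a by simp
  have unit: "j (inv\<^bsub>K\<^esub> a) \<otimes> j a = \<one>" and inv: "inv\<^bsub>K\<^esub> a \<in> carrier K"
    using a K.field_Units by (auto simp flip: j.hom_mult)
  have "fixed_class W s = {x \<in> fixed. j a \<odot>\<^bsub>M\<^esub> x \<ominus>\<^bsub>M\<^esub> t \<in> fixed_class W (j a \<odot>\<^bsub>M\<^esub> s \<ominus>\<^bsub>M\<^esub> t)}" if s: "s \<in> fixed" for s
  proof -
    have "s \<ominus>\<^bsub>M\<^esub> x \<in> W \<longleftrightarrow> (j a \<odot>\<^bsub>M\<^esub> s \<ominus>\<^bsub>M\<^esub> t) \<ominus>\<^bsub>M\<^esub> (j a \<odot>\<^bsub>M\<^esub> x \<ominus>\<^bsub>M\<^esub> t) \<in> W"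
      if x: "x \<in> fixed" for x
    proof -
      have "(j a \<odot>\<^bsub>M\<^esub> s \<ominus>\<^bsub>M\<^esub> t) \<ominus>\<^bsub>M\<^esub> (j a \<odot>\<^bsub>M\<^esub> x \<ominus>\<^bsub>M\<^esub> t) = j a \<odot>\<^bsub>M\<^esub> s \<ominus>\<^bsub>M\<^esub> j a \<odot>\<^bsub>M\<^esub> x"
        using ac s x tc fixed_carrier by (simp add: M.diff_diff_cancel)
      also have "\<dots> = j a \<odot>\<^bsub>M\<^esub> (s \<ominus>\<^bsub>M\<^esub> x)"
        using ac s x fixed_carrier by (simp add: smult_minus_distr)
      finally have e1: "(j a \<odot>\<^bsub>M\<^esub> s \<ominus>\<^bsub>M\<^esub> t) \<ominus>\<^bsub>M\<^esub> (j a \<odot>\<^bsub>M\<^esub> x \<ominus>\<^bsub>M\<^esub> t) = j a \<odot>\<^bsub>M\<^esub> (s \<ominus>\<^bsub>M\<^esub> x)" .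
      have e2: "s \<ominus>\<^bsub>M\<^esub> x = j (inv\<^bsub>K\<^esub> a) \<odot>\<^bsub>M\<^esub> (j a \<odot>\<^bsub>M\<^esub> (s \<ominus>\<^bsub>M\<^esub> x))"
        using ac inv s x fixed_carrier unit by (simp flip: smult_assoc1)
      show ?thesis
        unfolding e1 using e2 ac inv submoduleE(4)[OF Wm] by (metis j.hom_closed)
    qed
    then show ?thesis
      using fixed_minus[OF fixed_scale[OF ac] t] by (auto simp: fixed_class_def)
  qed
  then have "fixed_class W ` {s \<in> fixed. j a \<odot>\<^bsub>M\<^esub> s \<ominus>\<^bsub>M\<^esub> t \<in> A} \<subseteq> (\<lambda>B. {x \<in> fixed. j a \<odot>\<^bsub>M\<^esub> x \<ominus>\<^bsub>M\<^esub> t \<in> B}) ` (fixed_class W ` A)"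
    by auto
  then show ?thesis
    using finite by (meson finite_imageI finite_subset)
qed

text \<open>Consider the stable submodules \<open>U\<close> above \<open>W\<close> for which the fixed points that are torsion modulo \<open>U\<close>
  have finitely many classes modulo \<open>W\<close>. Adjoining a fixed point to \<open>U\<close> preserves this property, so a
  maximal such \<open>U\<close> contains all fixed points.\<close>
lemma finite_fixed_classes_integral:
  assumes W: "integral_quotient W"
  shows "finite (fixed_class W ` fixed)"
proof -
  have Wm: "submodule W R M" and not_top: "\<not> carrier M \<subseteq> W"
      and regular: "\<And>a x. a \<in> carrier R - annihilator W \<Longrightarrow> x \<in> carrier M \<Longrightarrow> a \<odot>\<^bsub>M\<^esub> x \<in> W \<Longrightarrow> x \<in> W"
    using W by (auto simp: integral_quotient_def stable_def)
  have stW: "stable W"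
    using W by (simp add: integral_quotient_def)
  define good where "good U \<longleftrightarrow> stable U \<and> W \<subseteq> U \<and> finite (fixed_class W ` reach W U)" for U
  have adjoin: "good (sum_with_multiples U t)" if U: "good U" and t: "t \<in> fixed" for U t
  proof -
    have st: "stable U" "W \<subseteq> U" and fin: "finite (fixed_class W ` reach W U)"
      using U by (auto simp: good_def)
    let ?G = "\<lambda>a. {s \<in> fixed. j a \<odot>\<^bsub>M\<^esub> s \<ominus>\<^bsub>M\<^esub> t \<in> reach W U}"
    have "fixed_class W ` reach W (sum_with_multiples U t) \<subseteq>
        fixed_class W ` reach W U \<union> (\<Union>a \<in> carrier K - {\<zero>\<^bsub>K\<^esub>}. fixed_class W ` ?G a)"
      using image_mono[OF reach_adjoin[OF W st t], of "fixed_class W"] by (simp only: image_Un image_UN)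
    moreover have "finite \<dots>"
      using fin K(2) finite_fixed_classes_translate[OF Wm t _ fin] by auto
    ultimately have "finite (fixed_class W ` reach W (sum_with_multiples U t))"
      by (rule finite_subset)
    moreover have "submodule U R M"
      using st by (simp add: stable_def)
    ultimately show ?thesis
      using stable_adjoin[OF st(1) t] st subset_sum_with_multiples(1)[of U t] fixed_carrier[OF t]
      unfolding good_def by blast
  qed
  have "reach W W \<subseteq> fixed \<inter> W"
    using regular fixed_carrier by (auto simp: reach_def)
  moreover have "fixed_class W s = fixed \<inter> W" if s: "s \<in> fixed \<inter> W" for s
  proof -
    have "s \<ominus>\<^bsub>M\<^esub> x \<in> W \<longleftrightarrow> x \<in> W" if x: "x \<in> fixed" for x
    proof
      assume d: "s \<ominus>\<^bsub>M\<^esub> x \<in> W"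
      have "x = s \<ominus>\<^bsub>M\<^esub> (s \<ominus>\<^bsub>M\<^esub> x)"
        using s x fixed_carrier by (simp add: M.diff_diff_self)
      then show "x \<in> W"
        using submodule_minus[OF Wm _ d, of s] s by simp
    qed (use s submodule_minus[OF Wm] in auto)
    then show ?thesis
      by (auto simp: fixed_class_def)
  qed
  ultimately have "fixed_class W ` reach W W \<subseteq> {fixed \<inter> W}"
    by blast
  then have "good W"
    using stW unfolding good_def by (meson finite.intros finite_subset order_refl)
  then obtain U where U: "good U" "\<And>U'. good U' \<Longrightarrow> \<not> U \<subset> U'"
    using wfE_min[OF noeth[unfolded noetherian_on_def], of W "Collect good"] submoduleE(1)
    by (auto simp: good_def stable_def) metis
  have Um: "submodule U R M"
    using U(1) by (simp add: good_def stable_def)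
  have "t \<in> U" if "t \<in> fixed" for t
    using adjoin[OF U(1) that] U(2) subset_sum_with_multiples[OF Um fixed_carrier[OF that]] by blast
  then have "fixed \<subseteq> reach W U"
    using not_top fixed_carrier unfolding reach_def by (auto simp: annihilator_def intro!: bexI[of _ \<one>])
  then have "reach W U = fixed"
    by (auto simp: reach_def)
  then show ?thesis
    using U(1) by (simp add: good_def)
qed

text \<open>Either \<open>W\<close> is, as far as fixed points are concerned, the intersection of two larger stable
  submodules, or \<open>W = M\<close>, or \<open>M/W\<close> is torsion-free over a domain.\<close>
lemma finite_fixed_classes_step:
  assumes W: "stable W" and IH: "\<And>W'. stable W' \<Longrightarrow> W \<subset> W' \<Longrightarrow> finite (fixed_class W' ` fixed)"
  shows "finite (fixed_class W ` fixed)"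
proof -
  have Wm: "submodule W R M"
    using W by (simp add: stable_def)
  consider a where "a \<in> carrier R" "W \<subset> torsion W a" "W \<subset> multiples W a" | "carrier M \<subseteq> W"
    | "integral_quotient W"
  proof (cases "\<exists>a \<in> carrier R. torsion W a \<noteq> W \<and> multiples W a \<noteq> W")
    case True
    then show ?thesis
      using that(1) stable_torsion(2)[OF W] stable_multiples(2)[OF W] by blast
  next
    case False
    have "x \<in> W" if a: "a \<in> carrier R - annihilator W" and x: "x \<in> carrier M" "a \<odot>\<^bsub>M\<^esub> x \<in> W" for a x
    proof -
      from a obtain v where v: "v \<in> carrier M" "a \<odot>\<^bsub>M\<^esub> v \<notin> W"
        by (auto simp: annihilator_def)
      then have "a \<odot>\<^bsub>M\<^esub> v = a \<odot>\<^bsub>M\<^esub> v \<oplus>\<^bsub>M\<^esub> \<zero>\<^bsub>M\<^esub>"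
        using a by simp
      then have "a \<odot>\<^bsub>M\<^esub> v \<in> multiples W a"
        unfolding multiples_def using v(1) submodule_zero[OF Wm] by blast
      then have "torsion W a = W"
        using False v a by auto
      moreover have "x \<in> torsion W a"
        using x a unfolding torsion_def by (auto intro!: exI[of _ "1::nat"])
      ultimately show ?thesis
        by simp
    qed
    then show ?thesis
      using that(2,3) W unfolding integral_quotient_def by blast
  qed
  then show ?thesis
  proof cases
    case (1 a)
    have "fixed_class W s = fixed_class (torsion W a) s \<inter> fixed_class (multiples W a) s" if "s \<in> fixed" for s
      using fixed_torsion_multiples[OF W 1(1)] 1(2,3) fixed_minus[OF that] unfolding fixed_class_def by blast
    then have "fixed_class W ` fixed \<subseteq>
        (\<lambda>(A, B). A \<inter> B) ` (fixed_class (torsion W a) ` fixed \<times> fixed_class (multiples W a) ` fixed)"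
      by auto
    moreover have "finite (fixed_class (torsion W a) ` fixed)" "finite (fixed_class (multiples W a) ` fixed)"
      using IH stable_torsion(1)[OF W] stable_multiples(1)[OF W] 1 by auto
    ultimately show ?thesis
      by (meson finite_SigmaI finite_imageI finite_subset)
  next
    case 2
    then have "fixed_class W ` fixed \<subseteq> {fixed}"
      using fixed_carrier by (auto simp: fixed_class_def)
    then show ?thesis
      by (meson finite.intros finite_subset)
  qed (rule finite_fixed_classes_integral)
qed

theorem finite_fixed: "finite fixed"
proof -
  have fin: "finite (fixed_class W ` fixed)" if "stable W" for W
    using that
  proof (induction W rule: wf_induct_rule[OF noeth[unfolded noetherian_on_def]])
    case (1 W)
    show ?case
    proof (rule finite_fixed_classes_step[OF 1(2)])
      fix W' assume W': "stable W'" "W \<subset> W'"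
      then show "finite (fixed_class W' ` fixed)"
        using 1 submoduleE(1)[of W'] unfolding stable_def by blast
    qed
  qed
  have "stable {\<zero>\<^bsub>M\<^esub>}"
    using zero_submodule F_zero by (simp add: stable_def)
  moreover have "fixed_class {\<zero>\<^bsub>M\<^esub>} s = {s}" if s: "s \<in> fixed" for s
  proof -
    have "s \<ominus>\<^bsub>M\<^esub> x = \<zero>\<^bsub>M\<^esub> \<longleftrightarrow> x = s" if "x \<in> fixed" for x
      using that s fixed_carrier M.diff_add_cancel[of s x] by (auto simp: M.minus_eq M.r_neg)
    then show ?thesis
      using s by (auto simp: fixed_class_def)
  qed
  ultimately have "finite ((\<lambda>s. {s}) ` fixed)"
    using fin by (metis (no_types, lifting) image_cong)
  then show ?thesis
    by (rule finite_imageD) auto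
qed

end

section \<open>Modules of linear maps\<close>

lemma linear_map_zero:
  assumes "module R M" and "module R N" and "f \<in> carrier M \<rightarrow> carrier N"
    and "\<And>r x. r \<in> carrier R \<Longrightarrow> x \<in> carrier M \<Longrightarrow> f (r \<odot>\<^bsub>M\<^esub> x) = r \<odot>\<^bsub>N\<^esub> f x"
  shows "f \<zero>\<^bsub>M\<^esub> = \<zero>\<^bsub>N\<^esub>"
proof -
  interpret M: module R M by fact
  interpret N: module R N by fact
  have "f \<zero>\<^bsub>M\<^esub> = f (\<zero>\<^bsub>R\<^esub> \<odot>\<^bsub>M\<^esub> \<zero>\<^bsub>M\<^esub>)"
    by simp
  also have "\<dots> = \<zero>\<^bsub>R\<^esub> \<odot>\<^bsub>N\<^esub> f \<zero>\<^bsub>M\<^esub>"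
    by (rule assms(4)) auto
  finally show ?thesis
    using assms(3) by (simp add: Pi_iff)
qed

definition linear_maps ::
    "('r, 'x) ring_scheme \<Rightarrow> ('r, 'm, 'y) module_scheme \<Rightarrow> ('r, 'n, 'z) module_scheme \<Rightarrow> ('m \<Rightarrow> 'n) set"
  where "linear_maps R M N = {f \<in> carrier M \<rightarrow>\<^sub>E carrier N.
    (\<forall>x \<in> carrier M. \<forall>y \<in> carrier M. f (x \<oplus>\<^bsub>M\<^esub> y) = f x \<oplus>\<^bsub>N\<^esub> f y) \<and>
    (\<forall>r \<in> carrier R. \<forall>x \<in> carrier M. f (r \<odot>\<^bsub>M\<^esub> x) = r \<odot>\<^bsub>N\<^esub> f x)}"

definition Hom_module ::
    "('r, 'x) ring_scheme \<Rightarrow> ('r, 'm, 'y) module_scheme \<Rightarrow> ('r, 'n, 'z) module_scheme \<Rightarrow> ('r, 'm \<Rightarrow> 'n) module"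
  where "Hom_module R M N =
    \<lparr>carrier = linear_maps R M N, mult = undefined, one = undefined,
     zero = (\<lambda>x \<in> carrier M. \<zero>\<^bsub>N\<^esub>),
     add = (\<lambda>f g. \<lambda>x \<in> carrier M. f x \<oplus>\<^bsub>N\<^esub> g x),
     smult = (\<lambda>r f. \<lambda>x \<in> carrier M. r \<odot>\<^bsub>N\<^esub> f x)\<rparr>"

lemma Hom_module_simps:
  "carrier (Hom_module R M N) = linear_maps R M N"
  "\<zero>\<^bsub>Hom_module R M N\<^esub> = (\<lambda>x \<in> carrier M. \<zero>\<^bsub>N\<^esub>)"
  "f \<oplus>\<^bsub>Hom_module R M N\<^esub> g = (\<lambda>x \<in> carrier M. f x \<oplus>\<^bsub>N\<^esub> g x)"
  "r \<odot>\<^bsub>Hom_module R M N\<^esub> f = (\<lambda>x \<in> carrier M. r \<odot>\<^bsub>N\<^esub> f x)"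
  by (simp_all add: Hom_module_def)

lemma linear_mapsD:
  assumes "f \<in> linear_maps R M N"
  shows "\<And>x. x \<in> carrier M \<Longrightarrow> f x \<in> carrier N"
    and "\<And>x y. x \<in> carrier M \<Longrightarrow> y \<in> carrier M \<Longrightarrow> f (x \<oplus>\<^bsub>M\<^esub> y) = f x \<oplus>\<^bsub>N\<^esub> f y"
    and "\<And>r x. r \<in> carrier R \<Longrightarrow> x \<in> carrier M \<Longrightarrow> f (r \<odot>\<^bsub>M\<^esub> x) = r \<odot>\<^bsub>N\<^esub> f x"
    and "f \<in> extensional (carrier M)"
  using assms by (auto simp: linear_maps_def PiE_def)

lemma linear_maps_eqI:
  assumes "f \<in> linear_maps R M N" and "g \<in> linear_maps R M N" and "\<And>x. x \<in> carrier M \<Longrightarrow> f x = g x"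
  shows "f = g"
  using assms(3) linear_mapsD(4)[OF assms(1)] linear_mapsD(4)[OF assms(2)] by (rule extensionalityI[rotated 2])

lemma module_Hom_module:
  assumes "module R M" and "module R N"
  shows "module R (Hom_module R M N)"
proof -
  interpret M: module R M by fact
  interpret N: module R N by fact
  note D = linear_mapsD[of _ R M N]
  have smult_closed: "(\<lambda>x \<in> carrier M. r \<odot>\<^bsub>N\<^esub> f x) \<in> linear_maps R M N"
    if "r \<in> carrier R" "f \<in> linear_maps R M N" for r f
    using that D[OF that(2)]
    by (auto simp: linear_maps_def N.smult_r_distr N.smult_assoc1[symmetric] M.R.m_comm)
  have add_closed: "(\<lambda>x \<in> carrier M. f x \<oplus>\<^bsub>N\<^esub> g x) \<in> linear_maps R M N"
    if "f \<in> linear_maps R M N" "g \<in> linear_maps R M N" for f g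
    using D[OF that(1)] D[OF that(2)] by (auto simp: linear_maps_def N.smult_r_distr N.M.a_ac)
  have zero_closed: "(\<lambda>x \<in> carrier M. \<zero>\<^bsub>N\<^esub>) \<in> linear_maps R M N"
    by (auto simp: linear_maps_def)
  show ?thesis
  proof (rule moduleI)
    show "cring R"
      by (rule M.R.is_cring)
    show "abelian_group (Hom_module R M N)"
    proof (rule abelian_groupI)
      fix f assume f: "f \<in> carrier (Hom_module R M N)"
      then show "\<exists>g \<in> carrier (Hom_module R M N). g \<oplus>\<^bsub>Hom_module R M N\<^esub> f = \<zero>\<^bsub>Hom_module R M N\<^esub>"
        using smult_closed[of "\<ominus>\<^bsub>R\<^esub> \<one>\<^bsub>R\<^esub>" f] D[of f]
        by (intro bexI[of _ "\<lambda>x \<in> carrier M. (\<ominus>\<^bsub>R\<^esub> \<one>\<^bsub>R\<^esub>) \<odot>\<^bsub>N\<^esub> f x"])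
          (auto simp: Hom_module_simps N.smult_l_minus N.M.l_neg intro!: restrict_ext)
      show "\<zero>\<^bsub>Hom_module R M N\<^esub> \<oplus>\<^bsub>Hom_module R M N\<^esub> f = f"
        using f D[of f] add_closed[OF zero_closed, of f]
        by (intro linear_maps_eqI[of _ R M N]) (auto simp: Hom_module_simps)
    qed (use add_closed zero_closed D in \<open>auto simp: Hom_module_simps N.M.a_ac intro!: restrict_ext\<close>)
    show "\<one>\<^bsub>R\<^esub> \<odot>\<^bsub>Hom_module R M N\<^esub> f = f" if "f \<in> carrier (Hom_module R M N)" for f
      using that D[of f] smult_closed[of "\<one>\<^bsub>R\<^esub>" f]
      by (intro linear_maps_eqI[of _ R M N]) (auto simp: Hom_module_simps)
  qed (use smult_closed D(1) in \<open>auto simp: Hom_module_simps N.smult_l_distr N.smult_r_distr N.smult_assoc1 intro!: restrict_ext\<close>)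
qed

text \<open>A linear map is determined by its values on a finite set \<open>B\<close> of generators. The maps that vanish on
  \<open>B - A\<close> are an extension, by evaluation at a further generator \<open>b\<close> in \<open>A\<close>, of a submodule of \<open>N\<close> by the
  maps that vanish at \<open>b\<close> as well.\<close>
lemma noetherian_Hom_module:
  assumes R: "noetherian_ring R" and M: "module R M" and N: "module R N"
    and fgM: "finitely_generated R M" and fgN: "finitely_generated R N"
  shows "noetherian_on R (Hom_module R M N) (linear_maps R M N)"
proof -
  let ?H = "Hom_module R M N"
  interpret M: module R M by fact
  interpret N: module R N by fact
  interpret H: module R ?H
    by (rule module_Hom_module[OF M N])
  note D = linear_mapsD[of _ R M N]
  obtain B where B: "B \<subseteq> carrier M" "finite B"
      and gen: "\<And>m. m \<in> carrier M \<Longrightarrow> \<exists>c \<in> B \<rightarrow> carrier R. m = (\<Oplus>\<^bsub>M\<^esub>b\<in>B. c b \<odot>\<^bsub>M\<^esub> b)"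
    using fgM unfolding finitely_generated_def by blast
  let ?V = "\<lambda>A. {f \<in> linear_maps R M N. \<forall>b \<in> B - A. f b = \<zero>\<^bsub>N\<^esub>}"
  have sub: "submodule (?V A) R ?H" for A
  proof (rule H.submoduleI')
    have "b \<in> carrier M" if "b \<in> B - A" for b
      using B that by auto
    then show "\<zero>\<^bsub>?H\<^esub> \<in> ?V A" "\<And>f g. f \<in> ?V A \<Longrightarrow> g \<in> ?V A \<Longrightarrow> f \<oplus>\<^bsub>?H\<^esub> g \<in> ?V A"
        "\<And>a f. a \<in> carrier R \<Longrightarrow> f \<in> ?V A \<Longrightarrow> a \<odot>\<^bsub>?H\<^esub> f \<in> ?V A"
      using H.M.zero_closed H.M.a_closed H.smult_closed by (auto simp: Hom_module_simps)
  qed (auto simp: Hom_module_simps)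
  have "noetherian_on R ?H (?V A)" if "finite A" "A \<subseteq> B" for A
    using that
  proof (induction A rule: finite_induct)
    case empty
    have "f = \<zero>\<^bsub>?H\<^esub>" if f: "f \<in> ?V {}" for f
    proof (rule linear_maps_eqI)
      fix x assume x: "x \<in> carrier M"
      have "submodule {x \<in> carrier M. f x = \<zero>\<^bsub>N\<^esub>} R M"
        using f D[of f] linear_map_zero[OF M N, of f] by (intro M.submoduleI') auto
      then have "x \<in> {x \<in> carrier M. f x = \<zero>\<^bsub>N\<^esub>}"
        using gen[OF x] M.combination_in_submodule[OF _ B(2)] f B(1) by fastforce
      then show "f x = \<zero>\<^bsub>?H\<^esub> x"
        using x by (simp add: Hom_module_simps)
    next
      show "\<zero>\<^bsub>?H\<^esub> \<in> linear_maps R M N"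
        using H.M.zero_closed by (simp add: Hom_module_simps)
    qed (use f in simp)
    then show ?case
      by (intro H.noetherian_on_subset[OF H.noetherian_on_zero]) blast
  next
    case (insert b A)
    then have b: "b \<in> carrier M"
      using B by auto
    show ?case
    proof (rule H.noetherian_on_extension[OF N sub, where f = "\<lambda>f. f b"])
      show "noetherian_on R N (carrier N)"
        by (rule N.finitely_generated_imp_noetherian[OF R fgN])
      have "noetherian_on R ?H (?V A)"
        using insert.IH insert.prems by simp
      then show "noetherian_on R ?H {f \<in> ?V (insert b A). f b = \<zero>\<^bsub>N\<^esub>}"
        by (rule H.noetherian_on_subset) blast
    qed (use b D in \<open>auto simp: Hom_module_simps\<close>)
  qed
  from this[OF B(2)] show ?thesis
    by simp
qed

lemma noetherian_on_restrict:
  assumes M: "module R M" and V: "submodule V R M" and noeth: "noetherian_on R M V"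
  shows "noetherian_on R (M\<lparr>carrier := V\<rparr>) V"
proof -
  interpret M: module R M by fact
  interpret V: module R "M\<lparr>carrier := V\<rparr>"
    by (rule submodule.submodule_is_module[OF V M])
  have "submodule W R M" if W: "submodule W R (M\<lparr>carrier := V\<rparr>)" for W
    using V.submoduleE[OF W] V.submodule_zero[OF W] M.submoduleE(1)[OF V] by (intro M.submoduleI') auto
  then show ?thesis
    using noeth unfolding noetherian_on_def by (elim wf_subset) auto
qed

section \<open>Finiteness of morphisms over an affine open set\<close>

text \<open>The maps in question are the fixed points of the \<open>q\<close>-linear map that sends \<open>f\<close> to the unique \<open>g\<close> with
  \<open>f C = D g\<close>. The hypothesis \<open>nil\<close> makes \<open>g\<close> unique.\<close>
lemma finite_cartier_linear_maps:
  assumes R: "noetherian_ring R" and M: "module R M" and N: "module R N"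
    and fgM: "finitely_generated R M" and fgN: "finitely_generated R N"
    and CM: "C \<in> carrier M \<rightarrow> carrier M" and D: "D \<in> carrier N \<rightarrow> carrier N"
    and D_add: "\<And>x y. x \<in> carrier N \<Longrightarrow> y \<in> carrier N \<Longrightarrow> D (x \<oplus>\<^bsub>N\<^esub> y) = D x \<oplus>\<^bsub>N\<^esub> D y"
    and D_smult: "\<And>r x. r \<in> carrier R \<Longrightarrow> x \<in> carrier N \<Longrightarrow> D (r [^]\<^bsub>R\<^esub> q \<odot>\<^bsub>N\<^esub> x) = r \<odot>\<^bsub>N\<^esub> D x"
    and nil: "\<And>x. x \<in> carrier N \<Longrightarrow> (\<And>r. r \<in> carrier R \<Longrightarrow> D (r \<odot>\<^bsub>N\<^esub> x) = \<zero>\<^bsub>N\<^esub>) \<Longrightarrow> x = \<zero>\<^bsub>N\<^esub>"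
    and K: "field K" "finite (carrier K)" "order K = q" and j: "j \<in> ring_hom K R"
  shows "finite {f \<in> linear_maps R M N. \<forall>x \<in> carrier M. f (C x) = D (f x)}"
proof -
  let ?H = "Hom_module R M N"
  interpret M: module R M by fact
  interpret N: module R N by fact
  interpret H: module R ?H
    by (rule module_Hom_module[OF M N])
  note hom = linear_mapsD[of _ R M N]
  define rel where "rel f g \<longleftrightarrow> f \<in> linear_maps R M N \<and> g \<in> linear_maps R M N \<and>
    (\<forall>x \<in> carrier M. f (C x) = D (g x))" for f g
  have rel_hom: "f \<in> carrier ?H" "g \<in> carrier ?H" if "rel f g" for f g
    using that by (auto simp: rel_def Hom_module_simps)
  have Cc: "C x \<in> carrier M" if "x \<in> carrier M" for x
    using CM that by auto
  have rel_add: "rel (f \<oplus>\<^bsub>?H\<^esub> f') (g \<oplus>\<^bsub>?H\<^esub> g')" if "rel f g" "rel f' g'" for f g f' g'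
  proof -
    have "f \<oplus>\<^bsub>?H\<^esub> f' \<in> linear_maps R M N" "g \<oplus>\<^bsub>?H\<^esub> g' \<in> linear_maps R M N"
      using H.M.a_closed rel_hom[OF that(1)] rel_hom[OF that(2)] by (simp_all add: Hom_module_simps(1))
    moreover have "f (C x) \<oplus>\<^bsub>N\<^esub> f' (C x) = D (g x \<oplus>\<^bsub>N\<^esub> g' x)" if x: "x \<in> carrier M" for x
      using x \<open>rel f g\<close> \<open>rel f' g'\<close> hom(1)[of g] hom(1)[of g'] by (simp add: rel_def D_add)
    ultimately show ?thesis
      using Cc by (simp add: rel_def Hom_module_simps)
  qed
  have rel_smult: "rel (r \<odot>\<^bsub>?H\<^esub> f) (r [^]\<^bsub>R\<^esub> q \<odot>\<^bsub>?H\<^esub> g)" if "rel f g" "r \<in> carrier R" for r f g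
  proof -
    have "r \<odot>\<^bsub>?H\<^esub> f \<in> linear_maps R M N" "r [^]\<^bsub>R\<^esub> q \<odot>\<^bsub>?H\<^esub> g \<in> linear_maps R M N"
      using H.smult_closed rel_hom[OF that(1)] that(2) by (simp_all add: Hom_module_simps(1))
    moreover have "r \<odot>\<^bsub>N\<^esub> f (C x) = D (r [^]\<^bsub>R\<^esub> q \<odot>\<^bsub>N\<^esub> g x)" if x: "x \<in> carrier M" for x
      using x \<open>rel f g\<close> \<open>r \<in> carrier R\<close> hom(1)[of g] by (simp add: rel_def D_smult)
    ultimately show ?thesis
      using Cc by (simp add: rel_def Hom_module_simps)
  qed
  have rel_unique: "g = g'" if g: "rel f g" and g': "rel f g'" for f g g'
  proof -
    have D_minus: "D (x \<ominus>\<^bsub>N\<^esub> y) = D x \<ominus>\<^bsub>N\<^esub> D y" if "x \<in> carrier N" "y \<in> carrier N" for x y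
    proof -
      have "D x = D (x \<ominus>\<^bsub>N\<^esub> y) \<oplus>\<^bsub>N\<^esub> D y"
        using D_add[of "x \<ominus>\<^bsub>N\<^esub> y" y] that by (simp add: N.M.diff_add_cancel)
      moreover have "D (x \<ominus>\<^bsub>N\<^esub> y) \<in> carrier N" "D y \<in> carrier N"
        using D that by auto
      ultimately show ?thesis
        by (simp add: N.M.add_diff_cancel)
    qed
    show ?thesis
    proof (rule linear_maps_eqI[of _ R M N])
      fix x assume x: "x \<in> carrier M"
      have gx: "g y \<in> carrier N" "g' y \<in> carrier N" if "y \<in> carrier M" for y
        using g g' that hom(1) by (auto simp: rel_def)
      have "g x \<ominus>\<^bsub>N\<^esub> g' x = \<zero>\<^bsub>N\<^esub>"
      proof (rule nil)
        fix r assume r: "r \<in> carrier R"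
        have "r \<odot>\<^bsub>N\<^esub> (g x \<ominus>\<^bsub>N\<^esub> g' x) = g (r \<odot>\<^bsub>M\<^esub> x) \<ominus>\<^bsub>N\<^esub> g' (r \<odot>\<^bsub>M\<^esub> x)"
          using g g' r x gx hom(3) by (simp add: rel_def N.smult_minus_distr)
        also have "D \<dots> = D (g (r \<odot>\<^bsub>M\<^esub> x)) \<ominus>\<^bsub>N\<^esub> D (g' (r \<odot>\<^bsub>M\<^esub> x))"
          using r x gx by (simp add: D_minus)
        also have "\<dots> = f (C (r \<odot>\<^bsub>M\<^esub> x)) \<ominus>\<^bsub>N\<^esub> f (C (r \<odot>\<^bsub>M\<^esub> x))"
          using g g' r x by (simp add: rel_def)
        also have "\<dots> = \<zero>\<^bsub>N\<^esub>"
        proof -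
          have "f (C (r \<odot>\<^bsub>M\<^esub> x)) \<in> carrier N"
            using g r x Cc hom(1) D by (auto simp: rel_def Pi_iff)
          then show ?thesis
            by (simp add: N.M.minus_eq N.M.r_neg)
        qed
        finally show "D (r \<odot>\<^bsub>N\<^esub> (g x \<ominus>\<^bsub>N\<^esub> g' x)) = \<zero>\<^bsub>N\<^esub>" .
      qed (use x gx in auto)
      then show "g x = g' x"
        using N.M.diff_add_cancel[of "g x" "g' x"] gx[OF x] by simp
    qed (use g g' in \<open>auto simp: rel_def\<close>)
  qed
  \<comment> \<open>The largest submodule that \<open>F\<close> is defined on and maps to itself.\<close>
  define V where "V = {f \<in> carrier ?H. \<exists>s::nat \<Rightarrow> _. s 0 = f \<and> (\<forall>i. rel (s i) (s (Suc i)))}"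
  define F where "F f = (THE g. rel f g)" for f
  have V: "submodule V R ?H"
  proof (rule H.submoduleI')
    have "D \<zero>\<^bsub>N\<^esub> \<in> carrier N"
      using D by auto
    then have "rel \<zero>\<^bsub>?H\<^esub> \<zero>\<^bsub>?H\<^esub>"
      using H.M.zero_closed Cc D_smult[of "\<zero>\<^bsub>R\<^esub>" "\<zero>\<^bsub>N\<^esub>"] by (auto simp: rel_def Hom_module_simps)
    then show "\<zero>\<^bsub>?H\<^esub> \<in> V"
      unfolding V_def by (auto intro!: exI[of _ "\<lambda>i. \<zero>\<^bsub>?H\<^esub>"])
  next
    fix f g assume "f \<in> V" "g \<in> V"
    then obtain s t :: "nat \<Rightarrow> _" where "s 0 = f" "\<And>i. rel (s i) (s (Suc i))" "t 0 = g" "\<And>i. rel (t i) (t (Suc i))"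
      by (auto simp: V_def)
    then show "f \<oplus>\<^bsub>?H\<^esub> g \<in> V"
      using rel_hom unfolding V_def
      by (auto intro!: exI[of _ "\<lambda>i. s i \<oplus>\<^bsub>?H\<^esub> t i"] rel_add H.M.a_closed)
  next
    fix r f assume r: "r \<in> carrier R" and "f \<in> V"
    then obtain s :: "nat \<Rightarrow> _" where s: "s 0 = f" "\<And>i. rel (s i) (s (Suc i))"
      by (auto simp: V_def)
    have "rel (r [^]\<^bsub>R\<^esub> (q ^ i) \<odot>\<^bsub>?H\<^esub> s i) (r [^]\<^bsub>R\<^esub> (q ^ Suc i) \<odot>\<^bsub>?H\<^esub> s (Suc i))" for i
      using rel_smult[OF s(2), of "r [^]\<^bsub>R\<^esub> (q ^ i)" i] r by (simp add: M.R.nat_pow_pow mult.commute)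
    then show "r \<odot>\<^bsub>?H\<^esub> f \<in> V"
      using rel_hom(1)[OF s(2)[of 0]] s(1) r unfolding V_def
      by (auto intro!: exI[of _ "\<lambda>i. r [^]\<^bsub>R\<^esub> (q ^ i) \<odot>\<^bsub>?H\<^esub> s i"])
  qed (auto simp: V_def)
  have F: "F f = g" if "rel f g" for f g
    unfolding F_def using that rel_unique by (intro the_equality) auto
  have VF: "rel f (F f)" "F f \<in> V" if "f \<in> V" for f
  proof -
    from that obtain s :: "nat \<Rightarrow> _" where s: "s 0 = f" "\<And>i. rel (s i) (s (Suc i))"
      by (auto simp: V_def)
    then have "F f = s 1"
      using F[of f "s 1"] s(2)[of 0] by simp
    moreover have "s 1 \<in> V"
      unfolding V_def using rel_hom(1)[OF s(2)] s(2) by (auto intro!: exI[of _ "\<lambda>i. s (Suc i)"])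
    ultimately show "rel f (F f)" "F f \<in> V"
      using s(1) s(2)[of 0] by auto
  qed
  let ?V = "?H\<lparr>carrier := V\<rparr>"
  interpret V: module R ?V
    by (rule submodule.submodule_is_module[OF V H.module_axioms])
  interpret Q: q_linear_module R ?V K j q F
  proof (rule q_linear_module.intro[OF V.module_axioms], rule q_linear_module_axioms.intro)
    show "noetherian_on R ?V (carrier ?V)"
      using noetherian_on_restrict[OF H.module_axioms V] H.noetherian_on_subset
        noetherian_Hom_module[OF R M N fgM fgN] H.submoduleE(1)[OF V]
      by (simp add: Hom_module_simps)
    show "F \<in> carrier ?V \<rightarrow> carrier ?V"
      using VF by auto
    show "F (x \<oplus>\<^bsub>?V\<^esub> y) = F x \<oplus>\<^bsub>?V\<^esub> F y" if "x \<in> carrier ?V" "y \<in> carrier ?V" for x y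
      using that F[OF rel_add[OF VF(1) VF(1)]] by simp
    show "F (r \<odot>\<^bsub>?V\<^esub> x) = r [^]\<^bsub>R\<^esub> q \<odot>\<^bsub>?V\<^esub> F x" if "r \<in> carrier R" "x \<in> carrier ?V" for r x
      using that F[OF rel_smult[OF VF(1)]] by simp
  qed (use K j in auto)
  have "{f \<in> linear_maps R M N. \<forall>x \<in> carrier M. f (C x) = D (f x)} \<subseteq> Q.fixed"
  proof
    fix f assume f: "f \<in> {f \<in> linear_maps R M N. \<forall>x \<in> carrier M. f (C x) = D (f x)}"
    then have "rel f f"
      by (auto simp: rel_def)
    moreover from this have "f \<in> V"
      using rel_hom unfolding V_def by (auto intro!: exI[of _ "\<lambda>i. f"])
    ultimately show "f \<in> Q.fixed"
      using F by (simp add: Q.fixed_def)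
  qed
  then show ?thesis
    using Q.finite_fixed by (rule finite_subset)
qed

section \<open>Basic open subsets of affine open sets\<close>

lemma sheaf_on_restrict_closed:
  assumes "sheaf_on T S r" and "openin T U" and "openin T V" and "V \<subseteq> U" and "s \<in> S U"
  shows "r U V s \<in> S V"
  using assms(1)[unfolded sheaf_on_def, THEN conjunct1] assms(2-5) by blast

lemma sheaf_on_restrict_self:
  assumes "sheaf_on T S r" and "openin T U" and "s \<in> S U"
  shows "r U U s = s"
  using assms(1)[unfolded sheaf_on_def, THEN conjunct2, THEN conjunct1] assms(2-3) by blast

lemma sheaf_on_restrict_restrict:
  assumes "sheaf_on T S r" and "openin T U" and "openin T V" and "openin T W" and "V \<subseteq> U" and "W \<subseteq> V" and "s \<in> S U"
  shows "r V W (r U V s) = r U W s"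
  using assms(1)[unfolded sheaf_on_def, THEN conjunct2, THEN conjunct2, THEN conjunct1] assms(2-7) by blast

lemma sheaf_on_separated:
  assumes "sheaf_on T S r" and "\<And>U. U \<in> \<U> \<Longrightarrow> openin T U" and "s \<in> S (\<Union>\<U>)" and "t \<in> S (\<Union>\<U>)"
    and "\<And>U. U \<in> \<U> \<Longrightarrow> r (\<Union>\<U>) U s = r (\<Union>\<U>) U t"
  shows "s = t"
  using assms(1)[unfolded sheaf_on_def, THEN conjunct2, THEN conjunct2, THEN conjunct2, THEN conjunct1] assms(2-5)
  by blast

lemma sheaf_on_glue:
  assumes "sheaf_on T S r" and "\<And>U. U \<in> \<U> \<Longrightarrow> openin T U" and "\<And>U. U \<in> \<U> \<Longrightarrow> s U \<in> S U"
    and "\<And>U V. U \<in> \<U> \<Longrightarrow> V \<in> \<U> \<Longrightarrow> r U (U \<inter> V) (s U) = r V (U \<inter> V) (s V)"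
  shows "\<exists>t \<in> S (\<Union>\<U>). \<forall>U \<in> \<U>. r (\<Union>\<U>) U t = s U"
proof -
  have "(\<forall>U \<in> \<U>. openin T U \<and> s U \<in> S U) \<and>
      (\<forall>U \<in> \<U>. \<forall>V \<in> \<U>. r U (U \<inter> V) (s U) = r V (U \<inter> V) (s V))"
    using assms(2-4) by blast
  then show ?thesis
    by (rule assms(1)[unfolded sheaf_on_def, THEN conjunct2, THEN conjunct2, THEN conjunct2, THEN conjunct2,
          THEN spec, THEN spec, THEN mp])
qed

lemma sheaf_on_eq_if_locally_eq:
  assumes S: "sheaf_on T S r" and U: "openin T U" and s: "s \<in> S U" and t: "t \<in> S U"
    and local: "\<And>x. x \<in> U \<Longrightarrow> \<exists>V. openin T V \<and> x \<in> V \<and> V \<subseteq> U \<and> r U V s = r U V t"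
  shows "s = t"
proof -
  define \<U> where "\<U> = {V. openin T V \<and> V \<subseteq> U \<and> r U V s = r U V t}"
  have un: "\<Union>\<U> = U"
    using local unfolding \<U>_def by blast
  show ?thesis
    by (rule sheaf_on_separated[OF S, of \<U>]) (use s t in \<open>auto simp: un\<close>, auto simp: \<U>_def)
qed

text \<open>The sets \<open>D(f)\<close> generate the topology as a subbasis; they are a basis since
  \<open>D(f) \<inter> D(g) = D(f g)\<close>.\<close>
lemma prime_spectrum_basis:
  assumes R: "cring R" and W: "openin (prime_spectrum R) W" and P: "P \<in> W"
  shows "primeideal P R \<and> (\<exists>f \<in> carrier R. f \<notin> P \<and> {Q. primeideal Q R \<and> f \<notin> Q} \<subseteq> W)"
proof -
  interpret R: cring R by fact
  let ?B = "(\<lambda>f. {P. primeideal P R \<and> f \<notin> P}) ` carrier R"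
  have "generate_topology_on ?B W"
    using W unfolding prime_spectrum_def by (rule openin_topology_generated_by)
  then show ?thesis
    using P
  proof (induction arbitrary: P)
    case Empty
    then show ?case
      by simp
  next
    case (Int V W)
    obtain f where f: "primeideal P R" "f \<in> carrier R" "f \<notin> P" "{Q. primeideal Q R \<and> f \<notin> Q} \<subseteq> V"
      using Int.IH(1)[of P] Int.prems by blast
    obtain g where g: "g \<in> carrier R" "g \<notin> P" "{Q. primeideal Q R \<and> g \<notin> Q} \<subseteq> W"
      using Int.IH(2)[of P] Int.prems by blast
    have "f \<otimes>\<^bsub>R\<^esub> g \<notin> P"
      using primeideal.I_prime[OF f(1)] f g by blast
    moreover have "{Q. primeideal Q R \<and> f \<otimes>\<^bsub>R\<^esub> g \<notin> Q} \<subseteq> V \<inter> W"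
    proof
      fix Q assume "Q \<in> {Q. primeideal Q R \<and> f \<otimes>\<^bsub>R\<^esub> g \<notin> Q}"
      then have Q: "primeideal Q R" "f \<otimes>\<^bsub>R\<^esub> g \<notin> Q"
        by auto
      interpret Q: primeideal Q R by fact
      have "f \<notin> Q" "g \<notin> Q"
        using Q(2) f(2) g(1) Q.I_l_closed Q.I_r_closed by blast+
      then show "Q \<in> V \<inter> W"
        using Q(1) f(4) g(3) by blast
    qed
    ultimately show ?case
      using f(1,2) g(1) R.m_closed by blast
  next
    case (UN \<V>)
    then obtain V where V: "V \<in> \<V>" "P \<in> V"
      by blast
    then show ?case
      using UN.IH[OF V] by blast
  next
    case (Basis V)
    then show ?case
      by blast
  qed
qed

lemma ringed_space_cring: "ringed_space X \<Longrightarrow> openin (topo X) U \<Longrightarrow> cring (sec X U)"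
  by (simp add: ringed_space_def)

lemma ringed_space_res_hom:
  "ringed_space X \<Longrightarrow> openin (topo X) U \<Longrightarrow> openin (topo X) V \<Longrightarrow> V \<subseteq> U \<Longrightarrow>
    res X U V \<in> ring_hom (sec X U) (sec X V)"
  by (simp add: ringed_space_def)

lemma ringed_space_ring_hom_cring:
  "ringed_space X \<Longrightarrow> openin (topo X) U \<Longrightarrow> openin (topo X) V \<Longrightarrow> V \<subseteq> U \<Longrightarrow>
    ring_hom_cring (sec X U) (sec X V) (res X U V)"
  by (rule ring_hom_cring.intro[OF _ _ ring_hom_cring_axioms.intro])
    (simp_all add: ringed_space_cring ringed_space_res_hom)

lemma ringed_space_res_res:
  "ringed_space X \<Longrightarrow> openin (topo X) U \<Longrightarrow> openin (topo X) V \<Longrightarrow> openin (topo X) W \<Longrightarrow>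
    V \<subseteq> U \<Longrightarrow> W \<subseteq> V \<Longrightarrow> s \<in> carrier (sec X U) \<Longrightarrow> res X V W (res X U V s) = res X U W s"
  using sheaf_on_restrict_restrict[of "topo X" "\<lambda>U. carrier (sec X U)" "res X" U V W s]
  by (simp add: ringed_space_def)

lemma ring_hom_nat_pow:
  assumes "cring R" and "cring S" and "h \<in> ring_hom R S" and "x \<in> carrier R"
  shows "h (x [^]\<^bsub>R\<^esub> (k::nat)) = h x [^]\<^bsub>S\<^esub> k"
proof -
  interpret R: cring R by fact
  interpret S: cring S by fact
  interpret h: ring_hom_cring R S h
    using assms(3) by unfold_locales
  show ?thesis
    using assms(4) by (rule h.ring.hom_nat_pow)
qed

lemma ring_hom_Units:
  assumes "cring R" and "cring S" and h: "h \<in> ring_hom R S" and x: "x \<in> Units R"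
  shows "h x \<in> Units S"
proof -
  interpret R: cring R by fact
  interpret S: cring S by fact
  interpret h: ring_hom_cring R S h
    using h by unfold_locales
  have "h x \<otimes>\<^bsub>S\<^esub> h (inv\<^bsub>R\<^esub> x) = \<one>\<^bsub>S\<^esub>"
    using x R.Units_closed[OF x] h.hom_mult[of x "inv\<^bsub>R\<^esub> x"] by simp
  then show ?thesis
    using R.Units_closed[OF x] R.Units_inv_closed[OF x] S.m_comm[of "h x" "h (inv\<^bsub>R\<^esub> x)"]
    unfolding Units_def mem_Collect_eq by (metis h.hom_closed)
qed

text \<open>An isomorphism with the spectrum, read as a map \<open>\<pi>\<close> from the points of \<open>U\<close> to prime ideals.\<close>
lemma affine_open_chart:
  assumes X: "ringed_space X" and U: "affine_open X U"
  obtains \<pi> where "\<And>x. x \<in> U \<Longrightarrow> primeideal (\<pi> x) (sec X U)"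
    and "\<And>f. f \<in> carrier (sec X U) \<Longrightarrow> openin (topo X) {x \<in> U. f \<notin> \<pi> x}"
    and "\<And>f. f \<in> carrier (sec X U) \<Longrightarrow>
      is_localization (sec X U) f (sec X {x \<in> U. f \<notin> \<pi> x}) (res X U {x \<in> U. f \<notin> \<pi> x})"
    and "\<And>V x. openin (topo X) V \<Longrightarrow> V \<subseteq> U \<Longrightarrow> x \<in> V \<Longrightarrow>
      \<exists>f \<in> carrier (sec X U). f \<notin> \<pi> x \<and> {x \<in> U. f \<notin> \<pi> x} \<subseteq> V"
proof -
  let ?A = "sec X U" and ?S = "prime_spectrum (sec X U)" and ?T = "subtopology (topo X) U"
  have Uo: "openin (topo X) U"
    using U by (simp add: affine_open_def)
  obtain \<pi> where hom: "homeomorphic_map ?T ?S \<pi>"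
      and loc: "\<And>f. f \<in> carrier ?A \<Longrightarrow> is_localization ?A f (sec X {x \<in> U. f \<notin> \<pi> x}) (res X U {x \<in> U. f \<notin> \<pi> x})"
    using U by (auto simp: affine_open_def)
  have A: "cring ?A"
    using ringed_space_cring[OF X Uo] .
  have TU: "topspace ?T = U"
    using openin_subset[OF Uo] by (auto simp: topspace_subtopology)
  have cont: "continuous_map ?T ?S \<pi>" and op: "open_map ?T ?S \<pi>" and inj: "inj_on \<pi> U"
    using homeomorphic_imp_continuous_map[OF hom] homeomorphic_imp_open_map[OF hom]
      homeomorphic_imp_injective_map[OF hom] TU by simp_all
  have prime: "primeideal (\<pi> x) ?A" if "x \<in> U" for x
  proof -
    have "\<pi> x \<in> topspace ?S"
      using continuous_map_image_subset_topspace[OF cont] TU that by auto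
    then show ?thesis
      using prime_spectrum_basis[OF A openin_topspace] by blast
  qed
  show ?thesis
  proof
    fix f assume f: "f \<in> carrier ?A"
    have "openin ?S {P. primeideal P ?A \<and> f \<notin> P}"
      unfolding prime_spectrum_def using f by (intro topology_generated_by_Basis) blast
    from openin_continuous_map_preimage[OF cont this]
    have "openin ?T {x \<in> U. f \<notin> \<pi> x}"
      unfolding TU using prime by (auto cong: conj_cong elim!: back_subst[of "openin ?T"])
    then show "openin (topo X) {x \<in> U. f \<notin> \<pi> x}"
      using openin_open_subtopology[OF Uo] by blast
  next
    fix V x assume V: "openin (topo X) V" "V \<subseteq> U" "x \<in> V"
    then have "openin ?S (\<pi> ` V)"
      using op openin_open_subtopology[OF Uo] by (auto simp: open_map_def)
    then obtain f where f: "f \<in> carrier ?A" "f \<notin> \<pi> x" "{Q. primeideal Q ?A \<and> f \<notin> Q} \<subseteq> \<pi> ` V"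
      using prime_spectrum_basis[OF A, of "\<pi> ` V" "\<pi> x"] V(3) by blast
    have "{y \<in> U. f \<notin> \<pi> y} \<subseteq> V"
    proof clarify
      fix y assume y: "y \<in> U" "f \<notin> \<pi> y"
      then obtain z where "z \<in> V" "\<pi> y = \<pi> z"
        using f(3) prime[OF y(1)] by blast
      then show "y \<in> V"
        using inj_onD[OF inj, of y z] y V(2) by blast
    qed
    then show "\<exists>f \<in> carrier ?A. f \<notin> \<pi> x \<and> {y \<in> U. f \<notin> \<pi> y} \<subseteq> V"
      using f by blast
  qed (use prime loc in auto)
qed

text \<open>If the germ of \<open>f\<close> at \<open>x\<close> is a unit, then \<open>f\<close> is a unit on some \<open>D(g)\<close> that contains \<open>x\<close>. So \<open>f\<close> divides a
  power of \<open>g\<close>, and as the prime ideal of \<open>x\<close> does not contain this power, it does not contain \<open>f\<close>.\<close>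
lemma basic_open_eq:
  assumes X: "ringed_space X" and U: "openin (topo X) U"
    and prime: "\<And>x. x \<in> U \<Longrightarrow> primeideal (\<pi> x) (sec X U)"
    and D: "\<And>f. f \<in> carrier (sec X U) \<Longrightarrow> openin (topo X) {x \<in> U. f \<notin> \<pi> x}"
    and loc: "\<And>f. f \<in> carrier (sec X U) \<Longrightarrow>
      is_localization (sec X U) f (sec X {x \<in> U. f \<notin> \<pi> x}) (res X U {x \<in> U. f \<notin> \<pi> x})"
    and basis: "\<And>V x. openin (topo X) V \<Longrightarrow> V \<subseteq> U \<Longrightarrow> x \<in> V \<Longrightarrow>
      \<exists>f \<in> carrier (sec X U). f \<notin> \<pi> x \<and> {x \<in> U. f \<notin> \<pi> x} \<subseteq> V"
    and f: "f \<in> carrier (sec X U)"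
  shows "basic_open X U f = {x \<in> U. f \<notin> \<pi> x}"
proof (intro equalityI subsetI)
  fix x assume "x \<in> {x \<in> U. f \<notin> \<pi> x}"
  then show "x \<in> basic_open X U f"
    using D[OF f] loc[OF f] unfolding basic_open_def invertible_at_def is_localization_def by blast
next
  let ?A = "sec X U"
  interpret A: cring ?A
    by (rule ringed_space_cring[OF X U])
  fix x assume "x \<in> basic_open X U f"
  then obtain V where x: "x \<in> U" and V: "openin (topo X) V" "x \<in> V" "V \<subseteq> U" "res X U V f \<in> Units (sec X V)"
    by (auto simp: basic_open_def invertible_at_def)
  obtain g where g: "g \<in> carrier ?A" "g \<notin> \<pi> x" "{x \<in> U. g \<notin> \<pi> x} \<subseteq> V"
    using basis[OF V(1,3,2)] by blast
  define W where "W = {x \<in> U. g \<notin> \<pi> x}"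
  have Wo: "openin (topo X) W" and WV: "W \<subseteq> V" and WU: "W \<subseteq> U"
    using D[OF g(1)] g(3) by (auto simp: W_def)
  interpret B: cring "sec X W"
    by (rule ringed_space_cring[OF X Wo])
  have lW: "is_localization ?A g (sec X W) (res X U W)"
    using loc[OF g(1)] by (simp add: W_def)
  interpret \<rho>: ring_hom_cring ?A "sec X W" "res X U W"
    by (rule ringed_space_ring_hom_cring[OF X U Wo WU])
  have "res X V W (res X U V f) \<in> Units (sec X W)"
    by (rule ring_hom_Units[OF ringed_space_cring[OF X V(1)] B.is_cring ringed_space_res_hom[OF X V(1) Wo WV] V(4)])
  then have "res X U W f \<in> Units (sec X W)"
    using ringed_space_res_res[OF X U V(1) Wo V(3) WV f] by simp
  then obtain b where b: "b \<in> carrier (sec X W)" "res X U W f \<otimes>\<^bsub>sec X W\<^esub> b = \<one>\<^bsub>sec X W\<^esub>"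
    using B.Units_r_inv_ex by blast
  obtain k :: nat and a where a: "a \<in> carrier ?A" "res X U W a = res X U W g [^]\<^bsub>sec X W\<^esub> k \<otimes>\<^bsub>sec X W\<^esub> b"
    using lW b(1) unfolding is_localization_def by blast
  have "res X U W (f \<otimes>\<^bsub>?A\<^esub> a) = res X U W g [^]\<^bsub>sec X W\<^esub> k \<otimes>\<^bsub>sec X W\<^esub> (res X U W f \<otimes>\<^bsub>sec X W\<^esub> b)"
    using a b(1) f g(1) by (simp add: B.m_ac)
  also have "\<dots> = res X U W (g [^]\<^bsub>?A\<^esub> k)"
    using g(1) by (simp add: b(2) \<rho>.ring.hom_nat_pow)
  finally have "res X U W (f \<otimes>\<^bsub>?A\<^esub> a \<ominus>\<^bsub>?A\<^esub> g [^]\<^bsub>?A\<^esub> k) = \<zero>\<^bsub>sec X W\<^esub>"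
    using f a(1) g(1) by (simp add: A.minus_eq B.r_neg)
  then obtain l :: nat where l: "g [^]\<^bsub>?A\<^esub> l \<otimes>\<^bsub>?A\<^esub> (f \<otimes>\<^bsub>?A\<^esub> a \<ominus>\<^bsub>?A\<^esub> g [^]\<^bsub>?A\<^esub> k) = \<zero>\<^bsub>?A\<^esub>"
    using lW f a(1) g(1) unfolding is_localization_def by (meson A.m_closed A.minus_closed A.nat_pow_closed)
  interpret P: primeideal "\<pi> x" ?A
    by (rule prime[OF x])
  have pow: "g [^]\<^bsub>?A\<^esub> (i::nat) \<notin> \<pi> x" for i
  proof (induction i)
    case 0
    then show ?case
      using P.I_notcarr P.one_imp_carrier by auto
  next
    case (Suc i)
    then show ?case
      using P.I_prime[of "g [^]\<^bsub>?A\<^esub> i" g] g by auto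
  qed
  show "x \<in> {x \<in> U. f \<notin> \<pi> x}"
  proof (rule ccontr)
    assume "x \<notin> {x \<in> U. f \<notin> \<pi> x}"
    then have "f \<in> \<pi> x"
      using x by simp
    then have "f \<otimes>\<^bsub>?A\<^esub> a \<in> \<pi> x"
      using a(1) by (simp add: P.I_r_closed)
    moreover have "f \<otimes>\<^bsub>?A\<^esub> a \<ominus>\<^bsub>?A\<^esub> g [^]\<^bsub>?A\<^esub> k \<in> \<pi> x"
      using P.I_prime[of "g [^]\<^bsub>?A\<^esub> l" "f \<otimes>\<^bsub>?A\<^esub> a \<ominus>\<^bsub>?A\<^esub> g [^]\<^bsub>?A\<^esub> k"] l pow[of l] P.zero_closed f a(1) g(1)
      by auto
    ultimately have "f \<otimes>\<^bsub>?A\<^esub> a \<ominus>\<^bsub>?A\<^esub> (f \<otimes>\<^bsub>?A\<^esub> a \<ominus>\<^bsub>?A\<^esub> g [^]\<^bsub>?A\<^esub> k) \<in> \<pi> x"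
      unfolding A.minus_eq[of "f \<otimes>\<^bsub>?A\<^esub> a" "f \<otimes>\<^bsub>?A\<^esub> a \<ominus>\<^bsub>?A\<^esub> g [^]\<^bsub>?A\<^esub> k"]
      by (intro P.a_closed P.a_inv_closed)
    then show False
      using pow[of k] f a(1) g(1) by (simp add: A.diff_diff_self)
  qed
qed

lemma affine_open_openin: "affine_open X U \<Longrightarrow> openin (topo X) U"
  by (simp add: affine_open_def)

lemma basic_open_subset: "basic_open X U f \<subseteq> U"
  by (auto simp: basic_open_def)

lemma affine_basic_open:
  assumes X: "ringed_space X" and U: "affine_open X U"
  shows openin_basic_open: "f \<in> carrier (sec X U) \<Longrightarrow> openin (topo X) (basic_open X U f)"
    and localization_basic_open: "f \<in> carrier (sec X U) \<Longrightarrow>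
      is_localization (sec X U) f (sec X (basic_open X U f)) (res X U (basic_open X U f))"
    and basic_open_basis: "openin (topo X) V \<Longrightarrow> V \<subseteq> U \<Longrightarrow> x \<in> V \<Longrightarrow>
      \<exists>f \<in> carrier (sec X U). x \<in> basic_open X U f \<and> basic_open X U f \<subseteq> V"
proof -
  obtain \<pi> where \<pi>: "\<And>x. x \<in> U \<Longrightarrow> primeideal (\<pi> x) (sec X U)"
    "\<And>f. f \<in> carrier (sec X U) \<Longrightarrow> openin (topo X) {x \<in> U. f \<notin> \<pi> x}"
    "\<And>f. f \<in> carrier (sec X U) \<Longrightarrow>
      is_localization (sec X U) f (sec X {x \<in> U. f \<notin> \<pi> x}) (res X U {x \<in> U. f \<notin> \<pi> x})"
    "\<And>V x. openin (topo X) V \<Longrightarrow> V \<subseteq> U \<Longrightarrow> x \<in> V \<Longrightarrow>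
      \<exists>f \<in> carrier (sec X U). f \<notin> \<pi> x \<and> {x \<in> U. f \<notin> \<pi> x} \<subseteq> V"
    by (rule affine_open_chart[OF X U]) blast
  have eq: "basic_open X U f = {x \<in> U. f \<notin> \<pi> x}" if "f \<in> carrier (sec X U)" for f
    by (rule basic_open_eq[OF X affine_open_openin[OF U] \<pi> that])
  show "openin (topo X) (basic_open X U f)" if "f \<in> carrier (sec X U)" for f
    using \<pi>(2)[OF that] by (simp add: eq that)
  show "is_localization (sec X U) f (sec X (basic_open X U f)) (res X U (basic_open X U f))"
    if "f \<in> carrier (sec X U)" for f
    using \<pi>(3)[OF that] by (simp add: eq that)
  show "\<exists>f \<in> carrier (sec X U). x \<in> basic_open X U f \<and> basic_open X U f \<subseteq> V"
    if V: "openin (topo X) V" "V \<subseteq> U" "x \<in> V" for V x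
  proof -
    obtain f where "f \<in> carrier (sec X U)" "f \<notin> \<pi> x" "{x \<in> U. f \<notin> \<pi> x} \<subseteq> V"
      using \<pi>(4)[OF V] by blast
    then show ?thesis
      using V eq by (intro bexI[of _ f]) auto
  qed
qed

section \<open>The subsheaf of a Cartier module on which all multiples are killed\<close>

locale cartier_sheaf =
  fixes q :: nat and X :: "('a, 'b) ringed_space" and N :: "('a, 'b, 'm) cartier"
  assumes X: "ringed_space X" and cartier: "cartier_module q X N"
begin

lemma qcoh: "quasi_coherent X N"
  using cartier by (simp add: cartier_module_def)

lemma O_mod: "O_module X N"
  using qcoh by (simp add: quasi_coherent_def)

lemma sheaf: "sheaf_on (topo X) (\<lambda>U. carrier (msec N U)) (mres N)"
  using O_mod by (simp add: O_module_def)

lemma section_module: "openin (topo X) U \<Longrightarrow> module (sec X U) (msec N U)"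
  using O_mod by (simp add: O_module_def)

lemma sec_closed:
  "openin (topo X) U \<Longrightarrow> openin (topo X) V \<Longrightarrow> V \<subseteq> U \<Longrightarrow> r \<in> carrier (sec X U) \<Longrightarrow>
    res X U V r \<in> carrier (sec X V)"
  by (rule ring_hom_closed[OF ringed_space_res_hom[OF X]])

lemma res_pow:
  "openin (topo X) U \<Longrightarrow> openin (topo X) V \<Longrightarrow> V \<subseteq> U \<Longrightarrow> r \<in> carrier (sec X U) \<Longrightarrow>
    res X U V (r [^]\<^bsub>sec X U\<^esub> (k::nat)) = res X U V r [^]\<^bsub>sec X V\<^esub> k"
  by (rule ring_hom_nat_pow[OF ringed_space_cring[OF X] ringed_space_cring[OF X] ringed_space_res_hom[OF X]])

lemma res_mult:
  "openin (topo X) U \<Longrightarrow> openin (topo X) V \<Longrightarrow> V \<subseteq> U \<Longrightarrow> r \<in> carrier (sec X U) \<Longrightarrow> s \<in> carrier (sec X U) \<Longrightarrow>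
    res X U V (r \<otimes>\<^bsub>sec X U\<^esub> s) = res X U V r \<otimes>\<^bsub>sec X V\<^esub> res X U V s"
  by (rule ring_hom_mult[OF ringed_space_res_hom[OF X]])

lemma mres_closed:
  "openin (topo X) U \<Longrightarrow> openin (topo X) V \<Longrightarrow> V \<subseteq> U \<Longrightarrow> m \<in> carrier (msec N U) \<Longrightarrow>
    mres N U V m \<in> carrier (msec N V)"
  using sheaf_on_restrict_closed[OF sheaf] .

lemma mres_mres:
  "openin (topo X) U \<Longrightarrow> openin (topo X) V \<Longrightarrow> openin (topo X) W \<Longrightarrow> V \<subseteq> U \<Longrightarrow> W \<subseteq> V \<Longrightarrow>
    m \<in> carrier (msec N U) \<Longrightarrow> mres N V W (mres N U V m) = mres N U W m"
  using sheaf_on_restrict_restrict[OF sheaf] .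

lemma mres_self: "openin (topo X) U \<Longrightarrow> m \<in> carrier (msec N U) \<Longrightarrow> mres N U U m = m"
  using sheaf_on_restrict_self[OF sheaf] .

lemma mres_add:
  "openin (topo X) U \<Longrightarrow> openin (topo X) V \<Longrightarrow> V \<subseteq> U \<Longrightarrow> m \<in> carrier (msec N U) \<Longrightarrow> n \<in> carrier (msec N U) \<Longrightarrow>
    mres N U V (m \<oplus>\<^bsub>msec N U\<^esub> n) = mres N U V m \<oplus>\<^bsub>msec N V\<^esub> mres N U V n"
  using O_mod by (simp add: O_module_def)

lemma mres_smult:
  "openin (topo X) U \<Longrightarrow> openin (topo X) V \<Longrightarrow> V \<subseteq> U \<Longrightarrow> r \<in> carrier (sec X U) \<Longrightarrow> m \<in> carrier (msec N U) \<Longrightarrow>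
    mres N U V (r \<odot>\<^bsub>msec N U\<^esub> m) = res X U V r \<odot>\<^bsub>msec N V\<^esub> mres N U V m"
  using O_mod by (simp add: O_module_def)

lemma C_closed: "openin (topo X) U \<Longrightarrow> m \<in> carrier (msec N U) \<Longrightarrow> cmap N U m \<in> carrier (msec N U)"
  using cartier by (auto simp: cartier_module_def)

lemma C_add:
  "openin (topo X) U \<Longrightarrow> m \<in> carrier (msec N U) \<Longrightarrow> n \<in> carrier (msec N U) \<Longrightarrow>
    cmap N U (m \<oplus>\<^bsub>msec N U\<^esub> n) = cmap N U m \<oplus>\<^bsub>msec N U\<^esub> cmap N U n"
  using cartier by (simp add: cartier_module_def)

lemma C_smult:
  "openin (topo X) U \<Longrightarrow> r \<in> carrier (sec X U) \<Longrightarrow> m \<in> carrier (msec N U) \<Longrightarrow>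
    cmap N U (r [^]\<^bsub>sec X U\<^esub> q \<odot>\<^bsub>msec N U\<^esub> m) = r \<odot>\<^bsub>msec N U\<^esub> cmap N U m"
  using cartier by (simp add: cartier_module_def)

lemma C_res:
  "openin (topo X) U \<Longrightarrow> openin (topo X) V \<Longrightarrow> V \<subseteq> U \<Longrightarrow> m \<in> carrier (msec N U) \<Longrightarrow>
    mres N U V (cmap N U m) = cmap N V (mres N U V m)"
  using cartier by (simp add: cartier_module_def)

lemma zero_closed: "openin (topo X) U \<Longrightarrow> \<zero>\<^bsub>msec N U\<^esub> \<in> carrier (msec N U)"
  using module.axioms(2)[OF section_module] by (simp add: abelian_group_def abelian_monoid.zero_closed)

lemma smult_closed:
  "openin (topo X) U \<Longrightarrow> r \<in> carrier (sec X U) \<Longrightarrow> m \<in> carrier (msec N U) \<Longrightarrow>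
    r \<odot>\<^bsub>msec N U\<^esub> m \<in> carrier (msec N U)"
  using module.smult_closed[OF section_module] .

lemma mres_zero:
  assumes U: "openin (topo X) U" and V: "openin (topo X) V" "V \<subseteq> U"
  shows "mres N U V \<zero>\<^bsub>msec N U\<^esub> = \<zero>\<^bsub>msec N V\<^esub>"
proof -
  interpret U: module "sec X U" "msec N U" by (rule section_module[OF U])
  interpret V: module "sec X V" "msec N V" by (rule section_module[OF V(1)])
  interpret \<rho>: ring_hom_cring "sec X U" "sec X V" "res X U V"
    by (rule ringed_space_ring_hom_cring[OF X U V])
  have "mres N U V (\<zero>\<^bsub>sec X U\<^esub> \<odot>\<^bsub>msec N U\<^esub> \<zero>\<^bsub>msec N U\<^esub>) = \<zero>\<^bsub>sec X V\<^esub> \<odot>\<^bsub>msec N V\<^esub> mres N U V \<zero>\<^bsub>msec N U\<^esub>"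
    using mres_smult[OF U V, of "\<zero>\<^bsub>sec X U\<^esub>" "\<zero>\<^bsub>msec N U\<^esub>"] by simp
  then show ?thesis
    using mres_closed[OF U V zero_closed[OF U]] by simp
qed

lemma C_zero:
  assumes U: "openin (topo X) U"
  shows "cmap N U \<zero>\<^bsub>msec N U\<^esub> = \<zero>\<^bsub>msec N U\<^esub>"
proof -
  interpret U: module "sec X U" "msec N U" by (rule section_module[OF U])
  have "cmap N U (\<zero>\<^bsub>sec X U\<^esub> [^]\<^bsub>sec X U\<^esub> q \<odot>\<^bsub>msec N U\<^esub> \<zero>\<^bsub>msec N U\<^esub>) = \<zero>\<^bsub>sec X U\<^esub> \<odot>\<^bsub>msec N U\<^esub> cmap N U \<zero>\<^bsub>msec N U\<^esub>"
    by (rule C_smult[OF U]) auto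
  then show ?thesis
    using C_closed[OF U U.M.zero_closed] by simp
qed

lemma eq_if_locally_eq:
  assumes "openin (topo X) U" and "s \<in> carrier (msec N U)" and "t \<in> carrier (msec N U)"
    and "\<And>x. x \<in> U \<Longrightarrow> \<exists>V. openin (topo X) V \<and> x \<in> V \<and> V \<subseteq> U \<and> mres N U V s = mres N U V t"
  shows "s = t"
  using sheaf_on_eq_if_locally_eq[OF sheaf assms] .

lemma qcoh_extend:
  assumes "affine_open X U" and "f \<in> carrier (sec X U)" and "m \<in> carrier (msec N (basic_open X U f))"
  obtains k :: nat and n where "n \<in> carrier (msec N U)"
    and "mres N U (basic_open X U f) n =
      res X U (basic_open X U f) (f [^]\<^bsub>sec X U\<^esub> k) \<odot>\<^bsub>msec N (basic_open X U f)\<^esub> m"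
proof -
  have "\<forall>m \<in> carrier (msec N (basic_open X U f)). \<exists>k::nat. \<exists>n \<in> carrier (msec N U).
        mres N U (basic_open X U f) n =
          res X U (basic_open X U f) (f [^]\<^bsub>sec X U\<^esub> k) \<odot>\<^bsub>msec N (basic_open X U f)\<^esub> m"
    using qcoh assms(1,2) unfolding quasi_coherent_def by simp
  then show ?thesis
    using assms(3) that by blast
qed

lemma qcoh_zero:
  assumes "affine_open X U" and "f \<in> carrier (sec X U)" and "n \<in> carrier (msec N U)"
    and "mres N U (basic_open X U f) n = \<zero>\<^bsub>msec N (basic_open X U f)\<^esub>"
  shows "\<exists>k::nat. f [^]\<^bsub>sec X U\<^esub> k \<odot>\<^bsub>msec N U\<^esub> n = \<zero>\<^bsub>msec N U\<^esub>"
  using qcoh assms unfolding quasi_coherent_def by simp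

lemma res_basic_open_Unit:
  assumes "affine_open X U" and "f \<in> carrier (sec X U)"
  shows "res X U (basic_open X U f) f \<in> Units (sec X (basic_open X U f))"
  using localization_basic_open[OF X assms] by (simp add: is_localization_def)

lemma smult_Unit_cancel:
  assumes U: "openin (topo X) U" and u: "u \<in> Units (sec X U)"
    and m: "m \<in> carrier (msec N U)" "n \<in> carrier (msec N U)"
    and eq: "u \<odot>\<^bsub>msec N U\<^esub> m = u \<odot>\<^bsub>msec N U\<^esub> n"
  shows "m = n"
proof -
  interpret U: module "sec X U" "msec N U" by (rule section_module[OF U])
  have inv: "inv\<^bsub>sec X U\<^esub> u \<in> carrier (sec X U)" "u \<in> carrier (sec X U)"
    using u U.R.Units_closed U.R.Units_inv_closed by auto
  have "x = inv\<^bsub>sec X U\<^esub> u \<odot>\<^bsub>msec N U\<^esub> (u \<odot>\<^bsub>msec N U\<^esub> x)" if "x \<in> carrier (msec N U)" for x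
    using that u inv by (simp add: U.smult_assoc1[symmetric])
  then show ?thesis
    using m eq by metis
qed

lemma Unit_pow: "openin (topo X) U \<Longrightarrow> u \<in> Units (sec X U) \<Longrightarrow> u [^]\<^bsub>sec X U\<^esub> (k::nat) \<in> Units (sec X U)"
  using ringed_space_cring[OF X, of U] by (simp add: cring_def ring_def monoid.Units_pow_closed)

text \<open>The largest \<open>\<O>\<close>-submodule of \<open>N\<close> that \<open>C\<close> kills. Admitting multiples by sections over smaller open
  sets makes it a subsheaf for arbitrary open sets.\<close>
definition null where
  "null U = {m \<in> carrier (msec N U). \<forall>V. openin (topo X) V \<and> V \<subseteq> U \<longrightarrow>
    (\<forall>r \<in> carrier (sec X V). cmap N V (r \<odot>\<^bsub>msec N V\<^esub> mres N U V m) = \<zero>\<^bsub>msec N V\<^esub>)}"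

lemma nullD:
  "m \<in> null U \<Longrightarrow> openin (topo X) V \<Longrightarrow> V \<subseteq> U \<Longrightarrow> r \<in> carrier (sec X V) \<Longrightarrow>
    cmap N V (r \<odot>\<^bsub>msec N V\<^esub> mres N U V m) = \<zero>\<^bsub>msec N V\<^esub>"
  by (simp add: null_def)

lemma null_carrier: "m \<in> null U \<Longrightarrow> m \<in> carrier (msec N U)"
  by (simp add: null_def)

text \<open>Over an affine open set the multiples by sections over the whole set suffice. Locally any
  section is a fraction \<open>b/f\<^sup>k\<^sup>q\<close>, where the exponent of the denominator may be taken to be a multiple
  of \<open>q\<close>, and \<open>C\<close> takes \<open>f\<^sup>k\<^sup>q\<close> out of its argument as \<open>f\<^sup>k\<close>.\<close>
lemma null_affineI:
  assumes U: "affine_open X U" and m: "m \<in> carrier (msec N U)" and q: "0 < q"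
    and ann: "\<And>r. r \<in> carrier (sec X U) \<Longrightarrow> cmap N U (r \<odot>\<^bsub>msec N U\<^esub> m) = \<zero>\<^bsub>msec N U\<^esub>"
  shows "m \<in> null U"
proof -
  note Uo = affine_open_openin[OF U]
  interpret U: module "sec X U" "msec N U" by (rule section_module[OF Uo])
  have "cmap N V (r \<odot>\<^bsub>msec N V\<^esub> mres N U V m) = \<zero>\<^bsub>msec N V\<^esub>"
    if V: "openin (topo X) V" "V \<subseteq> U" and r: "r \<in> carrier (sec X V)" for V r
  proof (rule eq_if_locally_eq[OF V(1)])
    have mV: "mres N U V m \<in> carrier (msec N V)"
      using mres_closed[OF Uo V m] .
    show "cmap N V (r \<odot>\<^bsub>msec N V\<^esub> mres N U V m) \<in> carrier (msec N V)"
      by (intro C_closed smult_closed V r mV)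
    show "\<zero>\<^bsub>msec N V\<^esub> \<in> carrier (msec N V)"
      by (rule zero_closed[OF V(1)])
    fix x assume x: "x \<in> V"
    obtain f where f: "f \<in> carrier (sec X U)" and xD: "x \<in> basic_open X U f" and DV: "basic_open X U f \<subseteq> V"
      using basic_open_basis[OF X U V x] by blast
    define D where "D = basic_open X U f"
    have D: "openin (topo X) D" "D \<subseteq> U" "D \<subseteq> V"
      using openin_basic_open[OF X U f] DV basic_open_subset[of X U f] by (simp_all add: D_def)
    interpret D: module "sec X D" "msec N D" by (rule section_module[OF D(1)])
    define g where "g = res X U D f"
    have g: "g \<in> Units (sec X D)" "g \<in> carrier (sec X D)"
      using res_basic_open_Unit[OF U f] D.R.Units_closed by (simp_all add: g_def D_def)
    define rD where "rD = res X V D r"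
    have rD: "rD \<in> carrier (sec X D)"
      using sec_closed[OF V(1) D(1,3) r] by (simp add: rD_def)
    obtain k :: nat and a where a: "a \<in> carrier (sec X U)" "res X U D a = g [^]\<^bsub>sec X D\<^esub> k \<otimes>\<^bsub>sec X D\<^esub> rD"
      using localization_basic_open[OF X U f] rD unfolding is_localization_def D_def g_def by blast
    define mD where "mD = mres N U D m"
    have mD: "mD \<in> carrier (msec N D)"
      using mres_closed[OF Uo D(1,2) m] by (simp add: mD_def)
    \<comment> \<open>As \<open>k (q - 1) + k = k q\<close>, the numerator \<open>b\<close> belongs to the denominator \<open>f\<^sup>k\<^sup>q\<close>.\<close>
    define b where "b = f [^]\<^bsub>sec X U\<^esub> (k * (q - 1)) \<otimes>\<^bsub>sec X U\<^esub> a"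
    have b: "b \<in> carrier (sec X U)"
      using f a(1) by (simp add: b_def)
    have "k * (q - 1) + k = k * q"
      using q by (cases q) auto
    then have "res X U D b = (g [^]\<^bsub>sec X D\<^esub> k) [^]\<^bsub>sec X D\<^esub> q \<otimes>\<^bsub>sec X D\<^esub> rD"
      using res_mult[OF Uo D(1,2), of "f [^]\<^bsub>sec X U\<^esub> (k * (q - 1))" a] res_pow[OF Uo D(1,2) f] f a g(2) rD
      by (simp add: b_def D.R.m_assoc[symmetric] D.R.nat_pow_mult D.R.nat_pow_pow flip: g_def)
    then have "mres N U D (b \<odot>\<^bsub>msec N U\<^esub> m) = (g [^]\<^bsub>sec X D\<^esub> k) [^]\<^bsub>sec X D\<^esub> q \<odot>\<^bsub>msec N D\<^esub> (rD \<odot>\<^bsub>msec N D\<^esub> mD)"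
      using mres_smult[OF Uo D(1,2) b m] g(2) rD mD by (simp add: D.smult_assoc1 flip: mD_def)
    then have "g [^]\<^bsub>sec X D\<^esub> k \<odot>\<^bsub>msec N D\<^esub> cmap N D (rD \<odot>\<^bsub>msec N D\<^esub> mD) = cmap N D (mres N U D (b \<odot>\<^bsub>msec N U\<^esub> m))"
      using C_smult[OF D(1)] g(2) rD mD by simp
    also have "\<dots> = mres N U D (cmap N U (b \<odot>\<^bsub>msec N U\<^esub> m))"
      using C_res[OF Uo D(1,2)] b m by simp
    also have "\<dots> = \<zero>\<^bsub>msec N D\<^esub>"
      using ann[OF b] mres_zero[OF Uo D(1,2)] by simp
    also have "\<dots> = g [^]\<^bsub>sec X D\<^esub> k \<odot>\<^bsub>msec N D\<^esub> \<zero>\<^bsub>msec N D\<^esub>"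
      using g(2) by simp
    finally have zero: "cmap N D (rD \<odot>\<^bsub>msec N D\<^esub> mD) = \<zero>\<^bsub>msec N D\<^esub>"
      using smult_Unit_cancel[OF D(1) Unit_pow[OF D(1) g(1)]] C_closed[OF D(1)] rD mD by simp
    have "mres N V D (cmap N V (r \<odot>\<^bsub>msec N V\<^esub> mres N U V m)) = cmap N D (mres N V D (r \<odot>\<^bsub>msec N V\<^esub> mres N U V m))"
      using C_res[OF V(1) D(1,3) smult_closed[OF V(1) r mV]] .
    also have "mres N V D (r \<odot>\<^bsub>msec N V\<^esub> mres N U V m) = rD \<odot>\<^bsub>msec N D\<^esub> mD"
      using mres_smult[OF V(1) D(1,3) r mV] mres_mres[OF Uo V(1) D(1) V(2) D(3) m] by (simp add: rD_def mD_def)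
    finally have "mres N V D (cmap N V (r \<odot>\<^bsub>msec N V\<^esub> mres N U V m)) = mres N V D \<zero>\<^bsub>msec N V\<^esub>"
      using zero mres_zero[OF V(1) D(1,3)] by simp
    then show "\<exists>W. openin (topo X) W \<and> x \<in> W \<and> W \<subseteq> V \<and>
        mres N V W (cmap N V (r \<odot>\<^bsub>msec N V\<^esub> mres N U V m)) = mres N V W \<zero>\<^bsub>msec N V\<^esub>"
      using D xD by (auto simp flip: D_def)
  qed
  then show ?thesis
    using m unfolding null_def by blast
qed

lemma null_submodule:
  assumes U: "openin (topo X) U"
  shows "submodule (null U) (sec X U) (msec N U)"
proof -
  interpret U: module "sec X U" "msec N U" by (rule section_module[OF U])
  show ?thesis
  proof (rule U.submoduleI')
    show "null U \<subseteq> carrier (msec N U)"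
      using null_carrier by blast
    show "\<zero>\<^bsub>msec N U\<^esub> \<in> null U"
      unfolding null_def using mres_zero[OF U] C_zero zero_closed[OF U] by (auto simp: module.smult_r_null[OF section_module])
    show "m \<oplus>\<^bsub>msec N U\<^esub> n \<in> null U" if mn: "m \<in> null U" "n \<in> null U" for m n
    proof -
      have "cmap N V (r \<odot>\<^bsub>msec N V\<^esub> mres N U V (m \<oplus>\<^bsub>msec N U\<^esub> n)) = \<zero>\<^bsub>msec N V\<^esub>"
        if V: "openin (topo X) V" "V \<subseteq> U" and r: "r \<in> carrier (sec X V)" for V r
      proof -
        interpret V: module "sec X V" "msec N V" by (rule section_module[OF V(1)])
        note c = mres_closed[OF U V null_carrier[OF mn(1)]] mres_closed[OF U V null_carrier[OF mn(2)]]
        show ?thesis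
          using mres_add[OF U V null_carrier[OF mn(1)] null_carrier[OF mn(2)]]
            C_add[OF V(1) smult_closed[OF V(1) r c(1)] smult_closed[OF V(1) r c(2)]]
            nullD[OF mn(1) V r] nullD[OF mn(2) V r] r c by (simp add: V.smult_r_distr)
      qed
      then show ?thesis
        using null_carrier mn unfolding null_def by auto
    qed
    show "a \<odot>\<^bsub>msec N U\<^esub> m \<in> null U" if a: "a \<in> carrier (sec X U)" and m: "m \<in> null U" for a m
    proof -
      have "cmap N V (r \<odot>\<^bsub>msec N V\<^esub> mres N U V (a \<odot>\<^bsub>msec N U\<^esub> m)) = \<zero>\<^bsub>msec N V\<^esub>"
        if V: "openin (topo X) V" "V \<subseteq> U" and r: "r \<in> carrier (sec X V)" for V r
      proof -
        interpret V: module "sec X V" "msec N V" by (rule section_module[OF V(1)])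
        note c = mres_closed[OF U V null_carrier[OF m]] sec_closed[OF U V a]
        have "r \<odot>\<^bsub>msec N V\<^esub> mres N U V (a \<odot>\<^bsub>msec N U\<^esub> m) = (r \<otimes>\<^bsub>sec X V\<^esub> res X U V a) \<odot>\<^bsub>msec N V\<^esub> mres N U V m"
          using mres_smult[OF U V a null_carrier[OF m]] r c by (simp add: V.smult_assoc1)
        then show ?thesis
          using nullD[OF m V, of "r \<otimes>\<^bsub>sec X V\<^esub> res X U V a"] r c by simp
      qed
      then show ?thesis
        using smult_closed[OF U a null_carrier[OF m]] unfolding null_def by auto
    qed
  qed
qed

lemma null_res:
  assumes U: "openin (topo X) U" and V: "openin (topo X) V" "V \<subseteq> U" and m: "m \<in> null U"
  shows "mres N U V m \<in> null V"
proof -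
  have "cmap N W (r \<odot>\<^bsub>msec N W\<^esub> mres N V W (mres N U V m)) = \<zero>\<^bsub>msec N W\<^esub>"
    if W: "openin (topo X) W" "W \<subseteq> V" and r: "r \<in> carrier (sec X W)" for W r
    using nullD[OF m W(1) _ r] W(2) V(2) mres_mres[OF U V(1) W(1) V(2) W(2) null_carrier[OF m]] by simp
  then show ?thesis
    using mres_closed[OF U V null_carrier[OF m]] unfolding null_def by blast
qed

lemma C_null:
  assumes U: "openin (topo X) U" and m: "m \<in> null U"
  shows "cmap N U m = \<zero>\<^bsub>msec N U\<^esub>"
proof -
  interpret U: module "sec X U" "msec N U" by (rule section_module[OF U])
  show ?thesis
    using nullD[OF m U subset_refl, of "\<one>\<^bsub>sec X U\<^esub>"] mres_self[OF U null_carrier[OF m]] null_carrier[OF m] by simp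
qed

lemma null_if_locally_null:
  assumes op: "\<And>U. U \<in> \<U> \<Longrightarrow> openin (topo X) U" and t: "t \<in> carrier (msec N (\<Union>\<U>))"
    and loc: "\<And>U. U \<in> \<U> \<Longrightarrow> mres N (\<Union>\<U>) U t \<in> null U"
  shows "t \<in> null (\<Union>\<U>)"
proof -
  have S: "openin (topo X) (\<Union>\<U>)"
    using op by blast
  have "cmap N V (r \<odot>\<^bsub>msec N V\<^esub> mres N (\<Union>\<U>) V t) = \<zero>\<^bsub>msec N V\<^esub>"
    if V: "openin (topo X) V" "V \<subseteq> \<Union>\<U>" and r: "r \<in> carrier (sec X V)" for V r
  proof (rule eq_if_locally_eq[OF V(1)])
    have tV: "mres N (\<Union>\<U>) V t \<in> carrier (msec N V)"
      using mres_closed[OF S V t] .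
    show "cmap N V (r \<odot>\<^bsub>msec N V\<^esub> mres N (\<Union>\<U>) V t) \<in> carrier (msec N V)"
      by (intro C_closed smult_closed V r tV)
    show "\<zero>\<^bsub>msec N V\<^esub> \<in> carrier (msec N V)"
      by (rule zero_closed[OF V(1)])
    fix x assume x: "x \<in> V"
    then obtain U where U: "U \<in> \<U>" "x \<in> U"
      using V(2) by blast
    have W: "openin (topo X) (V \<inter> U)" "V \<inter> U \<subseteq> V" "V \<inter> U \<subseteq> U" "U \<subseteq> \<Union>\<U>"
      using V(1) op[OF U(1)] U(1) by auto
    have "mres N V (V \<inter> U) (cmap N V (r \<odot>\<^bsub>msec N V\<^esub> mres N (\<Union>\<U>) V t)) =
        cmap N (V \<inter> U) (res X V (V \<inter> U) r \<odot>\<^bsub>msec N (V \<inter> U)\<^esub> mres N V (V \<inter> U) (mres N (\<Union>\<U>) V t))"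
      using C_res[OF V(1) W(1,2) smult_closed[OF V(1) r tV]] mres_smult[OF V(1) W(1,2) r tV] by simp
    also have "mres N V (V \<inter> U) (mres N (\<Union>\<U>) V t) = mres N U (V \<inter> U) (mres N (\<Union>\<U>) U t)"
      using mres_mres[OF S V(1) W(1) V(2) W(2) t] mres_mres[OF S op[OF U(1)] W(1) W(4,3) t] by simp
    also have "cmap N (V \<inter> U) (res X V (V \<inter> U) r \<odot>\<^bsub>msec N (V \<inter> U)\<^esub> \<dots>) = \<zero>\<^bsub>msec N (V \<inter> U)\<^esub>"
      by (rule nullD[OF loc[OF U(1)] W(1,3) sec_closed[OF V(1) W(1,2) r]])
    finally have "mres N V (V \<inter> U) (cmap N V (r \<odot>\<^bsub>msec N V\<^esub> mres N (\<Union>\<U>) V t)) = mres N V (V \<inter> U) \<zero>\<^bsub>msec N V\<^esub>"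
      using mres_zero[OF V(1) W(1,2)] by simp
    then show "\<exists>W. openin (topo X) W \<and> x \<in> W \<and> W \<subseteq> V \<and>
        mres N V W (cmap N V (r \<odot>\<^bsub>msec N V\<^esub> mres N (\<Union>\<U>) V t)) = mres N V W \<zero>\<^bsub>msec N V\<^esub>"
      using W x U by blast
  qed
  then show ?thesis
    using t unfolding null_def by blast
qed

end

lemma preimage_frobenius:
  "openin (topo X) U \<Longrightarrow> preimage X (frobenius q X) U = U"
  using openin_subset by (fastforce simp: preimage_def frobenius_def)

lemma finsum_module_along:
  "finsum (module_along h B) g A = finsum B g A"
  by (simp add: module_along_def finsum_def finprod_def)

lemma F_finite_generators:
  assumes ff: "F_finite q X" and U: "affine_open X U"
  shows "\<exists>B \<subseteq> carrier (sec X U). finite B \<and> (\<forall>r \<in> carrier (sec X U). \<exists>c \<in> B \<rightarrow> carrier (sec X U).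
    r = (\<Oplus>\<^bsub>sec X U\<^esub>b\<in>B. c b [^]\<^bsub>sec X U\<^esub> q \<otimes>\<^bsub>sec X U\<^esub> b))"
proof -
  have "finitely_generated (sec X U) (module_along (sharp (frobenius q X) U) (sec X (preimage X (frobenius q X) U)))"
    using ff U by (simp add: F_finite_def finite_morphism_def)
  then have "finitely_generated (sec X U) (module_along (\<lambda>s. s [^]\<^bsub>sec X U\<^esub> q) (sec X U))"
    using preimage_frobenius[OF affine_open_openin[OF U], of q] by (simp add: frobenius_def)
  then show ?thesis
    unfolding finitely_generated_def finsum_module_along by (simp add: module_along_def)
qed

context cartier_sheaf
begin

text \<open>The ring elements \<open>r\<close> with \<open>C(r m) = 0\<close> form a module over the \<open>q\<close>-th powers.\<close>
lemma C_eq_zero_from_generators: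
  assumes U: "openin (topo X) U" and m: "m \<in> carrier (msec N U)"
    and B: "finite B" "B \<subseteq> carrier (sec X U)" and c: "c \<in> B \<rightarrow> carrier (sec X U)"
    and zero: "\<And>b. b \<in> B \<Longrightarrow> cmap N U (b \<odot>\<^bsub>msec N U\<^esub> m) = \<zero>\<^bsub>msec N U\<^esub>"
  shows "cmap N U ((\<Oplus>\<^bsub>sec X U\<^esub>b\<in>B. c b [^]\<^bsub>sec X U\<^esub> q \<otimes>\<^bsub>sec X U\<^esub> b) \<odot>\<^bsub>msec N U\<^esub> m) = \<zero>\<^bsub>msec N U\<^esub>"
  using B c zero
proof (induction B rule: finite_induct)
  case empty
  interpret U: module "sec X U" "msec N U" by (rule section_module[OF U])
  show ?case
    using m C_zero[OF U] by simp
next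
  case (insert b B)
  interpret U: module "sec X U" "msec N U" by (rule section_module[OF U])
  let ?g = "\<lambda>b. c b [^]\<^bsub>sec X U\<^esub> q \<otimes>\<^bsub>sec X U\<^esub> b"
  have g: "?g \<in> B \<rightarrow> carrier (sec X U)" and b: "b \<in> carrier (sec X U)" "c b \<in> carrier (sec X U)"
    using insert.prems by (auto simp: Pi_iff)
  have s: "finsum (sec X U) ?g B \<in> carrier (sec X U)"
    using g by (rule U.R.finsum_closed)
  have "finsum (sec X U) ?g (insert b B) \<odot>\<^bsub>msec N U\<^esub> m =
      c b [^]\<^bsub>sec X U\<^esub> q \<odot>\<^bsub>msec N U\<^esub> (b \<odot>\<^bsub>msec N U\<^esub> m) \<oplus>\<^bsub>msec N U\<^esub> finsum (sec X U) ?g B \<odot>\<^bsub>msec N U\<^esub> m"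
    using U.R.finsum_insert[OF insert.hyps g] b s m by (simp add: U.smult_l_distr U.smult_assoc1)
  moreover have "cmap N U (finsum (sec X U) ?g B \<odot>\<^bsub>msec N U\<^esub> m) = \<zero>\<^bsub>msec N U\<^esub>"
    using insert.prems by (intro insert.IH) auto
  moreover have "cmap N U (c b [^]\<^bsub>sec X U\<^esub> q \<odot>\<^bsub>msec N U\<^esub> (b \<odot>\<^bsub>msec N U\<^esub> m)) = c b \<odot>\<^bsub>msec N U\<^esub> \<zero>\<^bsub>msec N U\<^esub>"
    using C_smult[OF U b(2) smult_closed[OF U b(1) m]] insert.prems(3)[of b] by simp
  ultimately show ?case
    using b s m by (simp add: C_add[OF U])
qed

text \<open>This is the part of quasi-coherence that needs a finiteness condition. A power of \<open>f\<close> extends \<open>m\<close>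
  to a section \<open>n0\<close> of \<open>N\<close> over \<open>U\<close>, and for each \<open>b\<close> a further power of \<open>f\<close> kills \<open>C(b n0)\<close>. If \<open>b\<close> runs
  through finitely many generators of the ring over its \<open>q\<close>-th powers, one exponent serves them all.\<close>
lemma null_extend:
  assumes ff: "F_finite q X" and q: "0 < q" and U: "affine_open X U" and f: "f \<in> carrier (sec X U)"
    and m: "m \<in> null (basic_open X U f)"
  shows "\<exists>k::nat. \<exists>n \<in> null U. mres N U (basic_open X U f) n =
    res X U (basic_open X U f) (f [^]\<^bsub>sec X U\<^esub> k) \<odot>\<^bsub>msec N (basic_open X U f)\<^esub> m"
proof -
  note Uo = affine_open_openin[OF U]
  define D where "D = basic_open X U f"
  have D: "openin (topo X) D" "D \<subseteq> U"
    using openin_basic_open[OF X U f] basic_open_subset[of X U f] by (simp_all add: D_def)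
  interpret U: module "sec X U" "msec N U" by (rule section_module[OF Uo])
  interpret D: module "sec X D" "msec N D" by (rule section_module[OF D(1)])
  have mD: "m \<in> null D" "m \<in> carrier (msec N D)"
    using m null_carrier by (simp_all add: D_def)
  note fD = sec_closed[OF Uo D f]
  obtain k0 :: nat and n0 where n0: "n0 \<in> carrier (msec N U)"
      and n0D: "mres N U D n0 = res X U D (f [^]\<^bsub>sec X U\<^esub> k0) \<odot>\<^bsub>msec N D\<^esub> m"
    using qcoh_extend[OF U f] mD(2) unfolding D_def by metis
  obtain B where B: "finite B" "B \<subseteq> carrier (sec X U)"
      and gen: "\<And>r. r \<in> carrier (sec X U) \<Longrightarrow> \<exists>c \<in> B \<rightarrow> carrier (sec X U).
        r = (\<Oplus>\<^bsub>sec X U\<^esub>b\<in>B. c b [^]\<^bsub>sec X U\<^esub> q \<otimes>\<^bsub>sec X U\<^esub> b)"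
    using F_finite_generators[OF ff U] by blast
  have "\<exists>k::nat. f [^]\<^bsub>sec X U\<^esub> k \<odot>\<^bsub>msec N U\<^esub> cmap N U (b \<odot>\<^bsub>msec N U\<^esub> n0) = \<zero>\<^bsub>msec N U\<^esub>"
    if b: "b \<in> carrier (sec X U)" for b
  proof (rule qcoh_zero[OF U f, folded D_def])
    have bn: "b \<odot>\<^bsub>msec N U\<^esub> n0 \<in> carrier (msec N U)"
      using b n0 by simp
    then show "cmap N U (b \<odot>\<^bsub>msec N U\<^esub> n0) \<in> carrier (msec N U)"
      by (rule C_closed[OF Uo])
    have r: "res X U D b \<otimes>\<^bsub>sec X D\<^esub> res X U D (f [^]\<^bsub>sec X U\<^esub> k0) \<in> carrier (sec X D)"
      by (intro D.R.m_closed sec_closed[OF Uo D] b U.R.nat_pow_closed f)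
    have "mres N U D (b \<odot>\<^bsub>msec N U\<^esub> n0) =
        (res X U D b \<otimes>\<^bsub>sec X D\<^esub> res X U D (f [^]\<^bsub>sec X U\<^esub> k0)) \<odot>\<^bsub>msec N D\<^esub> m"
      using mres_smult[OF Uo D b n0] n0D mD(2) sec_closed[OF Uo D b] sec_closed[OF Uo D, of "f [^]\<^bsub>sec X U\<^esub> k0"] f
      by (simp add: D.smult_assoc1)
    then have "mres N U D (cmap N U (b \<odot>\<^bsub>msec N U\<^esub> n0)) =
        cmap N D ((res X U D b \<otimes>\<^bsub>sec X D\<^esub> res X U D (f [^]\<^bsub>sec X U\<^esub> k0)) \<odot>\<^bsub>msec N D\<^esub> m)"
      using C_res[OF Uo D bn] by simp
    then show "mres N U D (cmap N U (b \<odot>\<^bsub>msec N U\<^esub> n0)) = \<zero>\<^bsub>msec N D\<^esub>"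
      using nullD[OF mD(1) D(1) subset_refl r] mres_self[OF D(1) mD(2)] by simp
  qed
  then obtain l :: "_ \<Rightarrow> nat" where l: "\<And>b. b \<in> carrier (sec X U) \<Longrightarrow>
      f [^]\<^bsub>sec X U\<^esub> l b \<odot>\<^bsub>msec N U\<^esub> cmap N U (b \<odot>\<^bsub>msec N U\<^esub> n0) = \<zero>\<^bsub>msec N U\<^esub>"
    by metis
  \<comment> \<open>To pass through \<open>C\<close> as \<open>f\<^sup>L\<close>, the factor has to be \<open>f\<^sup>L\<^sup>q\<close>.\<close>
  define L where "L = (\<Sum>b\<in>B. l b)"
  define n where "n = (f [^]\<^bsub>sec X U\<^esub> L) [^]\<^bsub>sec X U\<^esub> q \<odot>\<^bsub>msec N U\<^esub> n0"
  have n: "n \<in> carrier (msec N U)"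
    using f n0 by (simp add: n_def)
  have gens_zero: "cmap N U (b \<odot>\<^bsub>msec N U\<^esub> n) = \<zero>\<^bsub>msec N U\<^esub>" if b: "b \<in> B" for b
  proof -
    have bc: "b \<in> carrier (sec X U)"
      using b B by auto
    have Cb: "cmap N U (b \<odot>\<^bsub>msec N U\<^esub> n0) \<in> carrier (msec N U)"
      using C_closed[OF Uo] bc n0 by simp
    have "l b \<le> L"
      unfolding L_def using B(1) b by (intro member_le_sum) auto
    then have "f [^]\<^bsub>sec X U\<^esub> L = f [^]\<^bsub>sec X U\<^esub> (L - l b) \<otimes>\<^bsub>sec X U\<^esub> f [^]\<^bsub>sec X U\<^esub> l b"
      using f by (simp add: U.R.nat_pow_mult)
    then have z: "f [^]\<^bsub>sec X U\<^esub> L \<odot>\<^bsub>msec N U\<^esub> cmap N U (b \<odot>\<^bsub>msec N U\<^esub> n0) = \<zero>\<^bsub>msec N U\<^esub>"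
      using l[OF bc] f Cb by (simp add: U.smult_assoc1)
    have "b \<odot>\<^bsub>msec N U\<^esub> n = (f [^]\<^bsub>sec X U\<^esub> L) [^]\<^bsub>sec X U\<^esub> q \<odot>\<^bsub>msec N U\<^esub> (b \<odot>\<^bsub>msec N U\<^esub> n0)"
      unfolding n_def using f n0 bc by (simp add: U.smult_assoc1[symmetric] U.R.m_comm)
    then show ?thesis
      using C_smult[OF Uo, of "f [^]\<^bsub>sec X U\<^esub> L" "b \<odot>\<^bsub>msec N U\<^esub> n0"] z f n0 bc by simp
  qed
  have "n \<in> null U"
  proof (rule null_affineI[OF U n q])
    fix r assume "r \<in> carrier (sec X U)"
    then obtain c where c: "c \<in> B \<rightarrow> carrier (sec X U)"
        "r = (\<Oplus>\<^bsub>sec X U\<^esub>b\<in>B. c b [^]\<^bsub>sec X U\<^esub> q \<otimes>\<^bsub>sec X U\<^esub> b)"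
      using gen by blast
    then show "cmap N U (r \<odot>\<^bsub>msec N U\<^esub> n) = \<zero>\<^bsub>msec N U\<^esub>"
      using C_eq_zero_from_generators[OF Uo n B c(1) gens_zero] by simp
  qed
  moreover have "mres N U D n = res X U D (f [^]\<^bsub>sec X U\<^esub> (L * q + k0)) \<odot>\<^bsub>msec N D\<^esub> m"
  proof -
    have p: "f [^]\<^bsub>sec X U\<^esub> (L * q) \<in> carrier (sec X U)" "f [^]\<^bsub>sec X U\<^esub> k0 \<in> carrier (sec X U)"
      using f by auto
    have "mres N U D n = res X U D (f [^]\<^bsub>sec X U\<^esub> (L * q)) \<odot>\<^bsub>msec N D\<^esub> mres N U D n0"
      unfolding n_def using mres_smult[OF Uo D p(1) n0] f by (simp add: U.R.nat_pow_pow)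
    also have "\<dots> = res X U D (f [^]\<^bsub>sec X U\<^esub> (L * q) \<otimes>\<^bsub>sec X U\<^esub> f [^]\<^bsub>sec X U\<^esub> k0) \<odot>\<^bsub>msec N D\<^esub> m"
      using n0D mD(2) res_mult[OF Uo D p] sec_closed[OF Uo D p(1)] sec_closed[OF Uo D p(2)]
      by (simp add: D.smult_assoc1)
    finally show ?thesis
      using f by (simp add: U.R.nat_pow_mult)
  qed
  ultimately show ?thesis
    unfolding D_def by blast
qed

lemma restrict_carriers_simps:
  "msec (restrict_carriers N L) = (\<lambda>U. (msec N U)\<lparr>carrier := L U\<rparr>)"
  "mres (restrict_carriers N L) = mres N"
  "cmap (restrict_carriers N L) = cmap N"
  by (simp_all add: restrict_carriers_def)

lemma sheaf_null: "sheaf_on (topo X) null (mres N)"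
  unfolding sheaf_on_def
proof (intro conjI allI impI)
  show "mres N U V \<in> null U \<rightarrow> null V" if "openin (topo X) U \<and> openin (topo X) V \<and> V \<subseteq> U" for U V
    using that null_res by blast
  show "\<forall>s \<in> null U. mres N U U s = s" if "openin (topo X) U" for U
    using that mres_self null_carrier by blast
  show "\<forall>s \<in> null U. mres N V W (mres N U V s) = mres N U W s"
    if "openin (topo X) U \<and> openin (topo X) V \<and> openin (topo X) W \<and> W \<subseteq> V \<and> V \<subseteq> U" for U V W
    using that mres_mres[of U V W] null_carrier by simp
  show "\<forall>s \<in> null (\<Union>\<U>). \<forall>t \<in> null (\<Union>\<U>). (\<forall>U \<in> \<U>. mres N (\<Union>\<U>) U s = mres N (\<Union>\<U>) U t) \<longrightarrow> s = t"
    if "\<forall>U \<in> \<U>. openin (topo X) U" for \<U>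
  proof (intro ballI impI)
    fix s t assume st: "s \<in> null (\<Union>\<U>)" "t \<in> null (\<Union>\<U>)"
      and eq: "\<forall>U \<in> \<U>. mres N (\<Union>\<U>) U s = mres N (\<Union>\<U>) U t"
    show "s = t"
    proof (rule sheaf_on_separated[OF sheaf, where \<U> = \<U>])
      show "openin (topo X) U" "mres N (\<Union>\<U>) U s = mres N (\<Union>\<U>) U t" if "U \<in> \<U>" for U
        using that eq \<open>\<forall>U \<in> \<U>. openin (topo X) U\<close> by blast+
    qed (use st null_carrier in blast)+
  qed
  fix \<U> and s :: "'a set \<Rightarrow> 'm"
  assume a: "(\<forall>U \<in> \<U>. openin (topo X) U \<and> s U \<in> null U) \<and>
    (\<forall>U \<in> \<U>. \<forall>V \<in> \<U>. mres N U (U \<inter> V) (s U) = mres N V (U \<inter> V) (s V))"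
  have "\<exists>t \<in> carrier (msec N (\<Union>\<U>)). \<forall>U \<in> \<U>. mres N (\<Union>\<U>) U t = s U"
  proof (rule sheaf_on_glue[OF sheaf, of \<U>])
    show "openin (topo X) U" "s U \<in> carrier (msec N U)" if "U \<in> \<U>" for U
      using a that null_carrier by blast+
    show "mres N U (U \<inter> V) (s U) = mres N V (U \<inter> V) (s V)" if "U \<in> \<U>" "V \<in> \<U>" for U V
      using a that by blast
  qed
  then obtain t where t: "t \<in> carrier (msec N (\<Union>\<U>))" "\<And>U. U \<in> \<U> \<Longrightarrow> mres N (\<Union>\<U>) U t = s U"
    by blast
  have "t \<in> null (\<Union>\<U>)"
  proof (rule null_if_locally_null)
    show "openin (topo X) U" "mres N (\<Union>\<U>) U t \<in> null U" if "U \<in> \<U>" for U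
      using a t(2)[OF that] that by simp_all
  qed (rule t(1))
  then show "\<exists>t \<in> null (\<Union>\<U>). \<forall>U \<in> \<U>. mres N (\<Union>\<U>) U t = s U"
    using t(2) by blast
qed

lemma quasi_coherent_null:
  assumes ff: "F_finite q X" and q: "0 < q"
  shows "quasi_coherent X (restrict_carriers N null)"
  unfolding quasi_coherent_def
proof (intro conjI allI impI)
  show "O_module X (restrict_carriers N null)"
    unfolding O_module_def restrict_carriers_simps
  proof (intro conjI allI impI)
    show "sheaf_on (topo X) (\<lambda>U. carrier ((msec N U)\<lparr>carrier := null U\<rparr>)) (mres N)"
      using sheaf_null by simp
    show "module (sec X U) ((msec N U)\<lparr>carrier := null U\<rparr>)" if "openin (topo X) U" for U
      using submodule.submodule_is_module[OF null_submodule section_module] that by blast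
  qed (auto simp: mres_add mres_smult null_carrier)
next
  fix U f assume Uf: "affine_open X U \<and> f \<in> carrier (sec X U)"
  show "\<forall>m \<in> carrier (msec (restrict_carriers N null) (basic_open X U f)).
      \<exists>k::nat. \<exists>n \<in> carrier (msec (restrict_carriers N null) U).
        mres (restrict_carriers N null) U (basic_open X U f) n =
          res X U (basic_open X U f) (f [^]\<^bsub>sec X U\<^esub> k) \<odot>\<^bsub>msec (restrict_carriers N null) (basic_open X U f)\<^esub> m"
    using null_extend[OF ff q] Uf by (simp add: restrict_carriers_simps)
  show "\<forall>n \<in> carrier (msec (restrict_carriers N null) U).
      mres (restrict_carriers N null) U (basic_open X U f) n = \<zero>\<^bsub>msec (restrict_carriers N null) (basic_open X U f)\<^esub> \<longrightarrow>
      (\<exists>k::nat. f [^]\<^bsub>sec X U\<^esub> k \<odot>\<^bsub>msec (restrict_carriers N null) U\<^esub> n = \<zero>\<^bsub>msec (restrict_carriers N null) U\<^esub>)"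
    using qcoh_zero[of U f] Uf null_carrier by (simp add: restrict_carriers_simps)
qed

lemma nilpotent_cartier_submodule_null:
  assumes ff: "F_finite q X" and q: "0 < q"
  shows "nilpotent_cartier_submodule q X N null"
  unfolding nilpotent_cartier_submodule_def
proof (intro conjI allI impI)
  show "null U \<subseteq> carrier (msec N U)" for U
    using null_carrier by blast
  have zero: "\<zero>\<^bsub>msec N U\<^esub> \<in> null U" if "openin (topo X) U" for U
    using module.submodule_zero[OF section_module null_submodule] that by blast
  show "cartier_module q X (restrict_carriers N null)"
    unfolding cartier_module_def
  proof (intro conjI allI impI)
    show "quasi_coherent X (restrict_carriers N null)"
      by (rule quasi_coherent_null[OF ff q])
  qed (auto simp: restrict_carriers_simps C_null zero C_add C_smult mres_zero null_res null_carrier)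
  show "nilpotent_cartier X (restrict_carriers N null)"
    unfolding nilpotent_cartier_def
    by (rule exI[of _ 1]) (auto simp: restrict_carriers_simps C_null)
qed

lemma no_nilpotent_submodule_affine:
  assumes ff: "F_finite q X" and q: "0 < q"
    and nil: "largest_nilpotent_submodule q X N (\<lambda>U. {\<zero>\<^bsub>msec N U\<^esub>})"
    and U: "affine_open X U" and m: "m \<in> carrier (msec N U)"
    and ann: "\<And>r. r \<in> carrier (sec X U) \<Longrightarrow> cmap N U (r \<odot>\<^bsub>msec N U\<^esub> m) = \<zero>\<^bsub>msec N U\<^esub>"
  shows "m = \<zero>\<^bsub>msec N U\<^esub>"
proof -
  have "null U \<subseteq> {\<zero>\<^bsub>msec N U\<^esub>}"
    using nil nilpotent_cartier_submodule_null[OF ff q] affine_open_openin[OF U]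
    unfolding largest_nilpotent_submodule_def by simp
  then show ?thesis
    using null_affineI[OF U m q ann] by blast
qed

end

section \<open>Morphisms of Cartier modules\<close>

lemma cartier_homD:
  assumes "\<phi> \<in> cartier_hom X M N"
  shows "\<phi> \<in> extensional {U. openin (topo X) U}"
    and "\<And>U. openin (topo X) U \<Longrightarrow> \<phi> U \<in> carrier (msec M U) \<rightarrow>\<^sub>E carrier (msec N U)"
    and "\<And>U m. openin (topo X) U \<Longrightarrow> m \<in> carrier (msec M U) \<Longrightarrow> \<phi> U m \<in> carrier (msec N U)"
    and "\<And>U m n. openin (topo X) U \<Longrightarrow> m \<in> carrier (msec M U) \<Longrightarrow> n \<in> carrier (msec M U) \<Longrightarrow>
      \<phi> U (m \<oplus>\<^bsub>msec M U\<^esub> n) = \<phi> U m \<oplus>\<^bsub>msec N U\<^esub> \<phi> U n"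
    and "\<And>U r m. openin (topo X) U \<Longrightarrow> r \<in> carrier (sec X U) \<Longrightarrow> m \<in> carrier (msec M U) \<Longrightarrow>
      \<phi> U (r \<odot>\<^bsub>msec M U\<^esub> m) = r \<odot>\<^bsub>msec N U\<^esub> \<phi> U m"
    and "\<And>U m. openin (topo X) U \<Longrightarrow> m \<in> carrier (msec M U) \<Longrightarrow> \<phi> U (cmap M U m) = cmap N U (\<phi> U m)"
    and "\<And>U V m. openin (topo X) U \<Longrightarrow> openin (topo X) V \<Longrightarrow> V \<subseteq> U \<Longrightarrow> m \<in> carrier (msec M U) \<Longrightarrow>
      mres N U V (\<phi> U m) = \<phi> V (mres M U V m)"
proof -
  have 1: "\<phi> \<in> extensional {U. openin (topo X) U} \<and>
    (\<forall>U. openin (topo X) U \<longrightarrow>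
      \<phi> U \<in> carrier (msec M U) \<rightarrow>\<^sub>E carrier (msec N U) \<and>
      (\<forall>m \<in> carrier (msec M U). \<forall>m' \<in> carrier (msec M U).
        \<phi> U (m \<oplus>\<^bsub>msec M U\<^esub> m') = \<phi> U m \<oplus>\<^bsub>msec N U\<^esub> \<phi> U m') \<and>
      (\<forall>r \<in> carrier (sec X U). \<forall>m \<in> carrier (msec M U).
        \<phi> U (r \<odot>\<^bsub>msec M U\<^esub> m) = r \<odot>\<^bsub>msec N U\<^esub> \<phi> U m) \<and>
      (\<forall>m \<in> carrier (msec M U). \<phi> U (cmap M U m) = cmap N U (\<phi> U m))) \<and>
    (\<forall>U V. openin (topo X) U \<and> openin (topo X) V \<and> V \<subseteq> U \<longrightarrow>
      (\<forall>m \<in> carrier (msec M U). mres N U V (\<phi> U m) = \<phi> V (mres M U V m)))"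
    using assms unfolding cartier_hom_def mem_Collect_eq .
  show "\<phi> \<in> extensional {U. openin (topo X) U}"
    using 1 by (rule conjunct1)
  note 2 = 1[THEN conjunct2, THEN conjunct1, rule_format] and 3 = 1[THEN conjunct2, THEN conjunct2, rule_format]
  show "\<phi> U \<in> carrier (msec M U) \<rightarrow>\<^sub>E carrier (msec N U)" if "openin (topo X) U" for U
    using 2[OF that] by (rule conjunct1)
  then show "\<phi> U m \<in> carrier (msec N U)" if "openin (topo X) U" "m \<in> carrier (msec M U)" for U m
    using that by (meson PiE_mem)
  show "\<phi> U (m \<oplus>\<^bsub>msec M U\<^esub> n) = \<phi> U m \<oplus>\<^bsub>msec N U\<^esub> \<phi> U n"
    if "openin (topo X) U" "m \<in> carrier (msec M U)" "n \<in> carrier (msec M U)" for U m n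
    using 2[OF that(1)] that(2,3) by simp
  show "\<phi> U (r \<odot>\<^bsub>msec M U\<^esub> m) = r \<odot>\<^bsub>msec N U\<^esub> \<phi> U m"
    if "openin (topo X) U" "r \<in> carrier (sec X U)" "m \<in> carrier (msec M U)" for U r m
    using 2[OF that(1)] that(2,3) by simp
  show "\<phi> U (cmap M U m) = cmap N U (\<phi> U m)" if "openin (topo X) U" "m \<in> carrier (msec M U)" for U m
    using 2[OF that(1)] that(2) by simp
  show "mres N U V (\<phi> U m) = \<phi> V (mres M U V m)"
    if "openin (topo X) U" "openin (topo X) V" "V \<subseteq> U" "m \<in> carrier (msec M U)" for U V m
    using 3[of U V m] that by simp
qed

lemma cartier_homI:
  assumes "\<phi> \<in> extensional {U. openin (topo X) U}"
    and "\<And>U. openin (topo X) U \<Longrightarrow> \<phi> U \<in> extensional (carrier (msec M U))"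
    and "\<And>U m. openin (topo X) U \<Longrightarrow> m \<in> carrier (msec M U) \<Longrightarrow> \<phi> U m \<in> carrier (msec N U)"
    and "\<And>U m n. openin (topo X) U \<Longrightarrow> m \<in> carrier (msec M U) \<Longrightarrow> n \<in> carrier (msec M U) \<Longrightarrow>
      \<phi> U (m \<oplus>\<^bsub>msec M U\<^esub> n) = \<phi> U m \<oplus>\<^bsub>msec N U\<^esub> \<phi> U n"
    and "\<And>U r m. openin (topo X) U \<Longrightarrow> r \<in> carrier (sec X U) \<Longrightarrow> m \<in> carrier (msec M U) \<Longrightarrow>
      \<phi> U (r \<odot>\<^bsub>msec M U\<^esub> m) = r \<odot>\<^bsub>msec N U\<^esub> \<phi> U m"
    and "\<And>U m. openin (topo X) U \<Longrightarrow> m \<in> carrier (msec M U) \<Longrightarrow> \<phi> U (cmap M U m) = cmap N U (\<phi> U m)"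
    and "\<And>U V m. openin (topo X) U \<Longrightarrow> openin (topo X) V \<Longrightarrow> V \<subseteq> U \<Longrightarrow> m \<in> carrier (msec M U) \<Longrightarrow>
      mres N U V (\<phi> U m) = \<phi> V (mres M U V m)"
  shows "\<phi> \<in> cartier_hom X M N"
  unfolding cartier_hom_def mem_Collect_eq
  by (intro conjI allI impI ballI PiE_I assms)
    (auto dest: assms(2) simp: extensional_def)

lemma cartier_hom_eqI:
  assumes "\<phi> \<in> cartier_hom X M N" and "\<psi> \<in> cartier_hom X M N"
    and "\<And>U m. openin (topo X) U \<Longrightarrow> m \<in> carrier (msec M U) \<Longrightarrow> \<phi> U m = \<psi> U m"
  shows "\<phi> = \<psi>"
proof (rule extensionalityI[OF cartier_homD(1)[OF assms(1)] cartier_homD(1)[OF assms(2)]])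
  fix U assume "U \<in> {U. openin (topo X) U}"
  then have U: "openin (topo X) U"
    by simp
  show "\<phi> U = \<psi> U"
    using cartier_homD(2)[OF assms(1) U] cartier_homD(2)[OF assms(2) U] assms(3)[OF U]
    by (rule PiE_ext)
qed

text \<open>Every point has a neighbourhood \<open>D(f)\<close> inside an affine \<open>U\<close> of the cover on which a given section
  of \<open>M\<close> is, up to a power of the unit \<open>f\<close>, the restriction of a section over \<open>U\<close>.\<close>
lemma cartier_hom_eqI_affine_cover:
  assumes M: "cartier_sheaf q X M" and N: "cartier_sheaf q' X N"
    and \<phi>: "\<phi> \<in> cartier_hom X M N" and \<psi>: "\<psi> \<in> cartier_hom X M N"
    and aff: "\<And>U. U \<in> \<U> \<Longrightarrow> affine_open X U" and cover: "topspace (topo X) \<subseteq> \<Union>\<U>"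
    and eq: "\<And>U. U \<in> \<U> \<Longrightarrow> \<phi> U = \<psi> U"
  shows "\<phi> = \<psi>"
proof (rule cartier_hom_eqI[OF \<phi> \<psi>])
  interpret M: cartier_sheaf q X M by fact
  interpret N: cartier_sheaf q' X N by fact
  note d\<phi> = cartier_homD[OF \<phi>] and d\<psi> = cartier_homD[OF \<psi>]
  fix V m assume V: "openin (topo X) V" and m: "m \<in> carrier (msec M V)"
  show "\<phi> V m = \<psi> V m"
  proof (rule N.eq_if_locally_eq[OF V d\<phi>(3)[OF V m] d\<psi>(3)[OF V m]])
    fix x assume x: "x \<in> V"
    then obtain U where U: "U \<in> \<U>" "x \<in> U"
      using cover openin_subset[OF V] by blast
    note Ua = aff[OF U(1)]
    note Uo = affine_open_openin[OF Ua]
    obtain f where f: "f \<in> carrier (sec X U)" and xD: "x \<in> basic_open X U f" and sub: "basic_open X U f \<subseteq> V \<inter> U"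
      using basic_open_basis[OF M.X Ua openin_Int[OF V Uo]] x U(2) by blast
    define D where "D = basic_open X U f"
    have D: "openin (topo X) D" "D \<subseteq> U" "D \<subseteq> V"
      using openin_basic_open[OF M.X Ua f] sub by (auto simp: D_def)
    have mD: "mres M V D m \<in> carrier (msec M D)"
      using M.mres_closed[OF V D(1,3) m] .
    obtain k :: nat and n where n: "n \<in> carrier (msec M U)"
        and nD: "mres M U D n = res X U D (f [^]\<^bsub>sec X U\<^esub> k) \<odot>\<^bsub>msec M D\<^esub> mres M V D m"
      using M.qcoh_extend[OF Ua f] mD unfolding D_def by metis
    define u where "u = res X U D (f [^]\<^bsub>sec X U\<^esub> k)"
    have u: "u \<in> Units (sec X D)" "u \<in> carrier (sec X D)"
    proof -
      show "u \<in> Units (sec X D)"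
        using M.Unit_pow[OF D(1)] M.res_basic_open_Unit[OF Ua f] M.res_pow[OF Uo D(1,2) f]
        by (simp add: u_def D_def)
      then show "u \<in> carrier (sec X D)"
        by (simp add: Units_def)
    qed
    have "u \<odot>\<^bsub>msec N D\<^esub> \<phi> D (mres M V D m) = \<phi> D (mres M U D n)"
      using d\<phi>(5)[OF D(1) u(2) mD] nD by (simp add: u_def)
    also have "\<dots> = \<psi> D (mres M U D n)"
      using d\<phi>(7)[OF Uo D(1,2) n] d\<psi>(7)[OF Uo D(1,2) n] eq[OF U(1)] by simp
    also have "\<dots> = u \<odot>\<^bsub>msec N D\<^esub> \<psi> D (mres M V D m)"
      using d\<psi>(5)[OF D(1) u(2) mD] nD by (simp add: u_def)
    finally have "\<phi> D (mres M V D m) = \<psi> D (mres M V D m)"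
      by (rule N.smult_Unit_cancel[OF D(1) u(1) d\<phi>(3)[OF D(1) mD] d\<psi>(3)[OF D(1) mD]])
    then have "mres N V D (\<phi> V m) = mres N V D (\<psi> V m)"
      using d\<phi>(7)[OF V D(1,3) m] d\<psi>(7)[OF V D(1,3) m] by simp
    then show "\<exists>W. openin (topo X) W \<and> x \<in> W \<and> W \<subseteq> V \<and> mres N V W (\<phi> V m) = mres N V W (\<psi> V m)"
      using D xD by (auto simp: D_def)
  qed
qed

lemma structure_map_hom:
  assumes X: "ringed_space X" and \<iota>: "\<iota> \<in> ring_hom K (sec X (topspace (topo X)))" and U: "openin (topo X) U"
  shows "structure_map X \<iota> U \<in> ring_hom K (sec X U)"
proof -
  have "res X (topspace (topo X)) U \<circ> \<iota> \<in> ring_hom K (sec X U)"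
    by (rule ring_hom_trans[OF \<iota> ringed_space_res_hom[OF X openin_topspace U openin_subset[OF U]]])
  moreover have "structure_map X \<iota> U = res X (topspace (topo X)) U \<circ> \<iota>"
    by (simp add: structure_map_def fun_eq_iff)
  ultimately show ?thesis
    by simp
qed

lemma Hom_Cart_simps:
  "carrier (Hom_Cart X \<iota> M N) = cartier_hom X M N"
  "openin (topo X) U \<Longrightarrow> m \<in> carrier (msec M U) \<Longrightarrow> \<zero>\<^bsub>Hom_Cart X \<iota> M N\<^esub> U m = \<zero>\<^bsub>msec N U\<^esub>"
  "openin (topo X) U \<Longrightarrow> m \<in> carrier (msec M U) \<Longrightarrow>
    (\<phi> \<oplus>\<^bsub>Hom_Cart X \<iota> M N\<^esub> \<psi>) U m = \<phi> U m \<oplus>\<^bsub>msec N U\<^esub> \<psi> U m"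
  "openin (topo X) U \<Longrightarrow> m \<in> carrier (msec M U) \<Longrightarrow>
    (a \<odot>\<^bsub>Hom_Cart X \<iota> M N\<^esub> \<phi>) U m = structure_map X \<iota> U a \<odot>\<^bsub>msec N U\<^esub> \<phi> U m"
  by (simp_all add: Hom_Cart_def)

lemma Hom_Cart_extensional:
  "\<zero>\<^bsub>Hom_Cart X \<iota> M N\<^esub> \<in> extensional {U. openin (topo X) U}"
  "\<phi> \<oplus>\<^bsub>Hom_Cart X \<iota> M N\<^esub> \<psi> \<in> extensional {U. openin (topo X) U}"
  "a \<odot>\<^bsub>Hom_Cart X \<iota> M N\<^esub> \<phi> \<in> extensional {U. openin (topo X) U}"
  "openin (topo X) U \<Longrightarrow> \<zero>\<^bsub>Hom_Cart X \<iota> M N\<^esub> U \<in> extensional (carrier (msec M U))"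
  "openin (topo X) U \<Longrightarrow> (\<phi> \<oplus>\<^bsub>Hom_Cart X \<iota> M N\<^esub> \<psi>) U \<in> extensional (carrier (msec M U))"
  "openin (topo X) U \<Longrightarrow> (a \<odot>\<^bsub>Hom_Cart X \<iota> M N\<^esub> \<phi>) U \<in> extensional (carrier (msec M U))"
  by (simp_all add: Hom_Cart_def)

text \<open>Scalar multiplication by \<open>a\<close> in \<open>K\<close> commutes with \<open>C\<close> because \<open>a\<^sup>q = a\<close>.\<close>
lemma module_Hom_Cart:
  assumes K: "field K" "finite (carrier K)" "order K = q"
    and \<iota>: "\<iota> \<in> ring_hom K (sec X (topspace (topo X)))"
    and M: "cartier_sheaf q X M" and N: "cartier_sheaf q X N"
  shows "module K (Hom_Cart X \<iota> M N)"
proof -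
  interpret K: field K by fact
  interpret M: cartier_sheaf q X M by fact
  interpret N: cartier_sheaf q X N by fact
  let ?H = "Hom_Cart X \<iota> M N" and ?j = "structure_map X \<iota>"
  have j: "?j U \<in> ring_hom K (sec X U)" if "openin (topo X) U" for U
    by (rule structure_map_hom[OF M.X \<iota> that])
  have jc: "?j U a \<in> carrier (sec X U)" if "openin (topo X) U" "a \<in> carrier K" for U a
    by (rule ring_hom_closed[OF j[OF that(1)] that(2)])
  have jq: "?j U a [^]\<^bsub>sec X U\<^esub> q = ?j U a" if U: "openin (topo X) U" and a: "a \<in> carrier K" for U a
    using ring_hom_nat_pow[OF K.is_cring ringed_space_cring[OF M.X U] j[OF U] a, of q]
      K.power_order_eq_self[OF K(2) a] K(3) by simp
  have jres: "res X U V (?j U a) = ?j V a"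
    if "openin (topo X) U" "openin (topo X) V" "V \<subseteq> U" "a \<in> carrier K" for U V a
    unfolding structure_map_def
    using that ringed_space_res_res[OF M.X openin_topspace that(1,2) openin_subset[OF that(1)] that(3)]
      ring_hom_closed[OF \<iota>] by simp
  have zero: "\<zero>\<^bsub>?H\<^esub> \<in> cartier_hom X M N"
  proof (rule cartier_homI)
    fix U m n assume U: "openin (topo X) U" and m: "m \<in> carrier (msec M U)" and n: "n \<in> carrier (msec M U)"
    interpret MU: module "sec X U" "msec M U" by (rule M.section_module[OF U])
    interpret NU: module "sec X U" "msec N U" by (rule N.section_module[OF U])
    show "\<zero>\<^bsub>?H\<^esub> U (m \<oplus>\<^bsub>msec M U\<^esub> n) = \<zero>\<^bsub>?H\<^esub> U m \<oplus>\<^bsub>msec N U\<^esub> \<zero>\<^bsub>?H\<^esub> U n"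
      using m n by (simp add: Hom_Cart_simps U)
  next
    fix U r m assume U: "openin (topo X) U" and m: "m \<in> carrier (msec M U)" and r: "r \<in> carrier (sec X U)"
    interpret MU: module "sec X U" "msec M U" by (rule M.section_module[OF U])
    interpret NU: module "sec X U" "msec N U" by (rule N.section_module[OF U])
    show "\<zero>\<^bsub>?H\<^esub> U (r \<odot>\<^bsub>msec M U\<^esub> m) = r \<odot>\<^bsub>msec N U\<^esub> \<zero>\<^bsub>?H\<^esub> U m"
      using m r by (simp add: Hom_Cart_simps U)
  qed (simp_all add: Hom_Cart_simps Hom_Cart_extensional M.C_closed M.mres_closed N.C_zero N.mres_zero N.zero_closed)
  have add: "\<phi> \<oplus>\<^bsub>?H\<^esub> \<psi> \<in> cartier_hom X M N"
    if \<phi>: "\<phi> \<in> cartier_hom X M N" and \<psi>: "\<psi> \<in> cartier_hom X M N" for \<phi> \<psi>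
  proof -
    note d = cartier_homD[OF \<phi>] and e = cartier_homD[OF \<psi>]
    show ?thesis
    proof (rule cartier_homI)
      fix U m assume U: "openin (topo X) U" and m: "m \<in> carrier (msec M U)"
      interpret MU: module "sec X U" "msec M U" by (rule M.section_module[OF U])
      interpret NU: module "sec X U" "msec N U" by (rule N.section_module[OF U])
      note c = d(3)[OF U m] e(3)[OF U m]
      show "(\<phi> \<oplus>\<^bsub>?H\<^esub> \<psi>) U m \<in> carrier (msec N U)"
        using c by (simp add: Hom_Cart_simps U m)
      show "(\<phi> \<oplus>\<^bsub>?H\<^esub> \<psi>) U (cmap M U m) = cmap N U ((\<phi> \<oplus>\<^bsub>?H\<^esub> \<psi>) U m)"
        using c by (simp add: Hom_Cart_simps U m M.C_closed d(6) e(6) N.C_add)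
      show "(\<phi> \<oplus>\<^bsub>?H\<^esub> \<psi>) U (m \<oplus>\<^bsub>msec M U\<^esub> n) = (\<phi> \<oplus>\<^bsub>?H\<^esub> \<psi>) U m \<oplus>\<^bsub>msec N U\<^esub> (\<phi> \<oplus>\<^bsub>?H\<^esub> \<psi>) U n"
        if n: "n \<in> carrier (msec M U)" for n
        using c d(3)[OF U n] e(3)[OF U n]
        by (simp add: Hom_Cart_simps U m n d(4)[OF U m n] e(4)[OF U m n] NU.M.a_ac)
      show "(\<phi> \<oplus>\<^bsub>?H\<^esub> \<psi>) U (r \<odot>\<^bsub>msec M U\<^esub> m) = r \<odot>\<^bsub>msec N U\<^esub> (\<phi> \<oplus>\<^bsub>?H\<^esub> \<psi>) U m"
        if r: "r \<in> carrier (sec X U)" for r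
        using c r by (simp add: Hom_Cart_simps U m d(5)[OF U r m] e(5)[OF U r m] NU.smult_r_distr)
      show "mres N U V ((\<phi> \<oplus>\<^bsub>?H\<^esub> \<psi>) U m) = (\<phi> \<oplus>\<^bsub>?H\<^esub> \<psi>) V (mres M U V m)"
        if V: "openin (topo X) V" "V \<subseteq> U" for V
        using c by (simp add: Hom_Cart_simps U m V M.mres_closed[OF U V m] N.mres_add[OF U V]
            d(7)[OF U V m] e(7)[OF U V m])
    qed (simp_all add: Hom_Cart_extensional)
  qed
  have smult: "a \<odot>\<^bsub>?H\<^esub> \<phi> \<in> cartier_hom X M N"
    if a: "a \<in> carrier K" and \<phi>: "\<phi> \<in> cartier_hom X M N" for a \<phi>
  proof -
    note d = cartier_homD[OF \<phi>]
    show ?thesis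
    proof (rule cartier_homI)
      fix U m assume U: "openin (topo X) U" and m: "m \<in> carrier (msec M U)"
      interpret MU: module "sec X U" "msec M U" by (rule M.section_module[OF U])
      interpret NU: module "sec X U" "msec N U" by (rule N.section_module[OF U])
      note c = d(3)[OF U m] jc[OF U a]
      show "(a \<odot>\<^bsub>?H\<^esub> \<phi>) U m \<in> carrier (msec N U)"
        using c by (simp add: Hom_Cart_simps U m)
      show "(a \<odot>\<^bsub>?H\<^esub> \<phi>) U (cmap M U m) = cmap N U ((a \<odot>\<^bsub>?H\<^esub> \<phi>) U m)"
        using c N.C_smult[OF U c(2,1)] by (simp add: Hom_Cart_simps U m M.C_closed d(6) jq[OF U a])
      show "(a \<odot>\<^bsub>?H\<^esub> \<phi>) U (m \<oplus>\<^bsub>msec M U\<^esub> n) = (a \<odot>\<^bsub>?H\<^esub> \<phi>) U m \<oplus>\<^bsub>msec N U\<^esub> (a \<odot>\<^bsub>?H\<^esub> \<phi>) U n"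
        if n: "n \<in> carrier (msec M U)" for n
        using c d(3)[OF U n] by (simp add: Hom_Cart_simps U m n d(4)[OF U m n] NU.smult_r_distr)
      show "(a \<odot>\<^bsub>?H\<^esub> \<phi>) U (r \<odot>\<^bsub>msec M U\<^esub> m) = r \<odot>\<^bsub>msec N U\<^esub> (a \<odot>\<^bsub>?H\<^esub> \<phi>) U m"
        if r: "r \<in> carrier (sec X U)" for r
        using c r by (simp add: Hom_Cart_simps U m d(5)[OF U r m] NU.smult_assoc1[symmetric] MU.R.m_comm)
      show "mres N U V ((a \<odot>\<^bsub>?H\<^esub> \<phi>) U m) = (a \<odot>\<^bsub>?H\<^esub> \<phi>) V (mres M U V m)"
        if V: "openin (topo X) V" "V \<subseteq> U" for V
        using c by (simp add: Hom_Cart_simps U m V M.mres_closed[OF U V m] N.mres_smult[OF U V]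
            d(7)[OF U V m] jres[OF U V a])
    qed (simp_all add: Hom_Cart_extensional)
  qed
  have NM: "module (sec X U) (msec N U)" if "openin (topo X) U" for U
    by (rule N.section_module[OF that])
  note dist = module.smult_l_distr[OF NM] module.smult_r_distr[OF NM] module.smult_assoc1[OF NM] module.smult_one[OF NM]
  have ag: "abelian_group (msec N U)" if "openin (topo X) U" for U
    using NM[OF that] by (simp add: module_def)
  show ?thesis
  proof (rule moduleI)
    show "cring K"
      by (rule K.is_cring)
    show "abelian_group ?H"
    proof (rule abelian_groupI)
      fix \<phi> \<psi> \<chi> assume h: "\<phi> \<in> carrier ?H" "\<psi> \<in> carrier ?H" "\<chi> \<in> carrier ?H"
      then have h': "\<phi> \<in> cartier_hom X M N" "\<psi> \<in> cartier_hom X M N" "\<chi> \<in> cartier_hom X M N"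
        by (simp_all add: Hom_Cart_simps(1))
      note v = cartier_homD(3)[OF h'(1)] cartier_homD(3)[OF h'(2)] cartier_homD(3)[OF h'(3)]
      show "\<phi> \<oplus>\<^bsub>?H\<^esub> \<psi> \<oplus>\<^bsub>?H\<^esub> \<chi> = \<phi> \<oplus>\<^bsub>?H\<^esub> (\<psi> \<oplus>\<^bsub>?H\<^esub> \<chi>)"
        by (rule cartier_hom_eqI[of _ X M N])
          (simp_all add: Hom_Cart_simps add h' v abelian_monoid.a_assoc[OF abelian_group.axioms(1)[OF ag]])
    next
      fix \<phi> \<psi> assume h: "\<phi> \<in> carrier ?H" "\<psi> \<in> carrier ?H"
      then have h': "\<phi> \<in> cartier_hom X M N" "\<psi> \<in> cartier_hom X M N"
        by (simp_all add: Hom_Cart_simps(1))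
      note v = cartier_homD(3)[OF h'(1)] cartier_homD(3)[OF h'(2)]
      show "\<phi> \<oplus>\<^bsub>?H\<^esub> \<psi> \<in> carrier ?H"
        using add h' by (simp add: Hom_Cart_simps(1))
      show "\<phi> \<oplus>\<^bsub>?H\<^esub> \<psi> = \<psi> \<oplus>\<^bsub>?H\<^esub> \<phi>"
        by (rule cartier_hom_eqI[of _ X M N])
          (simp_all add: Hom_Cart_simps add h' v abelian_monoid.a_comm[OF abelian_group.axioms(1)[OF ag]])
    next
      fix \<phi> assume "\<phi> \<in> carrier ?H"
      then have h: "\<phi> \<in> cartier_hom X M N"
        by (simp add: Hom_Cart_simps(1))
      note v = cartier_homD(3)[OF h]
      show "\<zero>\<^bsub>?H\<^esub> \<oplus>\<^bsub>?H\<^esub> \<phi> = \<phi>"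
        by (rule cartier_hom_eqI[of _ X M N])
          (simp_all add: Hom_Cart_simps add zero h v abelian_monoid.l_zero[OF abelian_group.axioms(1)[OF ag]])
      have "(\<ominus>\<^bsub>K\<^esub> \<one>\<^bsub>K\<^esub>) \<odot>\<^bsub>?H\<^esub> \<phi> \<oplus>\<^bsub>?H\<^esub> \<phi> = \<zero>\<^bsub>?H\<^esub>"
      proof (rule cartier_hom_eqI[of _ X M N])
        show "(\<ominus>\<^bsub>K\<^esub> \<one>\<^bsub>K\<^esub>) \<odot>\<^bsub>?H\<^esub> \<phi> \<oplus>\<^bsub>?H\<^esub> \<phi> \<in> cartier_hom X M N"
          by (intro add smult h) simp
        fix U m assume U: "openin (topo X) U" and m: "m \<in> carrier (msec M U)"
        interpret NU: module "sec X U" "msec N U" by (rule N.section_module[OF U])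
        interpret jU: ring_hom_cring K "sec X U" "?j U"
          by (rule ring_hom_cring.intro[OF K.is_cring ringed_space_cring[OF M.X U] ring_hom_cring_axioms.intro[OF j[OF U]]])
        show "((\<ominus>\<^bsub>K\<^esub> \<one>\<^bsub>K\<^esub>) \<odot>\<^bsub>?H\<^esub> \<phi> \<oplus>\<^bsub>?H\<^esub> \<phi>) U m = \<zero>\<^bsub>?H\<^esub> U m"
          using v[OF U m] by (simp add: Hom_Cart_simps U m NU.smult_l_minus NU.M.l_neg)
      qed (rule zero)
      moreover have "(\<ominus>\<^bsub>K\<^esub> \<one>\<^bsub>K\<^esub>) \<odot>\<^bsub>?H\<^esub> \<phi> \<in> carrier ?H"
        using smult h by (simp add: Hom_Cart_simps(1))
      ultimately show "\<exists>\<psi> \<in> carrier ?H. \<psi> \<oplus>\<^bsub>?H\<^esub> \<phi> = \<zero>\<^bsub>?H\<^esub>"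
        by blast
    qed (simp add: Hom_Cart_simps(1) zero)
    fix \<phi> assume "\<phi> \<in> carrier ?H"
    then have h: "\<phi> \<in> cartier_hom X M N"
      by (simp add: Hom_Cart_simps(1))
    note v = cartier_homD(3)[OF h]
    show "\<one>\<^bsub>K\<^esub> \<odot>\<^bsub>?H\<^esub> \<phi> = \<phi>"
      by (rule cartier_hom_eqI[of _ X M N])
        (simp_all add: Hom_Cart_simps smult h v ring_hom_one[OF j] dist)
    fix a assume a: "a \<in> carrier K"
    show "a \<odot>\<^bsub>?H\<^esub> \<phi> \<in> carrier ?H"
      using smult a h by (simp add: Hom_Cart_simps(1))
    show "(a \<oplus>\<^bsub>K\<^esub> b) \<odot>\<^bsub>?H\<^esub> \<phi> = a \<odot>\<^bsub>?H\<^esub> \<phi> \<oplus>\<^bsub>?H\<^esub> b \<odot>\<^bsub>?H\<^esub> \<phi>" if b: "b \<in> carrier K" for b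
      by (rule cartier_hom_eqI[of _ X M N])
        (simp_all add: Hom_Cart_simps smult add a b h v jc ring_hom_add[OF j] dist)
    show "(a \<otimes>\<^bsub>K\<^esub> b) \<odot>\<^bsub>?H\<^esub> \<phi> = a \<odot>\<^bsub>?H\<^esub> (b \<odot>\<^bsub>?H\<^esub> \<phi>)" if b: "b \<in> carrier K" for b
      by (rule cartier_hom_eqI[of _ X M N])
        (simp_all add: Hom_Cart_simps smult add a b h v jc ring_hom_mult[OF j] dist)
    show "a \<odot>\<^bsub>?H\<^esub> (\<phi> \<oplus>\<^bsub>?H\<^esub> \<psi>) = a \<odot>\<^bsub>?H\<^esub> \<phi> \<oplus>\<^bsub>?H\<^esub> a \<odot>\<^bsub>?H\<^esub> \<psi>" if "\<psi> \<in> carrier ?H" for \<psi>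
    proof -
      have h2: "\<psi> \<in> cartier_hom X M N"
        using that by (simp add: Hom_Cart_simps(1))
      show ?thesis
        by (rule cartier_hom_eqI[of _ X M N])
          (simp_all add: Hom_Cart_simps smult add a h h2 v cartier_homD(3)[OF h2] jc dist)
    qed
  qed
qed

lemma (in module) finite_imp_finitely_generated:
  assumes "finite (carrier M)"
  shows "finitely_generated R M"
proof -
  have "\<exists>c \<in> carrier M \<rightarrow> carrier R. m = (\<Oplus>\<^bsub>M\<^esub>b\<in>carrier M. c b \<odot>\<^bsub>M\<^esub> b)" if m: "m \<in> carrier M" for m
  proof
    let ?c = "\<lambda>b. if b = m then \<one> else \<zero>"
    show "?c \<in> carrier M \<rightarrow> carrier R"
      by auto
    have "(\<Oplus>\<^bsub>M\<^esub>b\<in>carrier M. ?c b \<odot>\<^bsub>M\<^esub> b) = (\<Oplus>\<^bsub>M\<^esub>b\<in>carrier M. if m = b then b else \<zero>\<^bsub>M\<^esub>)"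
      by (rule M.finsum_cong') auto
    also have "\<dots> = m"
      using M.add.finprod_singleton[OF m assms, of "\<lambda>b. b"] by simp
    finally show "m = (\<Oplus>\<^bsub>M\<^esub>b\<in>carrier M. ?c b \<odot>\<^bsub>M\<^esub> b)" ..
  qed
  then show ?thesis
    using assms unfolding finitely_generated_def by blast
qed

theorem finite_cartier_hom:
  assumes K: "field K" "finite (carrier K)" "order K = q" and X: "scheme_over K X \<iota>"
    and noeth: "locally_noetherian X" and qc: "quasi_compact X" and ff: "F_finite q X"
    and M: "coherent_cartier_module q X M" and N: "coherent_cartier_module q X N"
    and nil: "largest_nilpotent_submodule q X N (\<lambda>U. {\<zero>\<^bsub>msec N U\<^esub>})"
  shows "finite (cartier_hom X M N)"
proof -
  interpret K: field K by fact
  have q: "0 < q"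
    using K.order_ge_two K by simp
  have rX: "ringed_space X" and \<iota>: "\<iota> \<in> ring_hom K (sec X (topspace (topo X)))"
    using X by (simp_all add: scheme_over_def scheme_def)
  interpret M: cartier_sheaf q X M
    using rX M by (simp add: cartier_sheaf_def coherent_cartier_module_def)
  interpret N: cartier_sheaf q X N
    using rX N by (simp add: cartier_sheaf_def coherent_cartier_module_def)
  let ?\<U> = "{U. affine_open X U \<and> noetherian_ring (sec X U)}"
  have "(\<forall>U \<in> ?\<U>. openin (topo X) U) \<and> topspace (topo X) \<subseteq> \<Union>?\<U>"
    using noeth affine_open_openin unfolding locally_noetherian_def by blast
  from qc[unfolded quasi_compact_def compact_space_alt, THEN spec, THEN mp, OF this]
  obtain \<U> where \<U>: "finite \<U>" "\<U> \<subseteq> ?\<U>" "topspace (topo X) \<subseteq> \<Union>\<U>"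
    by (elim exE conjE)
  let ?S = "\<lambda>U. {f \<in> linear_maps (sec X U) (msec M U) (msec N U).
    \<forall>m \<in> carrier (msec M U). f (cmap M U m) = cmap N U (f m)}"
  have fin: "finite (?S U)" if "U \<in> \<U>" for U
  proof -
    have U: "affine_open X U" and nU: "noetherian_ring (sec X U)"
      using that \<U>(2) by auto
    note Uo = affine_open_openin[OF U]
    show ?thesis
    proof (rule finite_cartier_linear_maps[OF nU M.section_module[OF Uo] N.section_module[OF Uo] _ _ _ _ _ _ _ K])
      show "finitely_generated (sec X U) (msec M U)" "finitely_generated (sec X U) (msec N U)"
        using M N U by (simp_all add: coherent_cartier_module_def coherent_def)
      show "structure_map X \<iota> U \<in> ring_hom K (sec X U)"
        by (rule structure_map_hom[OF rX \<iota> Uo])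
      show "x = \<zero>\<^bsub>msec N U\<^esub>" if "x \<in> carrier (msec N U)"
        "\<And>r. r \<in> carrier (sec X U) \<Longrightarrow> cmap N U (r \<odot>\<^bsub>msec N U\<^esub> x) = \<zero>\<^bsub>msec N U\<^esub>" for x
        by (rule N.no_nilpotent_submodule_affine[OF ff q nil U that])
    qed (use M.C_closed[OF Uo] N.C_closed[OF Uo] N.C_add[OF Uo] N.C_smult[OF Uo] in auto)
  qed
  let ?r = "\<lambda>\<phi>. \<lambda>U \<in> \<U>. \<phi> U"
  have "inj_on ?r (cartier_hom X M N)"
  proof (rule inj_onI)
    fix \<phi> \<psi> assume h: "\<phi> \<in> cartier_hom X M N" "\<psi> \<in> cartier_hom X M N" "?r \<phi> = ?r \<psi>"
    have eq: "\<phi> U = \<psi> U" if "U \<in> \<U>" for U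
      using fun_cong[OF h(3), of U] that by simp
    show "\<phi> = \<psi>"
      by (rule cartier_hom_eqI_affine_cover[OF M.cartier_sheaf_axioms N.cartier_sheaf_axioms h(1,2) _ \<U>(3) eq])
        (use \<U>(2) in auto)
  qed
  moreover have "?r ` cartier_hom X M N \<subseteq> Pi\<^sub>E \<U> ?S"
  proof (clarify intro!: PiE_I)
    fix \<phi> assume \<phi>: "\<phi> \<in> cartier_hom X M N"
    have "\<phi> U \<in> ?S U" if "U \<in> \<U>" for U
    proof -
      have Uo: "openin (topo X) U"
        using that \<U>(2) affine_open_openin by blast
      show ?thesis
        using cartier_homD(2,4,5,6)[OF \<phi>] Uo unfolding linear_maps_def by simp
    qed
    then show "?r \<phi> \<in> Pi\<^sub>E \<U> ?S"
      by (rule restrict_PiE_iff[THEN iffD2, rule_format])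
  qed
  moreover have "finite (Pi\<^sub>E \<U> ?S)"
    using \<U>(1) fin by (rule finite_PiE)
  ultimately show ?thesis
    using finite_imageD finite_subset by blast
qed

theorem theorem4p17:
  fixes p n q :: nat
    and K :: "'k ring"
    and X :: "('a, 'b) ringed_space"
    and \<iota> :: "'k \<Rightarrow> 'b"
    and M :: "('a, 'b, 'm) cartier"
    and N :: "('a, 'b, 'n) cartier"
  assumes "prime p" and "n > 0" and "q = p ^ n"
    and "field K" and "order K = q"
    and "scheme_over K X \<iota>"
    and "locally_noetherian X"
    and "quasi_compact X"
    and "separated_over TYPE('c) TYPE('d) K X \<iota>"
    and "F_finite q X"
    and "coherent_cartier_module q X M"
    and "coherent_cartier_module q X N"
    and "structural_map_surjective X M"
    and "largest_nilpotent_submodule q X N (\<lambda>U. {\<zero>\<^bsub>msec N U\<^esub>})"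
  shows "module K (Hom_Cart X \<iota> M N)
    \<and> finitely_generated K (Hom_Cart X \<iota> M N)
    \<and> finite (carrier (Hom_Cart X \<iota> M N))"
proof -
  have "0 < order K"
    using assms(1,3,5) by (simp add: prime_gt_0_nat)
  then have finK: "finite (carrier K)"
    by (simp add: order_def card_gt_0_iff)
  have rX: "ringed_space X" and \<iota>: "\<iota> \<in> ring_hom K (sec X (topspace (topo X)))"
    using assms(6) by (simp_all add: scheme_over_def scheme_def)
  have M: "cartier_sheaf q X M" and N: "cartier_sheaf q X N"
    using rX assms(11,12) by (simp_all add: cartier_sheaf_def coherent_cartier_module_def)
  interpret H: module K "Hom_Cart X \<iota> M N"
    by (rule module_Hom_Cart[OF assms(4) finK assms(5) \<iota> M N])
  have "finite (carrier (Hom_Cart X \<iota> M N))"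
    using finite_cartier_hom[OF assms(4) finK assms(5,6,7,8,10,11,12,14)] by (simp add: Hom_Cart_simps(1))
  then show ?thesis
    using H.module_axioms H.finite_imp_finitely_generated by blast
qed

end
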